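(* Let $A\in\mathbb{R}^{n\times n}$ be SPSD with eigenvalues $\lambda_1\ge\dots\ge\lambda_n\ge 0$, let $1\le k<n$ with $\lambda_k>0$, let $\gamma=\lambda_{k+1}/\lambda_k$ and $\Lambda_2=\mathrm{diag}(\lambda_{k+1},\dots,\lambda_n)$. Let $p\ge 0$ and $q\ge 1$ be integers, let $\Omega$ be an $n\times(k+p)$ Gaussian random matrix, let $\widehat{A}_{q,k+p}$ be the Nyström approximation of $A$ built from $\Omega$, and let $f:[0,\infty)\to[0,\infty)$ be operator monotone with $f(0)=0$. Suppose that $k,p,q\ge 2$. Then $$\mathbb{E}\,\|f(A)-f(\widehat{A}_{q,k+p})\|_F^2\;\le\;\Big(1+5\,\gamma^{2(q-3/2)}\,\frac{k}{p-1}\Big)\,\|f(\Lambda_2)\|_F^2 .$$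
   Context: SPSD means symmetric positive semi-definite. A Gaussian random matrix has i.i.d. standard normal entries. The Nyström approximation is $$\widehat{A}_{q,k+p}=A^q\Omega\,(\Omega^TA^{2q-1}\Omega)^{\dagger}\,(A^q\Omega)^T,$$ where $\dagger$ denotes the Moore–Penrose pseudoinverse; it is SPSD. For a symmetric matrix $B=V\,\mathrm{diag}(\mu_1,\dots,\mu_n)V^T$ with $V$ orthogonal, $f(B)=V\,\mathrm{diag}(f(\mu_1),\dots,f(\mu_n))V^T$. A function $f:[0,\infty)\to[0,\infty)$ is operator monotone if for every size and all SPSD matrices $B,C$ with $B\succeq C$ (i.e. $B-C$ SPSD) one has $f(B)\succeq f(C)$. $\|\cdot\|_F$ is the Frobenius norm. *)

theory Defs
  imports "HOL-Probability.Probability" "Jordan_Normal_Form.Char_Poly"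
begin

text \<open>Throughout, matrices are those of \<^theory>\<open>Jordan_Normal_Form.Matrix\<close>, whose dimensions are
  ordinary natural numbers, because operator monotonicity quantifies over all matrix sizes.\<close>

definition spsd :: "nat \<Rightarrow> real mat \<Rightarrow> bool" where
  "spsd n B \<longleftrightarrow> B \<in> carrier_mat n n \<and> transpose_mat B = B \<and>
     (\<forall>x \<in> carrier_vec n. 0 \<le> scalar_prod x (B *\<^sub>v x))"

text \<open>The predicate \<^const>\<open>orthogonal_mat\<close> of the matrix library does not require normalized
  columns, hence this definition.\<close>

definition orth_mat :: "nat \<Rightarrow> real mat \<Rightarrow> bool" where
  "orth_mat n V \<longleftrightarrow> V \<in> carrier_mat n n \<and> transpose_mat V * V = 1\<^sub>m n"

definition is_mat_fun :: "(real \<Rightarrow> real) \<Rightarrow> real mat \<Rightarrow> real mat \<Rightarrow> bool" where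
  "is_mat_fun f B C \<longleftrightarrow> (\<exists>V \<mu>. orth_mat (dim_row B) V \<and>
     B = V * mat_diag (dim_row B) \<mu> * transpose_mat V \<and>
     C = V * mat_diag (dim_row B) (\<lambda>i. f (\<mu> i)) * transpose_mat V)"

lemma is_mat_fun_unique:
  assumes "is_mat_fun f B C" and "is_mat_fun f B C'"
  shows "C = C'"
proof -
  define n where "n = dim_row B"
  from assms obtain V \<mu> W \<nu> where
    V: "V \<in> carrier_mat n n" "transpose_mat V * V = 1\<^sub>m n" and
    BV: "B = V * mat_diag n \<mu> * transpose_mat V" and
    C: "C = V * mat_diag n (\<lambda>i. f (\<mu> i)) * transpose_mat V" and
    W: "W \<in> carrier_mat n n" "transpose_mat W * W = 1\<^sub>m n" and
    BW: "B = W * mat_diag n \<nu> * transpose_mat W" and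
    C': "C' = W * mat_diag n (\<lambda>i. f (\<nu> i)) * transpose_mat W"
    unfolding is_mat_fun_def orth_mat_def n_def by blast
  define U where "U = transpose_mat W * V"
  have D[simp]: "mat_diag n g \<in> carrier_mat n n" for g :: "nat \<Rightarrow> real" by simp
  have Vt[simp]: "transpose_mat V \<in> carrier_mat n n" and Wt[simp]: "transpose_mat W \<in> carrier_mat n n"
    and U[simp]: "U \<in> carrier_mat n n" using V(1) W(1) by (auto simp: U_def)
  have WW: "W * transpose_mat W = 1\<^sub>m n" and VV: "V * transpose_mat V = 1\<^sub>m n"
    using mat_mult_left_right_inverse[OF Wt W(1) W(2)] mat_mult_left_right_inverse[OF Vt V(1) V(2)]
    by auto
  have VU: "V = W * U"
  proof -
    have "W * U = W * transpose_mat W * V" unfolding U_def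
      using assoc_mult_mat[OF W(1) Wt V(1)] by simp
    thus ?thesis using WW V(1) by simp
  qed
  have conj: "transpose_mat W * (V * mat_diag n g * transpose_mat V) * V = U * mat_diag n g"
    for g :: "nat \<Rightarrow> real"
  proof -
    have "transpose_mat W * (V * mat_diag n g * transpose_mat V) * V
       = transpose_mat W * (V * mat_diag n g * transpose_mat V * V)"
      by (rule assoc_mult_mat[of _ n n _ n _ n]) (use V(1) W(1) in auto)
    also have "V * mat_diag n g * transpose_mat V * V = V * mat_diag n g * (transpose_mat V * V)"
      by (rule assoc_mult_mat[of _ n n _ n _ n]) (use V(1) W(1) in auto)
    also have "\<dots> = V * mat_diag n g"
      using V(2) right_mult_one_mat[OF mult_carrier_mat[OF V(1) D]] by simp
    also have "transpose_mat W * (V * mat_diag n g) = U * mat_diag n g" unfolding U_def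
      by (rule assoc_mult_mat[of _ n n _ n _ n, symmetric]) (use V(1) W(1) in auto)
    finally show ?thesis .
  qed
  have conj': "transpose_mat W * (W * mat_diag n g * transpose_mat W) * V = mat_diag n g * U"
    for g :: "nat \<Rightarrow> real"
  proof -
    have "transpose_mat W * (W * mat_diag n g * transpose_mat W)
        = transpose_mat W * (W * mat_diag n g) * transpose_mat W"
      by (rule assoc_mult_mat[of _ n n _ n _ n, symmetric]) (use W(1) in auto)
    also have "transpose_mat W * (W * mat_diag n g) = transpose_mat W * W * mat_diag n g"
      by (rule assoc_mult_mat[of _ n n _ n _ n, symmetric]) (use W(1) in auto)
    also have "\<dots> = mat_diag n g" using W(2) left_mult_one_mat[OF D] by simp
    finally show ?thesis unfolding U_def
      using assoc_mult_mat[OF D Wt V(1)] by simp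
  qed
  have eq: "U * mat_diag n \<mu> = mat_diag n \<nu> * U" 
    using conj[of \<mu>, folded BV] conj'[of \<nu>, folded BW] by (rule trans[OF sym])
  have ent: "U $$ (i, j) * \<mu> j = \<nu> i * U $$ (i, j)" if "i < n" "j < n" for i j
    using arg_cong[OF eq, of "\<lambda>X. X $$ (i, j)"] that
    by (simp add: mat_diag_mult_right[OF U] mat_diag_mult_left[OF U])
  have eqf: "U * mat_diag n (\<lambda>i. f (\<mu> i)) = mat_diag n (\<lambda>i. f (\<nu> i)) * U"
    unfolding mat_diag_mult_right[OF U] mat_diag_mult_left[OF U]
  proof (rule eq_matI, goal_cases)
    case (1 i j)
    hence ij: "i < n" "j < n" by simp_all
    hence "U $$ (i, j) = 0 \<or> \<mu> j = \<nu> i"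
      using ent[of i j] by (metis mult.commute mult_cancel_left)
    thus ?case using ij by auto
  qed auto
  have undo: "W * (transpose_mat W * X * V) * transpose_mat V = X" if X: "X \<in> carrier_mat n n" for X
  proof -
    have "W * (transpose_mat W * X * V) = W * (transpose_mat W * (X * V))"
      using assoc_mult_mat[OF Wt X V(1)] by simp
    also have "\<dots> = W * transpose_mat W * (X * V)"
      by (rule assoc_mult_mat[of _ n n _ n _ n, symmetric]) (use V(1) W(1) X in auto)
    also have "\<dots> = X * V"
      using WW left_mult_one_mat[OF mult_carrier_mat[OF X V(1)]] by simp
    finally show ?thesis using assoc_mult_mat[OF X V(1) Vt] VV X by simp
  qed
  have cC: "C \<in> carrier_mat n n" "C' \<in> carrier_mat n n" using V(1) W(1) by (auto simp: C C')
  have e: "transpose_mat W * C * V = transpose_mat W * C' * V"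
    unfolding conj[of "\<lambda>i. f (\<mu> i)", folded C] conj'[of "\<lambda>i. f (\<nu> i)", folded C'] by (rule eqf)
  show ?thesis by (rule trans[OF sym[OF undo[OF cC(1)]] undo[OF cC(2), folded e]])
qed

text \<open>For symmetric \<open>B\<close> the matrix \<open>f(B)\<close> exists by the spectral theorem; it is independent of the
  chosen diagonalization by \<open>is_mat_fun_unique\<close>.\<close>

definition mat_fun :: "(real \<Rightarrow> real) \<Rightarrow> real mat \<Rightarrow> real mat" where
  "mat_fun f B = (THE C. is_mat_fun f B C)"

text \<open>A function on \<open>[0, \<infinity>)\<close> is represented by a total function on the reals of which only the
  values at nonnegative arguments matter.\<close>

definition operator_monotone :: "(real \<Rightarrow> real) \<Rightarrow> bool" where
  "operator_monotone f \<longleftrightarrow> (\<forall>x \<ge> 0. 0 \<le> f x) \<and>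
     (\<forall>n B C. spsd n B \<longrightarrow> spsd n C \<longrightarrow> spsd n (B - C) \<longrightarrow> spsd n (mat_fun f B - mat_fun f C))"

text \<open>The four Penrose equations.\<close>

definition is_pinv :: "real mat \<Rightarrow> real mat \<Rightarrow> bool" where
  "is_pinv B X \<longleftrightarrow> X \<in> carrier_mat (dim_col B) (dim_row B) \<and>
     B * X * B = B \<and> X * B * X = X \<and>
     transpose_mat (B * X) = B * X \<and> transpose_mat (X * B) = X * B"

lemma is_pinv_unique:
  assumes "is_pinv B X" and "is_pinv B Y"
  shows "X = Y"
proof -
  define n m where "n = dim_row B" and "m = dim_col B"
  have B: "B \<in> carrier_mat n m" by (simp add: n_def m_def)
  have X: "X \<in> carrier_mat m n" "B * X * B = B" "X * B * X = X"
      "transpose_mat (B * X) = B * X" "transpose_mat (X * B) = X * B"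
    and Y: "Y \<in> carrier_mat m n" "B * Y * B = B" "Y * B * Y = Y"
      "transpose_mat (B * Y) = B * Y" "transpose_mat (Y * B) = Y * B"
    using assms by (auto simp: is_pinv_def n_def m_def)
  have "B * X = B * Y * (B * X)"
    using assoc_mult_mat[OF mult_carrier_mat[OF B Y(1)] B X(1)] Y(2) by simp
  hence "B * X = transpose_mat (B * Y * (B * X))" using X(4) by simp
  also have "\<dots> = B * X * (B * Y)"
    using transpose_mult[OF mult_carrier_mat[OF B Y(1)] mult_carrier_mat[OF B X(1)]] X(4) Y(4) by simp
  also have "\<dots> = B * Y"
    using assoc_mult_mat[OF mult_carrier_mat[OF B X(1)] B Y(1)] X(2) by simp
  finally have BX: "B * X = B * Y" .
  have "X * B = X * B * (Y * B)"
    using assoc_mult_mat[OF X(1) B mult_carrier_mat[OF Y(1) B]] assoc_mult_mat[OF B Y(1) B] Y(2) by simp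
  hence "X * B = transpose_mat (X * B * (Y * B))" using X(5) by simp
  also have "\<dots> = Y * B * (X * B)"
    using transpose_mult[OF mult_carrier_mat[OF X(1) B] mult_carrier_mat[OF Y(1) B]] X(5) Y(5) by simp
  also have "\<dots> = Y * B"
    using assoc_mult_mat[OF Y(1) B mult_carrier_mat[OF X(1) B]] assoc_mult_mat[OF B X(1) B] X(2) by simp
  finally have XB: "X * B = Y * B" .
  have "X = X * (B * X)" using assoc_mult_mat[OF X(1) B X(1)] X(3) by simp
  also have "\<dots> = Y * B * Y" using BX XB assoc_mult_mat[OF X(1) B Y(1)] by simp
  finally show ?thesis using Y(3) by simp
qed

definition pinv :: "real mat \<Rightarrow> real mat" where
  "pinv B = (THE X. is_pinv B X)"

definition nystrom :: "real mat \<Rightarrow> nat \<Rightarrow> real mat \<Rightarrow> real mat" where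
  "nystrom A q W = (A ^\<^sub>m q * W) * pinv (transpose_mat W * A ^\<^sub>m (2 * q - 1) * W) *
     transpose_mat (A ^\<^sub>m q * W)"

definition frobenius_norm :: "real mat \<Rightarrow> real" where
  "frobenius_norm B = sqrt (\<Sum>i<dim_row B. \<Sum>j<dim_col B. (B $$ (i, j))\<^sup>2)"

definition (in prob_space) gaussian_matrix :: "nat \<Rightarrow> nat \<Rightarrow> ('a \<Rightarrow> real mat) \<Rightarrow> bool" where
  "gaussian_matrix n m W \<longleftrightarrow>
     (\<forall>w \<in> space M. W w \<in> carrier_mat n m) \<and>
     indep_vars (\<lambda>_. borel) (\<lambda>ij w. W w $$ ij) ({..<n} \<times> {..<m}) \<and>
     (\<forall>ij \<in> {..<n} \<times> {..<m}.
        distributed M lborel (\<lambda>w. W w $$ ij) (\<lambda>x. ennreal (std_normal_density x)))"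

text \<open>\<open>lam 1 \<ge> \<dots> \<ge> lam n\<close> are the eigenvalues of \<open>A\<close>, with multiplicity.\<close>

definition ordered_eigenvalues :: "nat \<Rightarrow> real mat \<Rightarrow> (nat \<Rightarrow> real) \<Rightarrow> bool" where
  "ordered_eigenvalues n A lam \<longleftrightarrow>
     char_poly A = (\<Prod>i = 1..n. [:- lam i, 1:]) \<and> antimono_on {1..n} lam"

end

theory Submission
  imports Defs "HOL-Real_Asymp.Real_Asymp"
begin

text \<open>
  Deterministic part. For SPSD \<open>B\<close> below \<open>A\<close>, operator monotonicity gives
  \<open>\<parallel>f(A) - f(B)\<parallel>\<^sup>2 \<le> \<parallel>f(A)\<parallel>\<^sup>2 - \<parallel>f(B)\<parallel>\<^sup>2\<close>. As \<open>f\<close> is concave, \<open>f(x)/x\<close> decreases, and with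
  \<open>g = f(\<lambda>\<^sub>k)/\<lambda>\<^sub>k\<close> the right-hand side is at most
  \<open>\<parallel>f(\<Lambda>\<^sub>2)\<parallel>\<^sup>2 + g\<^sup>2 (\<parallel>\<Lambda>\<^sub>1\<parallel>\<^sup>2 - \<parallel>B\<parallel>\<^sup>2)\<close>. For the Nystrom approximation
  \<open>B = A\<^bsup>1/2\<^esup> P A\<^bsup>1/2\<^esup>\<close>, where \<open>P\<close> projects onto the range of \<open>Y = A\<^bsup>q-1/2\<^esup> \<Omega>\<close>; in the
  eigenbasis of \<open>A\<close> one has \<open>1 - P\<^sub>i\<^sub>i \<le> \<parallel>e\<^sub>i - Y c\<parallel>\<^sup>2\<close> for every \<open>c\<close>.

  Probabilistic part. Let \<open>G\<close> be \<open>\<Omega>\<close> in the eigenbasis, with row blocks \<open>G\<^sub>1\<close>, \<open>G\<^sub>2\<close>. The vector \<open>c\<close>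
  is taken from the columns of \<open>X = G\<^sub>1\<^sup>T R\<close>, \<open>R = (G\<^sub>1 G\<^sub>1\<^sup>T + \<epsilon>)\<inverse>\<close>. Gaussian
  integration by parts in the entries of \<open>\<Omega>\<close> yields \<open>(p - 1) E tr R \<le> k\<close> and
  \<open>E (G\<^sub>2 X)\<^sub>s\<^sub>i\<^sup>2 \<le> E R\<^sub>i\<^sub>i\<close> without using rotation invariance; the regularization makes all
  integrands tame, and \<open>\<epsilon>\<close> is sent to \<open>0\<close> in the final numerical bound only. The constant
  obtained in place of \<open>5\<close> is \<open>2\<close>.
\<close>

section \<open>The spectral theorem\<close>

lemma symmetric_eigenvalue_real:
  fixes A :: "real mat"
  assumes A: "A \<in> carrier_mat n n" and sym: "transpose_mat A = A"
    and ev: "eigenvector (map_mat complex_of_real A) v a"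
  shows "a \<in> \<real>"
proof -
  let ?A = "map_mat complex_of_real A"
  have v: "v \<in> carrier_vec n" and v0: "v \<noteq> 0\<^sub>v n" and e: "?A *\<^sub>v v = a \<cdot>\<^sub>v v"
    using ev A by (auto simp: eigenvector_def)
  have row: "(\<Sum>j<n. of_real (A $$ (i, j)) * v $ j) = a * v $ i" if "i < n" for i
    using arg_cong[OF e, of "\<lambda>u. u $ i"] that A v
    by (simp add: mult_mat_vec_def scalar_prod_def lessThan_atLeast0)
  define s where "s = (\<Sum>i<n. \<Sum>j<n. cnj (v $ i) * of_real (A $$ (i, j)) * v $ j)"
  define N where "N = (\<Sum>i<n. (cmod (v $ i))\<^sup>2)"
  have symA: "A $$ (i, j) = A $$ (j, i)" if "i < n" "j < n" for i j
    using arg_cong[OF sym, of "\<lambda>B. B $$ (i, j)"] that A by simp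
  have "s = (\<Sum>i<n. cnj (v $ i) * (a * v $ i))"
    unfolding s_def using row by (intro sum.cong) (auto simp: sum_distrib_left mult.assoc simp flip: row)
  also have "\<dots> = a * of_real N"
    unfolding N_def of_real_sum sum_distrib_left
    by (intro sum.cong refl) (simp add: complex_norm_square mult_ac del: of_real_power)
  finally have sN: "s = a * of_real N" .
  have "cnj s = (\<Sum>i<n. \<Sum>j<n. v $ i * of_real (A $$ (i, j)) * cnj (v $ j))"
    unfolding s_def by (simp add: cnj_sum)
  also have "\<dots> = (\<Sum>j<n. \<Sum>i<n. v $ i * of_real (A $$ (i, j)) * cnj (v $ j))"
    by (rule sum.swap)
  also have "\<dots> = s" unfolding s_def
    by (intro sum.cong refl) (use symA in \<open>auto simp: mult_ac\<close>)
  finally have "cnj s = s" .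
  hence "cnj a * of_real N = a * of_real N" using sN by simp
  moreover have "N \<noteq> 0"
  proof
    assume "N = 0"
    hence "\<forall>i<n. v $ i = 0" unfolding N_def by (subst (asm) sum_nonneg_eq_0_iff) auto
    thus False using v0 v by (metis eq_vecI carrier_vecD index_zero_vec(1) index_zero_vec(2))
  qed
  ultimately have "cnj a = a" by simp
  thus ?thesis by (simp add: Reals_cnj_iff)
qed

lemma symmetric_char_poly_splits:
  fixes A :: "real mat"
  assumes A: "A \<in> carrier_mat n n" and sym: "transpose_mat A = A"
  shows "\<exists>es. char_poly A = (\<Prod>e\<leftarrow>es. [:- e, 1:])"
proof -
  let ?A = "map_mat complex_of_real A"
  have A': "?A \<in> carrier_mat n n" using A by simp
  obtain as where as: "char_poly ?A = (\<Prod>a\<leftarrow>as. [:- a, 1:])"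
    using char_poly_factorized[OF A'] by blast
  have real: "a \<in> \<real>" if "a \<in> set as" for a
  proof -
    have "poly (char_poly ?A) a = 0" unfolding as poly_prod_list
      using that by (auto simp: prod_list_zero_iff)
    hence "eigenvalue ?A a" using eigenvalue_root_char_poly[OF A'] by blast
    thus ?thesis using symmetric_eigenvalue_real[OF A sym] by (auto simp: eigenvalue_def)
  qed
  interpret mp: map_poly_inj_idom_hom "of_real :: real \<Rightarrow> complex" ..
  have "map_poly of_real (char_poly A) = char_poly ?A"
    by (rule of_real_hom.char_poly_hom[OF A, symmetric])
  also have "\<dots> = (\<Prod>a\<leftarrow>map complex_of_real (map Re as). [:- a, 1:])"
    unfolding as by (rule arg_cong[of _ _ prod_list]) (use real in \<open>auto simp: of_real_Re\<close>)
  also have "\<dots> = map_poly of_real (\<Prod>e\<leftarrow>map Re as. [:- e, 1:])"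
    unfolding mp.hom_prod_list by (simp add: o_def)
  finally have "char_poly A = (\<Prod>e\<leftarrow>map Re as. [:- e, 1:])" by (rule mp.injectivity)
  thus ?thesis by blast
qed

lemma orth_mat_transpose:
  assumes "orth_mat n V"
  shows "orth_mat n (transpose_mat V)" and "V * transpose_mat V = 1\<^sub>m n"
proof -
  have V: "V \<in> carrier_mat n n" "transpose_mat V * V = 1\<^sub>m n" using assms by (auto simp: orth_mat_def)
  show *: "V * transpose_mat V = 1\<^sub>m n"
    using mat_mult_left_right_inverse[OF _ V(1) V(2)] V(1) by auto
  show "orth_mat n (transpose_mat V)" using V * by (auto simp: orth_mat_def)
qed

lemma orth_mat_mult:
  assumes "orth_mat n U" and "orth_mat n V"
  shows "orth_mat n (U * V)"
proof -
  have c: "U \<in> carrier_mat n n" "V \<in> carrier_mat n n" using assms by (auto simp: orth_mat_def)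
  have "transpose_mat (U * V) * (U * V) = transpose_mat V * (transpose_mat U * U * V)"
    using c by (simp add: transpose_mult[OF c] assoc_mult_mat[of _ n n _ n _ n])
  also have "\<dots> = 1\<^sub>m n" using assms c by (simp add: orth_mat_def)
  finally show ?thesis using c by (auto simp: orth_mat_def)
qed

lemma ex_orth_mat_first_col:
  fixes w :: "real vec"
  assumes w: "w \<in> carrier_vec (Suc m)" and nw: "scalar_prod w w = 1"
  shows "\<exists>H. orth_mat (Suc m) H \<and> col H 0 = w"
proof -
  define n where "n = Suc m"
  define u where "u = (\<lambda>i. w $ i - (if i = 0 then 1 else 0))"
  define N where "N = (\<Sum>i<n. (u i)\<^sup>2)"
  have ww: "(\<Sum>i<n. (w $ i)\<^sup>2) = 1"
    using nw w by (simp add: scalar_prod_def n_def power2_eq_square lessThan_atLeast0)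
  have N: "N = - 2 * u 0"
  proof -
    have "N = (\<Sum>i<n. (w $ i)\<^sup>2 - (if i = 0 then 2 * w $ 0 - 1 else 0))"
      unfolding N_def u_def by (intro sum.cong) (auto simp: power2_eq_square algebra_simps)
    also have "\<dots> = 1 - (2 * w $ 0 - 1)" unfolding sum_subtractf ww by (simp add: n_def sum.delta)
    finally show ?thesis by (simp add: u_def)
  qed
  define H where "H = Matrix.mat n n (\<lambda>(i, j). (if i = j then 1 else 0) - 2 * u i * u j / N)"
  have Hc: "H \<in> carrier_mat n n" by (simp add: H_def)
  have "transpose_mat H * H = 1\<^sub>m n"
  proof (rule eq_matI, goal_cases)
    case (1 i j)
    hence ij: "i < n" "j < n" by auto
    have "(transpose_mat H * H) $$ (i, j)
        = (\<Sum>l<n. ((if l = i then 1 else 0) - 2 * u l * u i / N) * ((if l = j then 1 else 0) - 2 * u l * u j / N))"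
      using ij by (simp add: scalar_prod_def H_def lessThan_atLeast0)
    also have "\<dots> = (\<Sum>l<n. (if l = i then (if i = j then 1 else 0) - 2 * u i * u j / N else 0)
        - (if l = j then 2 * u i * u j / N else 0) + 4 * u i * u j / N^2 * (u l)\<^sup>2)"
      by (intro sum.cong) (auto simp: algebra_simps power2_eq_square)
    also have "\<dots> = (if i = j then 1 else 0) - 4 * u i * u j / N + 4 * u i * u j / N^2 * N"
      unfolding sum.distrib sum_subtractf sum_distrib_left[symmetric] N_def[symmetric]
      using ij by (simp add: sum.delta)
    also have "\<dots> = (if i = j then 1 else 0)" by (simp add: power2_eq_square)
    finally show ?case using ij by simp
  qed (auto simp: H_def)
  moreover have "col H 0 = w"
  proof (rule eq_vecI, goal_cases)
    case (1 i)
    hence i: "i < n" using w by (simp add: n_def)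
    have "u i = 0" if "N = 0"
      using that i unfolding N_def by (subst (asm) sum_nonneg_eq_0_iff) auto
    hence "H $$ (i, 0) = (if i = 0 then 1 else 0) + u i"
      using i N by (cases "N = 0") (auto simp: H_def field_simps n_def)
    thus ?case using i by (auto simp: H_def u_def n_def)
  qed (use w in \<open>auto simp: H_def n_def\<close>)
  ultimately show ?thesis using Hc unfolding orth_mat_def n_def by blast
qed

lemma spectral_decomposition_char_poly:
  fixes A :: "real mat"
  assumes "A \<in> carrier_mat n n" and "transpose_mat A = A"
    and "char_poly A = (\<Prod>e\<leftarrow>es. [:- e, 1:])"
  shows "\<exists>V. orth_mat n V \<and> A = V * mat_diag n (\<lambda>i. es ! i) * transpose_mat V"
  using assms
proof (induction es arbitrary: n A)
  case Nil
  have "n = 0" using degree_monic_char_poly[OF Nil(1)] Nil(3) by simp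
  thus ?case using Nil(1) by (intro exI[of _ "1\<^sub>m 0"]) (auto simp: orth_mat_def)
next
  case (Cons e es n A)
  note A = Cons.prems(1) and sym = Cons.prems(2)
  have "degree (char_poly A) = length (e # es)"
    unfolding Cons.prems(3) by (subst degree_prod_list_eq) (auto simp: o_def sum_list_triv)
  then obtain m where n: "n = Suc m" using degree_monic_char_poly[OF A] by auto
  have "poly (char_poly A) e = 0" unfolding Cons.prems(3) by simp
  then obtain v where v: "v \<in> carrier_vec n" "v \<noteq> 0\<^sub>v n" "A *\<^sub>v v = e \<cdot>\<^sub>v v"
    using eigenvalue_root_char_poly[OF A] A by (auto simp: eigenvalue_def eigenvector_def)
  define s where "s = scalar_prod v v"
  have s: "s > 0"
  proof -
    have "s = (\<Sum>i<n. (v $ i)\<^sup>2)" using v(1) by (simp add: s_def scalar_prod_def power2_eq_square lessThan_atLeast0)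
    moreover have "\<exists>i<n. v $ i \<noteq> 0" using v by (metis eq_vecI carrier_vecD index_zero_vec)
    ultimately show ?thesis by (auto intro: sum_pos2)
  qed
  define w where "w = (1 / sqrt s) \<cdot>\<^sub>v v"
  have w: "w \<in> carrier_vec n" using v(1) by (simp add: w_def)
  have Aw: "A *\<^sub>v w = e \<cdot>\<^sub>v w"
    unfolding w_def mult_mat_vec[OF A v(1)] v(3) by (simp add: smult_smult_assoc mult.commute)
  have "scalar_prod w w = 1 / sqrt s * (1 / sqrt s) * s"
    unfolding w_def s_def using v(1) by simp
  also have "\<dots> = 1" using s by (simp add: field_simps)
  finally obtain H where H: "orth_mat n H" "col H 0 = w"
    using ex_orth_mat_first_col[of w m] w n by auto
  have Hc: "H \<in> carrier_mat n n" and HH: "transpose_mat H * H = 1\<^sub>m n" using H by (auto simp: orth_mat_def)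
  note HH' = orth_mat_transpose(2)[OF H(1)]
  define B where "B = transpose_mat H * A * H"
  have Bc: "B \<in> carrier_mat n n" using Hc A by (simp add: B_def)
  have symB: "transpose_mat B = B"
    unfolding B_def using Hc A sym
    by (simp add: transpose_mult[of _ n n _ n] assoc_mult_mat[of _ n n _ n _ n])
  have A_eq: "A = H * B * transpose_mat H"
  proof -
    have "H * B * transpose_mat H = (H * transpose_mat H) * A * (H * transpose_mat H)"
      unfolding B_def using Hc A by (simp add: assoc_mult_mat[of _ n n _ n _ n] mult_carrier_mat[of _ n n _ n])
    thus ?thesis using HH' A by simp
  qed
  have Bcol: "B $$ (i, 0) = (if i = 0 then e else 0)" if i: "i < n" for i
  proof -
    have "B $$ (i, 0) = (transpose_mat H * (A * H)) $$ (i, 0)"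
      unfolding B_def using Hc A by (simp add: assoc_mult_mat[of _ n n _ n _ n])
    also have "\<dots> = scalar_prod (col H i) (A *\<^sub>v col H 0)"
      using i Hc A n by (simp add: scalar_prod_def)
    also have "\<dots> = e * scalar_prod (col H i) (col H 0)" unfolding H(2) Aw using w Hc by simp
    also have "scalar_prod (col H i) (col H 0) = (transpose_mat H * H) $$ (i, 0)"
      using i Hc n by simp
    finally show ?thesis unfolding HH using i n by simp
  qed
  have Brow: "B $$ (0, i) = (if i = 0 then e else 0)" if i: "i < n" for i
    using arg_cong[OF symB, of "\<lambda>B. B $$ (i, 0)"] Bcol[OF i] i Bc n by simp
  define E where "E = Matrix.mat 1 1 (\<lambda>_. e)"
  define A3 where "A3 = Matrix.mat m m (\<lambda>(i, j). B $$ (Suc i, Suc j))"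
  have Ec: "E \<in> carrier_mat 1 1" and A3c: "A3 \<in> carrier_mat m m" by (auto simp: E_def A3_def)
  have Bblock: "B = four_block_mat E (0\<^sub>m 1 m) (0\<^sub>m m 1) A3"
    using Bc Bcol Brow by (intro eq_matI) (auto simp: E_def A3_def n)
  have symA3: "transpose_mat A3 = A3"
  proof (rule eq_matI, goal_cases)
    case (1 i j)
    thus ?case
      using arg_cong[OF symB, of "\<lambda>B. B $$ (Suc i, Suc j)"] Bc n by (simp add: A3_def)
  qed (auto simp: A3_def)
  have "similar_mat A B"
    unfolding similar_mat_def similar_mat_wit_def Let_def
    by (rule exI[of _ H], rule exI[of _ "transpose_mat H"]) (use A Bc Hc HH HH' A_eq in auto)
  hence "char_poly A = char_poly B" by (rule char_poly_similar)
  also have "\<dots> = char_poly E * char_poly A3"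
    unfolding Bblock by (rule char_poly_four_block_zeros_col[OF Ec _ A3c]) simp
  also have "char_poly E = [:- e, 1:]"
    by (subst char_poly_upper_triangular[OF Ec]) (auto simp: E_def diag_mat_def)
  finally have "[:- e, 1:] * char_poly A3 = [:- e, 1:] * (\<Prod>e\<leftarrow>es. [:- e, 1:])"
    using Cons.prems(3) by simp
  hence "char_poly A3 = (\<Prod>e\<leftarrow>es. [:- e, 1:])"
    by (metis mult_cancel_left one_neq_zero pCons_eq_0_iff)
  from Cons.IH[OF A3c symA3 this] obtain V3 where
    V3: "orth_mat m V3" "A3 = V3 * mat_diag m (\<lambda>i. es ! i) * transpose_mat V3" by blast
  have V3c: "V3 \<in> carrier_mat m m" and VV3: "transpose_mat V3 * V3 = 1\<^sub>m m"
    using V3(1) by (auto simp: orth_mat_def)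
  define U where "U = four_block_mat (1\<^sub>m 1) (0\<^sub>m 1 m) (0\<^sub>m m 1) V3"
  define D where "D = four_block_mat E (0\<^sub>m 1 m) (0\<^sub>m m 1) (mat_diag m (\<lambda>i. es ! i))"
  have Uc: "U \<in> carrier_mat n n" and Dc: "D \<in> carrier_mat n n"
    using V3c four_block_carrier_mat[OF Ec mat_diag_dim] by (auto simp: U_def D_def n)
  have Ut: "transpose_mat U = four_block_mat (1\<^sub>m 1) (0\<^sub>m 1 m) (0\<^sub>m m 1) (transpose_mat V3)"
    unfolding U_def by (subst transpose_four_block_mat[of _ 1 1 _ m _ m]) (use V3c in auto)
  have "transpose_mat U * U = four_block_mat (1\<^sub>m 1) (0\<^sub>m 1 m) (0\<^sub>m m 1) (1\<^sub>m m)"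
    unfolding Ut unfolding U_def
    by (subst mult_four_block_mat[of _ 1 1 _ m _ m]) (use V3c VV3 in auto)
  also have "\<dots> = 1\<^sub>m n" by (rule eq_matI) (auto simp: n)
  finally have Uo: "orth_mat n U" using Uc by (simp add: orth_mat_def)
  have UD: "U * D = four_block_mat E (0\<^sub>m 1 m) (0\<^sub>m m 1) (V3 * mat_diag m (\<lambda>i. es ! i))"
    unfolding U_def D_def
    by (subst mult_four_block_mat[of _ 1 1 _ m _ m])
      (use V3c Ec in \<open>auto simp: left_mult_zero_mat[OF mat_diag_dim]\<close>)
  define K where "K = V3 * mat_diag m (\<lambda>i. es ! i)"
  have Kc: "K \<in> carrier_mat m m" using V3c mat_diag_dim unfolding K_def by (rule mult_carrier_mat)
  have "U * D * transpose_mat U = B"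
    unfolding UD Ut Bblock V3(2) K_def[symmetric]
    by (subst mult_four_block_mat[of _ 1 1 _ m _ m]) (use V3c Kc Ec in auto)
  moreover have "D = mat_diag n (\<lambda>i. (e # es) ! i)"
    unfolding D_def mat_diag_def by (rule eq_matI) (auto simp: n E_def nth_Cons')
  ultimately have "A = H * (U * mat_diag n (\<lambda>i. (e # es) ! i) * transpose_mat U) * transpose_mat H"
    using A_eq by simp
  also have "\<dots> = H * U * mat_diag n (\<lambda>i. (e # es) ! i) * transpose_mat (H * U)"
    using Hc Uc by (simp add: transpose_mult[of _ n n _ n] assoc_mult_mat[of _ n n _ n _ n] mult_carrier_mat[of _ n n _ n])
  finally show ?case using orth_mat_mult[OF H(1) Uo] by blast
qed

lemma spectral_decomposition:
  fixes A :: "real mat"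
  assumes "A \<in> carrier_mat n n" and "transpose_mat A = A"
  shows "\<exists>V \<mu>. orth_mat n V \<and> A = V * mat_diag n \<mu> * transpose_mat V"
  using symmetric_char_poly_splits[OF assms] spectral_decomposition_char_poly[OF assms] by blast

lemma spectral_decomposition_ordered:
  assumes "A \<in> carrier_mat n n" and "transpose_mat A = A" and "ordered_eigenvalues n A lam"
  shows "\<exists>V. orth_mat n V \<and> A = V * mat_diag n (\<lambda>i. lam (Suc i)) * transpose_mat V"
proof -
  define es where "es = map (\<lambda>i. lam (Suc i)) [0..<n]"
  have "char_poly A = (\<Prod>i = 1..n. [:- lam i, 1:])"
    using assms(3) by (simp add: ordered_eigenvalues_def)
  also have "\<dots> = (\<Prod>i<n. [:- lam (Suc i), 1:])"
    by (simp add: prod.atLeast1_atMost_eq lessThan_atLeast0)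
  also have "\<dots> = (\<Prod>e\<leftarrow>es. [:- e, 1:])"
    unfolding es_def using prod.distinct_set_conv_list[of "[0..<n]" "\<lambda>i. [:- lam (Suc i), 1:]"]
    by (simp add: o_def lessThan_atLeast0)
  finally obtain V where "orth_mat n V" "A = V * mat_diag n (\<lambda>i. es ! i) * transpose_mat V"
    using spectral_decomposition_char_poly[OF assms(1,2)] by blast
  moreover have "mat_diag n (\<lambda>i. es ! i) = mat_diag n (\<lambda>i. lam (Suc i))"
    unfolding mat_diag_def es_def by (rule eq_matI) auto
  ultimately show ?thesis by auto
qed

section \<open>Operator monotone functions are concave\<close>

lemma mult_mat_vec_index:
  assumes "B \<in> carrier_mat n m" and "x \<in> carrier_vec m" and "i < n"
  shows "(B *\<^sub>v x) $ i = (\<Sum>j<m. B $$ (i, j) * x $ j)"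
  using assms by (simp add: scalar_prod_def lessThan_atLeast0)

lemma mult_mat_index:
  assumes "B \<in> carrier_mat n m" and "C \<in> carrier_mat m r" and "i < n" and "j < r"
  shows "(B * C) $$ (i, j) = (\<Sum>l<m. B $$ (i, l) * C $$ (l, j))"
  using assms by (simp add: scalar_prod_def lessThan_atLeast0)

lemma quadratic_form_sum:
  fixes B :: "real mat"
  assumes B: "B \<in> carrier_mat n n" and x: "x \<in> carrier_vec n"
  shows "scalar_prod x (B *\<^sub>v x) = (\<Sum>i<n. \<Sum>j<n. x $ i * B $$ (i, j) * x $ j)"
proof -
  have "scalar_prod x (B *\<^sub>v x) = (\<Sum>i<n. x $ i * (B *\<^sub>v x) $ i)"
    using B x unfolding scalar_prod_def by (simp add: lessThan_atLeast0)
  also have "\<dots> = (\<Sum>i<n. \<Sum>j<n. x $ i * B $$ (i, j) * x $ j)"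
    by (intro sum.cong refl) (simp add: mult_mat_vec_index[OF B x] sum_distrib_left mult.assoc del: index_mult_mat_vec)
  finally show ?thesis .
qed

lemma conj_diag_carrier:
  "V \<in> carrier_mat n m \<Longrightarrow> V * mat_diag m \<mu> * transpose_mat V \<in> carrier_mat n n"
  by auto

lemma conj_diag_index:
  fixes V :: "real mat"
  assumes V: "V \<in> carrier_mat n m" and i: "i < n" and j: "j < n"
  shows "(V * mat_diag m \<mu> * transpose_mat V) $$ (i, j) = (\<Sum>l<m. V $$ (i, l) * \<mu> l * V $$ (j, l))"
proof -
  have c: "Matrix.mat n m (\<lambda>(i, l). V $$ (i, l) * \<mu> l) \<in> carrier_mat n m" by simp
  show ?thesis
    unfolding mat_diag_mult_right[OF V] mult_mat_index[OF c transpose_carrier_mat[THEN iffD2, OF V] i j]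
    using V i j by (intro sum.cong) auto
qed

lemma quadratic_form_conj_diag:
  fixes V :: "real mat"
  assumes V: "V \<in> carrier_mat n m" and x: "x \<in> carrier_vec n"
  shows "scalar_prod x ((V * mat_diag m \<mu> * transpose_mat V) *\<^sub>v x)
    = (\<Sum>l<m. \<mu> l * (\<Sum>i<n. V $$ (i, l) * x $ i)\<^sup>2)"
proof -
  have "scalar_prod x ((V * mat_diag m \<mu> * transpose_mat V) *\<^sub>v x)
    = (\<Sum>i<n. \<Sum>j<n. \<Sum>l<m. x $ i * (V $$ (i, l) * \<mu> l * V $$ (j, l)) * x $ j)"
    unfolding quadratic_form_sum[OF conj_diag_carrier[OF V] x]
    by (intro sum.cong refl) (simp add: conj_diag_index[OF V] sum_distrib_left sum_distrib_right del: index_mult_mat)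
  also have "\<dots> = (\<Sum>i<n. \<Sum>l<m. \<Sum>j<n. x $ i * (V $$ (i, l) * \<mu> l * V $$ (j, l)) * x $ j)"
    by (intro sum.cong refl sum.swap)
  also have "\<dots> = (\<Sum>l<m. \<Sum>i<n. \<Sum>j<n. x $ i * (V $$ (i, l) * \<mu> l * V $$ (j, l)) * x $ j)"
    by (rule sum.swap)
  also have "\<dots> = (\<Sum>l<m. \<mu> l * (\<Sum>i<n. V $$ (i, l) * x $ i)\<^sup>2)"
    unfolding power2_eq_square sum_product
    by (intro sum.cong refl) (simp add: sum_distrib_left mult_ac)
  finally show ?thesis .
qed

lemma conj_diag_transpose:
  fixes V :: "real mat"
  assumes V: "V \<in> carrier_mat n m"
  shows "transpose_mat (V * mat_diag m \<mu> * transpose_mat V) = V * mat_diag m \<mu> * transpose_mat V"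
  by (rule eq_matI)
    (use V conj_diag_index[OF V] in \<open>auto simp: mult_ac simp del: index_mult_mat(1)\<close>)

lemma spsd_conj_diag:
  fixes V :: "real mat"
  assumes V: "V \<in> carrier_mat n m" and "\<And>l. l < m \<Longrightarrow> 0 \<le> \<mu> l"
  shows "spsd n (V * mat_diag m \<mu> * transpose_mat V)"
  unfolding spsd_def conj_diag_transpose[OF V]
  using conj_diag_carrier[OF V] quadratic_form_conj_diag[OF V] assms(2)
  by (auto intro!: sum_nonneg mult_nonneg_nonneg)

lemma mat_fun_conj_diag:
  assumes V: "orth_mat n V"
  shows "mat_fun f (V * mat_diag n \<mu> * transpose_mat V) = V * mat_diag n (\<lambda>i. f (\<mu> i)) * transpose_mat V"
proof -
  let ?B = "V * mat_diag n \<mu> * transpose_mat V"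
  have d: "dim_row ?B = n" using V by (auto simp: orth_mat_def)
  have *: "is_mat_fun f ?B (V * mat_diag n (\<lambda>i. f (\<mu> i)) * transpose_mat V)"
    unfolding is_mat_fun_def d using V by blast
  show ?thesis unfolding mat_fun_def using * is_mat_fun_unique[OF _ *] by (rule the_equality)
qed

lemma orth_mat_one: "orth_mat n (1\<^sub>m n)"
  by (auto simp: orth_mat_def)

lemma mat_fun_diag: "mat_fun f (mat_diag n \<mu>) = mat_diag n (\<lambda>i. f (\<mu> i))"
  using mat_fun_conj_diag[OF orth_mat_one, of f n \<mu>]
  by (simp add: left_mult_one_mat[OF mat_diag_dim] right_mult_one_mat[OF mat_diag_dim])

lemma spsd_diag_nonneg:
  assumes "spsd n B" and i: "i < n"
  shows "0 \<le> B $$ (i, i)"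
proof -
  have B: "B \<in> carrier_mat n n" using assms by (simp add: spsd_def)
  have "0 \<le> scalar_prod (unit_vec n i) (B *\<^sub>v unit_vec n i)" using assms by (auto simp: spsd_def)
  also have "\<dots> = (\<Sum>a<n. \<Sum>b<n. unit_vec n i $ a * B $$ (a, b) * unit_vec n i $ b)"
    by (rule quadratic_form_sum[OF B]) simp
  also have "\<dots> = (\<Sum>a<n. if a = i then B $$ (i, i) else 0)"
  proof (intro sum.cong refl)
    fix a assume a: "a \<in> {..<n}"
    have "(\<Sum>b<n. unit_vec n i $ a * B $$ (a, b) * unit_vec n i $ b)
        = (\<Sum>b<n. if b = i then (if a = i then B $$ (i, i) else 0) else 0)"
      using a i by (intro sum.cong) auto
    thus "(\<Sum>b<n. unit_vec n i $ a * B $$ (a, b) * unit_vec n i $ b) = (if a = i then B $$ (i, i) else 0)"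
      using i by (simp add: sum.delta)
  qed
  also have "\<dots> = B $$ (i, i)" using i by (simp add: sum.delta)
  finally show ?thesis .
qed

text \<open>The rotated matrix with eigenvalues \<open>x\<close>, \<open>y\<close> lies below a diagonal matrix whose first entry is
  its own first entry plus \<open>\<epsilon>\<close>, provided that the second entry is large.\<close>

lemma operator_monotone_near_concave:
  assumes f: "operator_monotone f" and x: "0 \<le> x" and y: "0 \<le> y" and ab: "a\<^sup>2 + b\<^sup>2 = 1" and e: "0 < \<epsilon>"
  shows "a\<^sup>2 * f x + b\<^sup>2 * f y \<le> f (a\<^sup>2 * x + b\<^sup>2 * y + \<epsilon>)"
proof -
  define U where "U = Matrix.mat 2 2 (\<lambda>(i, j). if i = j then (if i = 0 then a else - a) else b)"
  have Uc: "U \<in> carrier_mat 2 2" by (simp add: U_def)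
  have U: "orth_mat 2 U" unfolding orth_mat_def
  proof (intro conjI Uc eq_matI, goal_cases)
    case (1 i j)
    hence "i \<in> {0, 1}" "j \<in> {0, 1}" by auto
    thus ?case using ab Uc by (auto simp: U_def scalar_prod_def numeral_2_eq_2 power2_eq_square algebra_simps)
  qed (use Uc in auto)
  have Uij: "U $$ (0, 0) = a" "U $$ (0, Suc 0) = b" "U $$ (Suc 0, 0) = b" "U $$ (Suc 0, Suc 0) = - a"
    by (simp_all add: U_def)
  have s2: "(\<Sum>l<2. h l) = h 0 + h (1::nat)" for h :: "nat \<Rightarrow> real" by (simp add: numeral_2_eq_2)
  define \<mu> where "\<mu> = (\<lambda>l::nat. if l = 0 then x else y)"
  define d where "d = a * b * (x - y)"
  define s where "s = b\<^sup>2 * x + a\<^sup>2 * y"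
  define c where "c = a\<^sup>2 * x + b\<^sup>2 * y"
  define \<nu> where "\<nu> = (\<lambda>l::nat. if l = 0 then c + \<epsilon> else s + d\<^sup>2 / \<epsilon>)"
  define C where "C = U * mat_diag 2 \<mu> * transpose_mat U"
  have Cc: "C \<in> carrier_mat 2 2" unfolding C_def by (rule conj_diag_carrier[OF Uc])
  have Cij: "C $$ (0, 0) = c" "C $$ (0, 1) = d" "C $$ (1, 0) = d" "C $$ (1, 1) = s"
    unfolding C_def by (simp_all add: conj_diag_index[OF Uc] s2 Uij \<mu>_def c_def d_def s_def
        power2_eq_square algebra_simps del: index_mult_mat)
  have pc: "spsd 2 C" unfolding C_def by (rule spsd_conj_diag[OF Uc]) (use x y in \<open>auto simp: \<mu>_def\<close>)
  have pb: "spsd 2 (mat_diag 2 \<nu>)"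
    using spsd_conj_diag[of "1\<^sub>m 2" 2 2 \<nu>] x y e
    by (simp add: left_mult_one_mat[OF mat_diag_dim] right_mult_one_mat[OF mat_diag_dim] \<nu>_def c_def s_def)
  have "spsd 2 (mat_diag 2 \<nu> - C)"
    unfolding spsd_def
  proof (intro conjI ballI)
    show "mat_diag 2 \<nu> - C \<in> carrier_mat 2 2" using Cc by auto
    show "transpose_mat (mat_diag 2 \<nu> - C) = mat_diag 2 \<nu> - C"
      using Cc pc by (subst transpose_minus[of _ 2 2])
        (auto simp: spsd_def mat_diag_def intro!: eq_matI)
    fix z :: "real vec" assume z: "z \<in> carrier_vec 2"
    have "scalar_prod z ((mat_diag 2 \<nu> - C) *\<^sub>v z) = (\<epsilon> * z $ 0 - d * z $ 1)\<^sup>2 / \<epsilon>"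
      using e Cc by (subst quadratic_form_sum[OF _ z])
       (auto simp: s2 Cij Cij[unfolded One_nat_def] mat_diag_def \<nu>_def power2_eq_square field_simps)
    thus "0 \<le> scalar_prod z ((mat_diag 2 \<nu> - C) *\<^sub>v z)" using e by simp
  qed
  hence "spsd 2 (mat_fun f (mat_diag 2 \<nu>) - mat_fun f C)"
    using f pb pc by (auto simp: operator_monotone_def)
  from spsd_diag_nonneg[OF this, of 0]
  show ?thesis unfolding mat_fun_diag unfolding C_def mat_fun_conj_diag[OF U]
    using Uc conj_diag_index[OF Uc, of 0 0 "\<lambda>i. f (\<mu> i)"] mat_diag_dim[of 2 "\<lambda>i. f (\<mu> i)"]
    by (simp add: s2 Uij mult_ac del: index_mult_mat(1) mat_diag_dim)
      (simp add: \<mu>_def \<nu>_def c_def mat_diag_def power2_eq_square mult_ac)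
qed

locale op_mono =
  fixes f :: "real \<Rightarrow> real"
  assumes f: "operator_monotone f" and f0: "f 0 = 0"
begin

lemma f_nonneg: "0 \<le> x \<Longrightarrow> 0 \<le> f x"
  using f by (simp add: operator_monotone_def)

lemma near_concave:
  assumes "0 \<le> x" "0 \<le> y" "0 \<le> t" "t \<le> 1" "0 < \<epsilon>"
  shows "t * f x + (1 - t) * f y \<le> f (t * x + (1 - t) * y + \<epsilon>)"
  using operator_monotone_near_concave[OF f assms(1,2), of "sqrt t" "sqrt (1 - t)" \<epsilon>] assms by simp

lemma f_mono:
  assumes "0 \<le> x" "x \<le> y"
  shows "f x \<le> f y"
  using near_concave[of x x 1 "y - x"] assms by (cases "x = y") auto

lemma concave:
  assumes x: "0 \<le> x" and y: "0 \<le> y" and t: "0 \<le> t" "t \<le> 1"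
  shows "t * f x + (1 - t) * f y \<le> f (t * x + (1 - t) * y)" (is "?l \<le> f ?c")
proof (cases "?c = 0")
  case True
  hence "t * x = 0" "(1 - t) * y = 0"
    using assms by (smt (verit) mult_nonneg_nonneg)+
  thus ?thesis using f0 by auto
next
  case False
  hence c: "?c > 0" using assms by (smt (verit) mult_nonneg_nonneg)
  have l: "?l \<ge> 0" using assms f_nonneg by (simp add: mult_nonneg_nonneg)
  have *: "(?c - e) / (?c + e) * ?l \<le> f ?c" if e: "0 < e" "e < ?c" for e
  proof -
    let ?s = "(?c - e) / (?c + e)"
    have s: "0 \<le> ?s" "?s \<le> 1" using e by auto
    have "?s * ?l \<le> ?s * f (?c + e)"
      by (rule mult_left_mono[OF near_concave[OF x y t e(1)] s(1)])
    also have "\<dots> \<le> f (?s * (?c + e) + e)"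
      using near_concave[of "?c + e" 0 ?s e] s e f0 by simp
    also have "?s * (?c + e) + e = ?c" using e by simp
    finally show ?thesis .
  qed
  have "((\<lambda>e. (?c - e) / (?c + e) * ?l) \<longlongrightarrow> (?c - 0) / (?c + 0) * ?l) (at_right 0)"
    using c by (intro tendsto_intros) auto
  moreover have "eventually (\<lambda>e. (?c - e) / (?c + e) * ?l \<le> f ?c) (at_right 0)"
    using eventually_at_right[OF c] * by (auto intro!: exI[of _ ?c] c)
  ultimately have "(?c - 0) / (?c + 0) * ?l \<le> f ?c"
    by (intro tendsto_upperbound) auto
  thus ?thesis using c by simp
qed

lemma ratio_antimono:
  assumes "0 < x" "x \<le> y"
  shows "f y / y \<le> f x / x"
  using concave[of y 0 "x / y"] assms f0 by (simp add: field_simps)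

lemma supporting_line:
  assumes y: "0 < y"
  obtains s where "0 \<le> s" "s * y \<le> f y" "\<And>x. 0 \<le> x \<Longrightarrow> f x \<le> f y + s * (x - y)"
proof -
  have cvx: "convex_on {0..} (\<lambda>x. - f x)"
  proof (rule convex_onI)
    fix t x y :: real assume "0 < t" "t < 1" "x \<in> {0..}" "y \<in> {0..}"
    thus "- f ((1 - t) *\<^sub>R x + t *\<^sub>R y) \<le> (1 - t) * - f x + t * - f y"
      using concave[of x y "1 - t"] by simp
  qed simp
  define s where "s = - Inf ((\<lambda>t. (- f y - (- f t)) / (y - t)) ` ({y<..} \<inter> {0..}))"
  have *: "f x \<le> f y + s * (x - y)" if "0 \<le> x" for x
    using convex_le_Inf_differential[OF cvx, of y x] y that
    by (simp add: s_def interior_real_atLeast)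
  show ?thesis
  proof (rule that)
    show "0 \<le> s" using *[of "y + 1"] f_mono[of y "y + 1"] y by simp
    show "s * y \<le> f y" using *[of 0] f0 by simp
  qed (rule *)
qed

lemma excess_le_average:
  assumes t: "0 < t" and g: "g = f t / t" and w: "\<And>i. i < n \<Longrightarrow> 0 \<le> w i" "(\<Sum>i<n. w i) = 1"
    and lam: "\<And>i. i < n \<Longrightarrow> 0 \<le> lam i"
    and mu: "0 \<le> \<mu>" "\<mu> \<le> (\<Sum>i<n. w i * lam i)"
  shows "g\<^sup>2 * \<mu>\<^sup>2 - (f \<mu>)\<^sup>2 \<le> (\<Sum>i<n. w i * max 0 (g\<^sup>2 * (lam i)\<^sup>2 - (f (lam i))\<^sup>2))"
    (is "_ \<le> ?R")
proof -
  define y where "y = (\<Sum>i<n. w i * lam i)"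
  have R0: "0 \<le> ?R" using w by (intro sum_nonneg) auto
  have g0: "0 \<le> g" using t f_nonneg[of t] by (simp add: g)
  show ?thesis
  proof (cases "\<mu> \<le> t")
    case True
    have "g * \<mu> \<le> f \<mu>"
      using ratio_antimono[of \<mu> t] True mu f0 t by (cases "\<mu> = 0") (auto simp: field_simps g)
    hence "(g * \<mu>)\<^sup>2 \<le> (f \<mu>)\<^sup>2" using g0 mu by (intro power_mono) auto
    thus ?thesis using R0 by (simp add: power_mult_distrib)
  next
    case False
    hence y: "t < y" "0 < y" "0 < \<mu>" "\<mu> \<le> y" using mu t by (auto simp: y_def)
    have fy: "f y = f y / y * y" "f \<mu> = f \<mu> / \<mu> * \<mu>" using y by auto
    have r: "f y / y \<le> f \<mu> / \<mu>" "f \<mu> / \<mu> \<le> g"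
      using ratio_antimono[of \<mu> y] ratio_antimono[of t \<mu>] y t False by (auto simp: g)
    have r0: "0 \<le> f y / y" "0 \<le> f \<mu> / \<mu>" using y f_nonneg[of y] f_nonneg[of \<mu>] by simp_all
    have "g\<^sup>2 * \<mu>\<^sup>2 - (f \<mu>)\<^sup>2 = (g\<^sup>2 - (f \<mu> / \<mu>)\<^sup>2) * \<mu>\<^sup>2"
      using y by (simp add: left_diff_distrib flip: power_mult_distrib)
    also have "\<dots> \<le> (g\<^sup>2 - (f y / y)\<^sup>2) * y\<^sup>2"
      using r r0 y g0 by (intro mult_mono) (auto intro!: power_mono diff_left_mono)
    also have "\<dots> = g\<^sup>2 * y\<^sup>2 - (f y)\<^sup>2"
      using y by (simp add: left_diff_distrib flip: power_mult_distrib)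
    also have "\<dots> \<le> ?R"
    proof -
      obtain s where s: "0 \<le> s" "s * y \<le> f y" "\<And>x. 0 \<le> x \<Longrightarrow> f x \<le> f y + s * (x - y)"
        using supporting_line[OF y(2)] by blast
      have "s \<le> f y / y" using s(2) y by (simp add: field_simps)
      hence sg: "s\<^sup>2 \<le> g\<^sup>2" using s(1) r by (intro power_mono) auto
      define L where "L = 2 * g\<^sup>2 * y - 2 * s * f y"
      have tangent: "g\<^sup>2 * y\<^sup>2 - (f y)\<^sup>2 + L * (x - y) \<le> max 0 (g\<^sup>2 * x\<^sup>2 - (f x)\<^sup>2)" if x: "0 \<le> x" for x
      proof -
        have "(f x)\<^sup>2 \<le> (f y + s * (x - y))\<^sup>2"
          using s(3)[OF x] f_nonneg[OF x] by (intro power_mono) auto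
        moreover have "g\<^sup>2 * x\<^sup>2 - (f y + s * (x - y))\<^sup>2
            = g\<^sup>2 * y\<^sup>2 - (f y)\<^sup>2 + L * (x - y) + (g\<^sup>2 - s\<^sup>2) * (x - y)\<^sup>2"
          unfolding L_def by (simp add: power2_eq_square algebra_simps)
        moreover have "0 \<le> (g\<^sup>2 - s\<^sup>2) * (x - y)\<^sup>2" using sg by simp
        ultimately show ?thesis by linarith
      qed
      have "g\<^sup>2 * y\<^sup>2 - (f y)\<^sup>2 = (\<Sum>i<n. w i * (g\<^sup>2 * y\<^sup>2 - (f y)\<^sup>2 + L * (lam i - y)))"
      proof -
        have "(\<Sum>i<n. w i * (g\<^sup>2 * y\<^sup>2 - (f y)\<^sup>2 + L * (lam i - y)))
            = (g\<^sup>2 * y\<^sup>2 - (f y)\<^sup>2 - L * y) * (\<Sum>i<n. w i) + L * (\<Sum>i<n. w i * lam i)"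
          unfolding sum_distrib_left sum.distrib[symmetric] by (intro sum.cong) (auto simp: algebra_simps)
        thus ?thesis using w(2) by (simp add: y_def)
      qed
      also have "\<dots> \<le> ?R"
        using w(1) tangent lam by (intro sum_mono mult_left_mono) auto
      finally show ?thesis .
    qed
    finally show ?thesis .
  qed
qed

end

section \<open>Reduction to the identity function\<close>

lemma frobenius_norm_sq:
  assumes "B \<in> carrier_mat n m"
  shows "(frobenius_norm B)\<^sup>2 = (\<Sum>i<n. \<Sum>j<m. (B $$ (i, j))\<^sup>2)"
  using assms unfolding frobenius_norm_def by (subst real_sqrt_pow2) (auto intro!: sum_nonneg)

lemma orth_mat_cols:
  assumes "orth_mat n V" and "i < n" and "j < n"
  shows "(\<Sum>a<n. V $$ (a, i) * V $$ (a, j)) = (if i = j then 1 else 0)"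
proof -
  have V: "V \<in> carrier_mat n n" and "(transpose_mat V * V) $$ (i, j) = 1\<^sub>m n $$ (i, j)"
    using assms by (auto simp: orth_mat_def)
  thus ?thesis using assms(2,3) mult_mat_index[of "transpose_mat V" n n V n i j] by simp
qed

lemma orth_mat_rows:
  assumes V: "orth_mat n V" and ij: "i < n" "j < n"
  shows "(\<Sum>a<n. V $$ (i, a) * V $$ (j, a)) = (if i = j then 1 else 0)"
proof -
  have "V \<in> carrier_mat n n" using V by (simp add: orth_mat_def)
  thus ?thesis using orth_mat_cols[OF orth_mat_transpose(1)[OF V] ij] ij by simp
qed

lemma frobenius_inner_conj_diag:
  fixes X :: "real mat"
  assumes W: "W \<in> carrier_mat n m" and X: "X \<in> carrier_mat n n"
  shows "(\<Sum>i<n. \<Sum>j<n. X $$ (i, j) * (W * mat_diag m \<nu> * transpose_mat W) $$ (i, j))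
    = (\<Sum>l<m. \<nu> l * scalar_prod (col W l) (X *\<^sub>v col W l))"
proof -
  have "(\<Sum>i<n. \<Sum>j<n. X $$ (i, j) * (W * mat_diag m \<nu> * transpose_mat W) $$ (i, j))
    = (\<Sum>i<n. \<Sum>j<n. \<Sum>l<m. \<nu> l * (W $$ (i, l) * X $$ (i, j) * W $$ (j, l)))"
    by (intro sum.cong refl) (simp add: conj_diag_index[OF W] sum_distrib_left mult_ac del: index_mult_mat(1))
  also have "\<dots> = (\<Sum>i<n. \<Sum>l<m. \<Sum>j<n. \<nu> l * (W $$ (i, l) * X $$ (i, j) * W $$ (j, l)))"
    by (intro sum.cong refl sum.swap)
  also have "\<dots> = (\<Sum>l<m. \<Sum>i<n. \<Sum>j<n. \<nu> l * (W $$ (i, l) * X $$ (i, j) * W $$ (j, l)))"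
    by (rule sum.swap)
  also have "\<dots> = (\<Sum>l<m. \<nu> l * scalar_prod (col W l) (X *\<^sub>v col W l))"
    by (intro sum.cong refl, subst quadratic_form_sum[OF X]) (use W in \<open>auto simp: sum_distrib_left\<close>)
  finally show ?thesis .
qed

lemma quadratic_form_eigenvector:
  assumes V: "orth_mat n V" and l: "l < n"
  shows "scalar_prod (col V l) ((V * mat_diag n \<mu> * transpose_mat V) *\<^sub>v col V l) = \<mu> l"
proof -
  have Vc: "V \<in> carrier_mat n n" using V by (simp add: orth_mat_def)
  have "scalar_prod (col V l) ((V * mat_diag n \<mu> * transpose_mat V) *\<^sub>v col V l)
      = (\<Sum>b<n. \<mu> b * (\<Sum>i<n. V $$ (i, b) * col V l $ i)\<^sup>2)"
    by (rule quadratic_form_conj_diag[OF Vc]) (use Vc l in auto)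
  also have "\<dots> = (\<Sum>b<n. if b = l then \<mu> l else 0)"
    using Vc l by (intro sum.cong refl) (simp add: orth_mat_cols[OF V])
  also have "\<dots> = \<mu> l" using l by (simp add: sum.delta)
  finally show ?thesis .
qed

lemma frobenius_norm_conj_diag:
  assumes V: "orth_mat n V"
  shows "(frobenius_norm (V * mat_diag n \<mu> * transpose_mat V))\<^sup>2 = (\<Sum>l<n. (\<mu> l)\<^sup>2)"
proof -
  have Vc: "V \<in> carrier_mat n n" using V by (simp add: orth_mat_def)
  show ?thesis
    unfolding frobenius_norm_sq[OF conj_diag_carrier[OF Vc]]
    using frobenius_inner_conj_diag[OF Vc conj_diag_carrier[OF Vc], of \<mu> \<mu>] quadratic_form_eigenvector[OF V]
    by (simp add: power2_eq_square del: index_mult_mat)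
qed

context op_mono
begin

text \<open>Convexity and monotonicity of \<open>x \<mapsto> max 0 (g\<^sup>2 x\<^sup>2 - f(x)\<^sup>2)\<close> make its trace monotone
  (Peierls' argument: Jensen in the eigenbasis of \<open>B\<close>); this reduces \<open>f\<close> to the identity.\<close>

lemma frobenius_mat_fun_diff_le:
  assumes V: "orth_mat n V" and A: "A = V * mat_diag n lam * transpose_mat V"
    and lam: "\<And>i. i < n \<Longrightarrow> 0 \<le> lam i"
    and B: "spsd n B" and AB: "spsd n (A - B)"
    and t: "0 < t" and g: "g = f t / t"
  shows "(frobenius_norm (mat_fun f A - mat_fun f B))\<^sup>2
    \<le> (\<Sum>i<n. (f (lam i))\<^sup>2 + max 0 (g\<^sup>2 * (lam i)\<^sup>2 - (f (lam i))\<^sup>2)) - g\<^sup>2 * (frobenius_norm B)\<^sup>2"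
proof -
  have Vc: "V \<in> carrier_mat n n" using V by (simp add: orth_mat_def)
  have Bc: "B \<in> carrier_mat n n" and symB: "transpose_mat B = B" using B by (auto simp: spsd_def)
  have sA: "spsd n A" unfolding A by (rule spsd_conj_diag[OF Vc lam])
  have Ac: "A \<in> carrier_mat n n" using sA by (simp add: spsd_def)
  obtain W \<mu> where W: "orth_mat n W" and BW: "B = W * mat_diag n \<mu> * transpose_mat W"
    using spectral_decomposition[OF Bc symB] by blast
  have Wc: "W \<in> carrier_mat n n" using W by (simp add: orth_mat_def)
  have cW: "col W l \<in> carrier_vec n" if "l < n" for l using Wc that by auto
  have \<mu>: "0 \<le> \<mu> l" if "l < n" for l
    using quadratic_form_eigenvector[OF W that, of \<mu>] B cW[OF that] unfolding spsd_def BW[symmetric] by metis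
  define E where "E = mat_fun f A"
  define D where "D = mat_fun f B"
  have E: "E = V * mat_diag n (\<lambda>i. f (lam i)) * transpose_mat V"
    unfolding E_def A by (rule mat_fun_conj_diag[OF V])
  have D: "D = W * mat_diag n (\<lambda>i. f (\<mu> i)) * transpose_mat W"
    unfolding D_def BW by (rule mat_fun_conj_diag[OF W])
  have Ec: "E \<in> carrier_mat n n" and Dc: "D \<in> carrier_mat n n"
    unfolding E D by (auto intro!: conj_diag_carrier Vc Wc)
  have ED: "spsd n (E - D)" using f sA B AB by (auto simp: operator_monotone_def E_def D_def)
  have EDc: "E - D \<in> carrier_mat n n" using Ec Dc by auto
  have "(\<Sum>i<n. \<Sum>j<n. (E - D) $$ (i, j) * D $$ (i, j))
      = (\<Sum>l<n. f (\<mu> l) * scalar_prod (col W l) ((E - D) *\<^sub>v col W l))"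
    using frobenius_inner_conj_diag[OF Wc EDc] unfolding D by blast
  also have "\<dots> \<ge> 0" using ED cW f_nonneg[OF \<mu>] by (intro sum_nonneg mult_nonneg_nonneg) (auto simp: spsd_def)
  finally have inner: "0 \<le> (\<Sum>i<n. \<Sum>j<n. (E - D) $$ (i, j) * D $$ (i, j))" .
  have "(frobenius_norm (E - D))\<^sup>2 = (\<Sum>i<n. \<Sum>j<n. (E $$ (i, j))\<^sup>2 - (D $$ (i, j))\<^sup>2 - 2 * ((E - D) $$ (i, j) * D $$ (i, j)))"
    unfolding frobenius_norm_sq[OF EDc]
    by (intro sum.cong refl) (use Ec Dc in \<open>auto simp: power2_eq_square algebra_simps\<close>)
  also have "\<dots> = (frobenius_norm E)\<^sup>2 - (frobenius_norm D)\<^sup>2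
      - 2 * (\<Sum>i<n. \<Sum>j<n. (E - D) $$ (i, j) * D $$ (i, j))"
    unfolding frobenius_norm_sq[OF Ec] frobenius_norm_sq[OF Dc] sum_subtractf sum_distrib_left[symmetric] by simp
  also have "\<dots> \<le> (\<Sum>i<n. (f (lam i))\<^sup>2) - (\<Sum>l<n. (f (\<mu> l))\<^sup>2)"
    using inner frobenius_norm_conj_diag[OF V] frobenius_norm_conj_diag[OF W] by (simp add: E D)
  finally have step1: "(frobenius_norm (E - D))\<^sup>2 \<le> (\<Sum>i<n. (f (lam i))\<^sup>2) - (\<Sum>l<n. (f (\<mu> l))\<^sup>2)" .
  let ?\<phi> = "\<lambda>x. max 0 (g\<^sup>2 * x\<^sup>2 - (f x)\<^sup>2)"
  define Z where "Z = (\<lambda>i l. (\<Sum>a<n. V $$ (a, i) * W $$ (a, l))\<^sup>2)"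
  have Z: "Z i l = (((transpose_mat V * W) $$ (i, l)))\<^sup>2" if "i < n" "l < n" for i l
    using that Vc Wc mult_mat_index[of "transpose_mat V" n n W n i l] by (simp add: Z_def)
  have orthZ: "orth_mat n (transpose_mat V * W)"
    by (intro orth_mat_mult orth_mat_transpose(1) V W)
  have Zl: "(\<Sum>i<n. Z i l) = 1" if "l < n" for l
    using orth_mat_cols[OF orthZ that that] that Z by (simp add: power2_eq_square)
  have Zi: "(\<Sum>l<n. Z i l) = 1" if "i < n" for i
    using orth_mat_rows[OF orthZ that that] that Z by (simp add: power2_eq_square)
  have "g\<^sup>2 * (\<mu> l)\<^sup>2 - (f (\<mu> l))\<^sup>2 \<le> (\<Sum>i<n. Z i l * ?\<phi> (lam i))" if l: "l < n" for l
  proof (rule excess_le_average[OF t g _ Zl[OF l] lam \<mu>[OF l]])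
    have "0 \<le> scalar_prod (col W l) ((A - B) *\<^sub>v col W l)" using AB cW[OF l] by (auto simp: spsd_def)
    also have "(A - B) *\<^sub>v col W l = A *\<^sub>v col W l - B *\<^sub>v col W l"
      by (rule minus_mult_distrib_mat_vec[OF Ac Bc cW[OF l]])
    also have "scalar_prod (col W l) \<dots> = scalar_prod (col W l) (A *\<^sub>v col W l) - scalar_prod (col W l) (B *\<^sub>v col W l)"
      by (rule scalar_prod_minus_distrib[OF cW[OF l] mult_mat_vec_carrier[OF Ac cW[OF l]]
            mult_mat_vec_carrier[OF Bc cW[OF l]]])
    also have "scalar_prod (col W l) (B *\<^sub>v col W l) = \<mu> l"
      unfolding BW by (rule quadratic_form_eigenvector[OF W l])
    also have "scalar_prod (col W l) (A *\<^sub>v col W l) = (\<Sum>i<n. Z i l * lam i)"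
      unfolding A quadratic_form_conj_diag[OF Vc cW[OF l]] Z_def
      using Wc l by (intro sum.cong refl) (simp add: mult.commute)
    finally show "\<mu> l \<le> (\<Sum>i<n. Z i l * lam i)" by simp
  qed (auto simp: Z_def)
  hence "(\<Sum>l<n. g\<^sup>2 * (\<mu> l)\<^sup>2 - (f (\<mu> l))\<^sup>2) \<le> (\<Sum>l<n. \<Sum>i<n. Z i l * ?\<phi> (lam i))"
    by (intro sum_mono) auto
  also have "\<dots> = (\<Sum>i<n. (\<Sum>l<n. Z i l) * ?\<phi> (lam i))"
    unfolding sum_distrib_right by (rule sum.swap)
  also have "\<dots> = (\<Sum>i<n. ?\<phi> (lam i))" using Zi by (intro sum.cong) auto
  finally have "g\<^sup>2 * (frobenius_norm B)\<^sup>2 \<le> (\<Sum>l<n. (f (\<mu> l))\<^sup>2) + (\<Sum>i<n. ?\<phi> (lam i))"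
    unfolding BW frobenius_norm_conj_diag[OF W] sum_distrib_left by (simp add: sum_subtractf)
  with step1 show ?thesis unfolding E_def D_def by (simp add: sum.distrib)
qed

lemma frobenius_mat_fun_diff_le_ordered:
  assumes V: "orth_mat n V" and A: "A = V * mat_diag n lam * transpose_mat V"
    and lam: "\<And>i. i < n \<Longrightarrow> 0 \<le> lam i"
    and B: "spsd n B" and AB: "spsd n (A - B)"
    and k: "k \<le> n" and t: "0 < t" and g: "g = f t / t"
    and hi: "\<And>i. i < k \<Longrightarrow> t \<le> lam i" and lo: "\<And>i. k \<le> i \<Longrightarrow> i < n \<Longrightarrow> lam i \<le> t"
  shows "(frobenius_norm (mat_fun f A - mat_fun f B))\<^sup>2
    \<le> (\<Sum>i=k..<n. (f (lam i))\<^sup>2) + g\<^sup>2 * ((\<Sum>i<k. (lam i)\<^sup>2) - (frobenius_norm B)\<^sup>2)"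
proof -
  let ?h = "\<lambda>i. (f (lam i))\<^sup>2 + max 0 (g\<^sup>2 * (lam i)\<^sup>2 - (f (lam i))\<^sup>2)"
  have g0: "0 \<le> g" using t f_nonneg[of t] by (simp add: g)
  have h1: "?h i = g\<^sup>2 * (lam i)\<^sup>2" if "i < k" for i
  proof -
    have "f (lam i) \<le> g * lam i"
      using ratio_antimono[OF t hi[OF that]] hi[OF that] t by (simp add: g field_simps)
    hence "(f (lam i))\<^sup>2 \<le> (g * lam i)\<^sup>2" using f_nonneg[OF lam] that k by (intro power_mono) auto
    thus ?thesis by (simp add: power_mult_distrib)
  qed
  have h2: "?h i = (f (lam i))\<^sup>2" if "k \<le> i" "i < n" for i
  proof -
    have "g * lam i \<le> f (lam i)"
      using ratio_antimono[OF _ lo[OF that]] lam[OF that(2)] t f0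
      by (cases "lam i = 0") (auto simp: g field_simps)
    hence "(g * lam i)\<^sup>2 \<le> (f (lam i))\<^sup>2" using g0 lam[OF that(2)] by (intro power_mono) auto
    thus ?thesis by (simp add: power_mult_distrib)
  qed
  have "(\<Sum>i<n. ?h i) = (\<Sum>i<k. ?h i) + (\<Sum>i=k..<n. ?h i)"
    unfolding lessThan_atLeast0 using k by (simp add: sum.atLeastLessThan_concat)
  also have "\<dots> = g\<^sup>2 * (\<Sum>i<k. (lam i)\<^sup>2) + (\<Sum>i=k..<n. (f (lam i))\<^sup>2)"
    unfolding sum_distrib_left using h1 h2 by (intro arg_cong2[of _ _ _ _ "(+)"] sum.cong) auto
  finally show ?thesis
    using frobenius_mat_fun_diff_le[OF V A lam B AB t g] by (simp add: algebra_simps)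
qed

end

section \<open>The structural bound\<close>

lemma conj_diag_mult:
  assumes V: "orth_mat n V"
  shows "(V * mat_diag n \<mu> * transpose_mat V) * (V * mat_diag n \<nu> * transpose_mat V)
    = V * mat_diag n (\<lambda>i. \<mu> i * \<nu> i) * transpose_mat V"
proof -
  have Vc: "V \<in> carrier_mat n n" and VV: "transpose_mat V * V = 1\<^sub>m n" using V by (auto simp: orth_mat_def)
  note D = mat_diag_dim[where 'a = real and n = n]
  have Vt: "transpose_mat V \<in> carrier_mat n n" using Vc by simp
  have VD: "V * mat_diag n h \<in> carrier_mat n n" for h using Vc D by (rule mult_carrier_mat)
  have "(V * mat_diag n \<mu> * transpose_mat V) * (V * mat_diag n \<nu> * transpose_mat V)
      = V * mat_diag n \<mu> * (transpose_mat V * (V * mat_diag n \<nu> * transpose_mat V))"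
    by (rule assoc_mult_mat[OF VD Vt conj_diag_carrier[OF Vc]])
  also have "transpose_mat V * (V * mat_diag n \<nu> * transpose_mat V)
      = transpose_mat V * (V * mat_diag n \<nu>) * transpose_mat V"
    by (rule assoc_mult_mat[OF Vt VD Vt, symmetric])
  also have "transpose_mat V * (V * mat_diag n \<nu>) = mat_diag n \<nu>"
    using assoc_mult_mat[OF Vt Vc D] VV left_mult_one_mat[OF D] by simp
  also have "V * mat_diag n \<mu> * (mat_diag n \<nu> * transpose_mat V)
      = V * (mat_diag n \<mu> * mat_diag n \<nu>) * transpose_mat V"
    using assoc_mult_mat[OF VD D Vt] assoc_mult_mat[OF Vc D D] by simp
  finally show ?thesis by simp
qed

lemma pow_mat_conj_diag:
  assumes V: "orth_mat n V"
  shows "(V * mat_diag n \<mu> * transpose_mat V) ^\<^sub>m r = V * mat_diag n (\<lambda>i. \<mu> i ^ r) * transpose_mat V"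
proof (induction r)
  case 0
  have "V \<in> carrier_mat n n" using V by (simp add: orth_mat_def)
  thus ?case using orth_mat_transpose(2)[OF V] by simp
next
  case (Suc r)
  show ?case unfolding pow_mat.simps Suc conj_diag_mult[OF V] by (simp add: mult.commute)
qed

lemma pinv_symmetric:
  fixes C :: "real mat"
  assumes C: "C \<in> carrier_mat m m" and sym: "transpose_mat C = C"
  shows "is_pinv C (pinv C)" and "transpose_mat (pinv C) = pinv C"
proof -
  obtain W \<nu> where W: "orth_mat m W" and CW: "C = W * mat_diag m \<nu> * transpose_mat W"
    using spectral_decomposition[OF C sym] by blast
  have Wc: "W \<in> carrier_mat m m" using W by (simp add: orth_mat_def)
  define X where "X = W * mat_diag m (\<lambda>i. inverse (\<nu> i)) * transpose_mat W"
  have [simp]: "(\<lambda>i. \<nu> i * inverse (\<nu> i) * \<nu> i) = \<nu>"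
    "(\<lambda>i. inverse (\<nu> i) * \<nu> i * inverse (\<nu> i)) = (\<lambda>i. inverse (\<nu> i))"
    by (auto simp: field_simps)
  have *: "is_pinv C X"
    unfolding is_pinv_def using conj_diag_carrier[OF Wc] C
    unfolding X_def CW conj_diag_mult[OF W] conj_diag_transpose[OF Wc]
    by (auto simp del: transpose_mult intro!: arg_cong[of _ _ "\<lambda>h. W * mat_diag m h * transpose_mat W"])
  hence eq: "pinv C = X" unfolding pinv_def using is_pinv_unique[OF _ *] by (rule the_equality)
  show "is_pinv C (pinv C)" using * eq by simp
  show "transpose_mat (pinv C) = pinv C" unfolding eq X_def by (rule conj_diag_transpose[OF Wc])
qed

lemma gram_eq_0:
  fixes Z :: "real mat"
  assumes Z: "Z \<in> carrier_mat n m" and "transpose_mat Z * Z = 0\<^sub>m m m"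
  shows "Z = 0\<^sub>m n m"
proof (rule eq_matI, goal_cases)
  case (1 i j)
  have "(\<Sum>a<n. Z $$ (a, j) * Z $$ (a, j)) = (transpose_mat Z * Z) $$ (j, j)"
    using Z 1 by (subst mult_mat_index[of _ m n _ m]) auto
  also have "\<dots> = 0" using assms(2) 1 by simp
  finally show ?case using 1 by (subst (asm) sum_nonneg_eq_0_iff) auto
qed (use Z in auto)

lemma pinv_projector:
  fixes Y :: "real mat"
  assumes Y: "Y \<in> carrier_mat n m"
  defines "P \<equiv> Y * pinv (transpose_mat Y * Y) * transpose_mat Y"
  shows "P \<in> carrier_mat n n" and "transpose_mat P = P" and "P * P = P" and "P * Y = Y"
proof -
  define C where "C = transpose_mat Y * Y"
  define X where "X = pinv C"
  have Yt: "transpose_mat Y \<in> carrier_mat m n" using Y by simp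
  have C: "C \<in> carrier_mat m m" unfolding C_def using Yt Y by (rule mult_carrier_mat)
  have sC: "transpose_mat C = C" unfolding C_def using transpose_mult[OF Yt Y] by simp
  have X: "X \<in> carrier_mat m m" "C * X * C = C" "X * C * X = X"
    using pinv_symmetric(1)[OF C sC] C by (auto simp: is_pinv_def X_def)
  have sX: "transpose_mat X = X" unfolding X_def by (rule pinv_symmetric(2)[OF C sC])
  have YX: "Y * X \<in> carrier_mat n m" using Y X(1) by (rule mult_carrier_mat)
  have P: "P = Y * X * transpose_mat Y" by (simp add: P_def X_def C_def)
  show Pc: "P \<in> carrier_mat n n" unfolding P using YX Yt by (rule mult_carrier_mat)
  show "transpose_mat P = P"
    unfolding P transpose_mult[OF YX Yt] transpose_mult[OF Y X(1)] sX
    using assoc_mult_mat[OF Y X(1) Yt] by simp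
  have XC: "X * C \<in> carrier_mat m m" using X(1) C by (rule mult_carrier_mat)
  have PY: "P * Y = Y * (X * C)"
    unfolding P assoc_mult_mat[OF YX Yt Y] C_def[symmetric] by (rule assoc_mult_mat[OF Y X(1) C])
  have "P * P = P * Y * X * transpose_mat Y"
    unfolding P[symmetric] using assoc_mult_mat[OF Pc YX Yt] assoc_mult_mat[OF Pc Y X(1)] P by simp
  also have "P * Y * X = Y * X"
    unfolding PY using assoc_mult_mat[OF Y XC X(1)] X(3) by simp
  finally show "P * P = P" using P by simp
  define K where "K = X * C - 1\<^sub>m m"
  have K: "K \<in> carrier_mat m m" unfolding K_def using XC by auto
  have CK: "C * K = 0\<^sub>m m m"
  proof -
    have "C * K = C * (X * C) - C * 1\<^sub>m m" unfolding K_def by (rule mult_minus_distrib_mat[OF C XC]) simp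
    also have "C * (X * C) = C" using X(2) assoc_mult_mat[OF C X(1) C] by simp
    finally show ?thesis using C by auto
  qed
  have YK: "Y * K \<in> carrier_mat n m" using Y K by (rule mult_carrier_mat)
  have "transpose_mat (Y * K) * (Y * K) = transpose_mat K * (C * K)"
    unfolding transpose_mult[OF Y K] C_def
    using assoc_mult_mat[OF _ Yt YK] assoc_mult_mat[OF Yt Y K] K by auto
  also have "\<dots> = 0\<^sub>m m m" unfolding CK using K by auto
  finally have "Y * K = 0\<^sub>m n m" by (rule gram_eq_0[OF YK])
  moreover have "Y * K = P * Y - Y"
    unfolding K_def PY using mult_minus_distrib_mat[OF Y XC, of "1\<^sub>m m"] Y by simp
  ultimately have *: "P * Y - Y = 0\<^sub>m n m" by simp
  show "P * Y = Y"
  proof (rule eq_matI, goal_cases)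
    case (1 i j)
    thus ?case using arg_cong[OF *, of "\<lambda>B. B $$ (i, j)"] Y by (simp del: index_mult_mat(1))
  qed (use Pc Y in auto)
qed

lemma spsd_gram:
  fixes N :: "real mat"
  assumes N: "N \<in> carrier_mat r n"
  shows "spsd n (transpose_mat N * N)"
proof -
  have Nt: "transpose_mat N \<in> carrier_mat n r" using N by simp
  have *: "transpose_mat N * N = transpose_mat N * mat_diag r (\<lambda>_. 1) * transpose_mat (transpose_mat N)"
    using Nt by simp
  show ?thesis unfolding * by (rule spsd_conj_diag[OF Nt]) simp
qed

lemma orth_mat_norm:
  assumes V: "orth_mat n V"
  shows "(\<Sum>i<n. (\<Sum>a<n. V $$ (i, a) * x a)\<^sup>2) = (\<Sum>a<n. (x a)\<^sup>2)"
proof -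
  have "(\<Sum>i<n. (\<Sum>a<n. V $$ (i, a) * x a)\<^sup>2)
      = (\<Sum>i<n. \<Sum>a<n. \<Sum>b<n. V $$ (i, a) * V $$ (i, b) * (x a * x b))"
    unfolding power2_eq_square sum_product by (intro sum.cong refl) (simp add: mult_ac)
  also have "\<dots> = (\<Sum>a<n. \<Sum>i<n. \<Sum>b<n. V $$ (i, a) * V $$ (i, b) * (x a * x b))"
    by (rule sum.swap)
  also have "\<dots> = (\<Sum>a<n. \<Sum>b<n. \<Sum>i<n. V $$ (i, a) * V $$ (i, b) * (x a * x b))"
    by (intro sum.cong refl sum.swap)
  also have "\<dots> = (\<Sum>a<n. \<Sum>b<n. (if a = b then x a * x b else 0))"
    unfolding sum_distrib_right[symmetric] by (intro sum.cong refl) (simp add: orth_mat_cols[OF V])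
  also have "\<dots> = (\<Sum>a<n. (x a)\<^sup>2)" by (simp add: sum.delta power2_eq_square)
  finally show ?thesis .
qed

lemma frobenius_norm_orth_conj:
  assumes V: "orth_mat n V" and M: "M \<in> carrier_mat n n"
  shows "(frobenius_norm (V * M * transpose_mat V))\<^sup>2 = (frobenius_norm M)\<^sup>2"
proof -
  have Vc: "V \<in> carrier_mat n n" using V by (simp add: orth_mat_def)
  have VM: "V * M \<in> carrier_mat n n" using Vc M by (rule mult_carrier_mat)
  have Vt: "transpose_mat V \<in> carrier_mat n n" using Vc by simp
  have "(frobenius_norm (V * M * transpose_mat V))\<^sup>2
      = (\<Sum>i<n. \<Sum>j<n. (\<Sum>a<n. V $$ (j, a) * (V * M) $$ (i, a))\<^sup>2)"
    unfolding frobenius_norm_sq[OF mult_carrier_mat[OF VM Vt]]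
  proof (intro sum.cong refl)
    fix i j assume "i \<in> {..<n}" "j \<in> {..<n}"
    thus "((V * M * transpose_mat V) $$ (i, j))\<^sup>2 = (\<Sum>a<n. V $$ (j, a) * (V * M) $$ (i, a))\<^sup>2"
      using Vc by (subst mult_mat_index[OF VM Vt]) (auto simp: mult.commute simp del: index_mult_mat(1))
  qed
  also have "\<dots> = (\<Sum>i<n. \<Sum>j<n. (\<Sum>a<n. V $$ (i, a) * M $$ (a, j))\<^sup>2)"
    unfolding orth_mat_norm[OF V] by (intro sum.cong refl) (simp add: mult_mat_index[OF Vc M] del: index_mult_mat(1))
  also have "\<dots> = (\<Sum>j<n. \<Sum>i<n. (\<Sum>a<n. V $$ (i, a) * M $$ (a, j))\<^sup>2)" by (rule sum.swap)
  also have "\<dots> = (\<Sum>j<n. \<Sum>i<n. (M $$ (i, j))\<^sup>2)" unfolding orth_mat_norm[OF V] ..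
  also have "\<dots> = (frobenius_norm M)\<^sup>2" unfolding frobenius_norm_sq[OF M] by (rule sum.swap)
  finally show ?thesis .
qed

lemma projector_diag_le:
  fixes P Y :: "real mat"
  assumes P: "P \<in> carrier_mat n n" "transpose_mat P = P" "P * P = P" "P * Y = Y"
    and Y: "Y \<in> carrier_mat n m" and i: "i < n"
  shows "P $$ (i, i) \<ge> 0" and "P $$ (i, i) \<le> 1"
    and "1 - P $$ (i, i) \<le> (\<Sum>s<n. ((if s = i then 1 else 0) - (\<Sum>l<m. Y $$ (s, l) * c l))\<^sup>2)"
proof -
  have sym: "P $$ (a, b) = P $$ (b, a)" if "a < n" "b < n" for a b
    using arg_cong[OF P(2), of "\<lambda>B. B $$ (a, b)"] that P(1) by simp
  have idem: "(\<Sum>b<n. P $$ (a, b) * P $$ (b, d)) = P $$ (a, d)" if "a < n" "d < n" for a d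
    using mult_mat_index[OF P(1) P(1) that] P(3) by simp
  have PY: "(\<Sum>b<n. P $$ (a, b) * Y $$ (b, l)) = Y $$ (a, l)" if "a < n" "l < m" for a l
    using mult_mat_index[OF P(1) Y that] P(4) by simp
  have Pii: "P $$ (i, i) = (\<Sum>b<n. (P $$ (b, i))\<^sup>2)"
    using idem[OF i i] sym i by (simp add: power2_eq_square)
  show p0: "P $$ (i, i) \<ge> 0" unfolding Pii by (intro sum_nonneg) auto
  have sq: "(P $$ (i, i))\<^sup>2 \<le> P $$ (i, i)"
    by (subst (2) Pii, rule member_le_sum) (use i in auto)
  show p1: "P $$ (i, i) \<le> 1"
  proof (rule ccontr)
    assume "\<not> ?thesis"
    hence "1 * P $$ (i, i) < P $$ (i, i) * P $$ (i, i)" by (intro mult_strict_right_mono) auto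
    thus False using sq by (simp add: power2_eq_square)
  qed
  let ?\<delta> = "\<lambda>s. if s = i then 1 else (0::real)"
  define y where "y = (\<lambda>s. \<Sum>l<m. Y $$ (s, l) * c l)"
  define z where "z = (\<lambda>s. ?\<delta> s - y s)"
  define u where "u = (\<lambda>s. P $$ (s, i) - y s)"
  have Py: "(\<Sum>b<n. P $$ (a, b) * y b) = y a" if a: "a < n" for a
  proof -
    have "(\<Sum>b<n. P $$ (a, b) * y b) = (\<Sum>b<n. \<Sum>l<m. P $$ (a, b) * Y $$ (b, l) * c l)"
      unfolding y_def by (simp add: sum_distrib_left mult_ac)
    also have "\<dots> = (\<Sum>l<m. \<Sum>b<n. P $$ (a, b) * Y $$ (b, l) * c l)" by (rule sum.swap)
    also have "\<dots> = y a" unfolding y_def sum_distrib_right[symmetric] using PY[OF a] by (intro sum.cong) auto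
    finally show ?thesis .
  qed
  have Pu: "(\<Sum>b<n. P $$ (a, b) * u b) = u a" if a: "a < n" for a
    unfolding u_def right_diff_distrib sum_subtractf using idem[OF a i] Py[OF a] by simp
  have orth: "(\<Sum>a<n. (?\<delta> a - P $$ (a, i)) * u a) = 0"
  proof -
    have "(\<Sum>a<n. (?\<delta> a - P $$ (a, i)) * u a) = (\<Sum>a<n. (if a = i then u i else 0)) - (\<Sum>a<n. P $$ (i, a) * u a)"
      unfolding sum_subtractf[symmetric]
      by (intro sum.cong refl) (use sym i in \<open>auto simp: left_diff_distrib\<close>)
    thus ?thesis using Pu[OF i] i by (simp add: sum.delta)
  qed
  have "1 - P $$ (i, i) = (\<Sum>a<n. (?\<delta> a - P $$ (a, i))\<^sup>2)"
  proof -
    have "(\<Sum>a<n. (?\<delta> a - P $$ (a, i))\<^sup>2) = (\<Sum>a<n. (if a = i then 1 - 2 * P $$ (i, i) else 0) + (P $$ (a, i))\<^sup>2)"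
      by (intro sum.cong refl) (auto simp: power2_eq_square algebra_simps)
    thus ?thesis unfolding sum.distrib Pii[symmetric] using i by (simp add: sum.delta)
  qed
  also have "\<dots> \<le> (\<Sum>a<n. (?\<delta> a - P $$ (a, i))\<^sup>2) + (\<Sum>a<n. (u a)\<^sup>2) + 2 * (\<Sum>a<n. (?\<delta> a - P $$ (a, i)) * u a)"
    using orth by (simp add: sum_nonneg)
  also have "\<dots> = (\<Sum>a<n. (z a)\<^sup>2)"
    unfolding sum_distrib_left sum.distrib[symmetric] z_def u_def
    by (intro sum.cong refl) (simp add: power2_eq_square algebra_simps)
  finally show "1 - P $$ (i, i) \<le> (\<Sum>s<n. (?\<delta> s - (\<Sum>l<m. Y $$ (s, l) * c l))\<^sup>2)"
    by (simp add: z_def y_def)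
qed

lemma nystrom_conj_diag:
  assumes V: "orth_mat n V" and A: "A = V * mat_diag n lam * transpose_mat V"
    and lam: "\<And>i. i < n \<Longrightarrow> 0 \<le> lam i" and q: "1 \<le> q" and Om: "Om \<in> carrier_mat n m"
  defines "S \<equiv> mat_diag n (\<lambda>i. sqrt (lam i))"
    and "Y \<equiv> mat_diag n (\<lambda>i. sqrt (lam i) ^ (2 * q - 1)) * (transpose_mat V * Om)"
  shows "nystrom A q Om
    = V * (S * (Y * pinv (transpose_mat Y * Y) * transpose_mat Y) * S) * transpose_mat V"
proof -
  have Vc: "V \<in> carrier_mat n n" using V by (simp add: orth_mat_def)
  have Vt: "transpose_mat V \<in> carrier_mat n n" using Vc by simp
  define G where "G = transpose_mat V * Om"
  have Gc: "G \<in> carrier_mat n m" unfolding G_def using Vt Om by (rule mult_carrier_mat)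
  note D = mat_diag_dim[where 'a = real and n = n]
  let ?h = "\<lambda>i. sqrt (lam i) ^ (2 * q - 1)"
  have Yc: "Y \<in> carrier_mat n m" unfolding Y_def G_def[symmetric] using D Gc by (rule mult_carrier_mat)
  have Sc: "S \<in> carrier_mat n n" by (simp add: S_def)
  have St: "transpose_mat S = S" unfolding S_def mat_diag_def by (rule eq_matI) auto
  have Yt: "transpose_mat Y = transpose_mat G * mat_diag n ?h"
    unfolding Y_def G_def[symmetric] transpose_mult[OF D Gc]
    by (rule arg_cong[of _ _ "\<lambda>X. transpose_mat G * X"]) (auto simp: mat_diag_def)
  have AO: "A ^\<^sub>m q * Om = V * (S * Y)"
  proof -
    have "A ^\<^sub>m q * Om = V * mat_diag n (\<lambda>i. lam i ^ q) * G"
      unfolding A pow_mat_conj_diag[OF V] G_def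
      by (rule assoc_mult_mat[OF mult_carrier_mat[OF Vc D] Vt Om])
    also have "\<dots> = V * (mat_diag n (\<lambda>i. lam i ^ q) * G)" by (rule assoc_mult_mat[OF Vc D Gc])
    also have "mat_diag n (\<lambda>i. lam i ^ q) = S * mat_diag n ?h"
    proof -
      have "lam i ^ q = sqrt (lam i) * ?h i" if "i < n" for i
      proof -
        have "sqrt (lam i) * ?h i = sqrt (lam i) ^ (2 * q)"
          using q by (simp flip: power_Suc)
        thus ?thesis using lam[OF that] by (simp add: power_mult)
      qed
      thus ?thesis unfolding S_def mat_diag_diag by (auto simp: mat_diag_def)
    qed
    also have "S * mat_diag n ?h * G = S * Y"
      unfolding Y_def G_def[symmetric] by (rule assoc_mult_mat[OF Sc D Gc])
    finally show ?thesis .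
  qed
  have C: "transpose_mat Om * A ^\<^sub>m (2 * q - 1) * Om = transpose_mat Y * Y"
  proof -
    let ?r = "\<lambda>i. lam i ^ (2 * q - 1)"
    have Ot: "transpose_mat Om \<in> carrier_mat m n" and Gt: "transpose_mat G \<in> carrier_mat m n"
      using Om Gc by auto
    have Gt': "transpose_mat G = transpose_mat Om * V" unfolding G_def transpose_mult[OF Vt Om] by simp
    have "transpose_mat Om * A ^\<^sub>m (2 * q - 1) * Om
        = transpose_mat Om * (V * mat_diag n ?r * transpose_mat V * Om)"
      unfolding A pow_mat_conj_diag[OF V] by (rule assoc_mult_mat[OF Ot conj_diag_carrier[OF Vc] Om])
    also have "V * mat_diag n ?r * transpose_mat V * Om = V * (mat_diag n ?r * G)"
      using assoc_mult_mat[OF mult_carrier_mat[OF Vc D] Vt Om] assoc_mult_mat[OF Vc D Gc] by (simp add: G_def)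
    also have "transpose_mat Om * (V * (mat_diag n ?r * G)) = transpose_mat G * (mat_diag n ?r * G)"
      unfolding Gt' by (rule assoc_mult_mat[OF Ot Vc mult_carrier_mat[OF D Gc], symmetric])
    also have "mat_diag n ?r = mat_diag n ?h * mat_diag n ?h"
      unfolding mat_diag_diag using lam by (auto simp: mat_diag_def simp flip: power_mult_distrib)
    also have "transpose_mat G * (mat_diag n ?h * mat_diag n ?h * G) = transpose_mat Y * Y"
      unfolding Yt using assoc_mult_mat[OF D D Gc] assoc_mult_mat[OF Gt D Yc]
      by (simp only: Y_def G_def[symmetric])
    finally show ?thesis .
  qed
  define X where "X = pinv (transpose_mat Y * Y)"
  have Xc: "X \<in> carrier_mat m m"
  proof -
    have Ytc: "transpose_mat Y \<in> carrier_mat m n" using Yc by simp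
    have c: "transpose_mat Y * Y \<in> carrier_mat m m" using Ytc Yc by (rule mult_carrier_mat)
    show ?thesis
      using pinv_symmetric(1)[OF c] transpose_mult[OF Ytc Yc] c by (auto simp: X_def is_pinv_def)
  qed
  have SY: "S * Y \<in> carrier_mat n m" using Sc Yc by (rule mult_carrier_mat)
  have Ytc: "transpose_mat Y \<in> carrier_mat m n" using Yc by simp
  have YX: "Y * X \<in> carrier_mat n m" using Yc Xc by (rule mult_carrier_mat)
  have "nystrom A q Om = V * (S * Y) * X * (transpose_mat Y * S * transpose_mat V)"
    unfolding nystrom_def AO C X_def[symmetric] transpose_mult[OF Vc SY] transpose_mult[OF Sc Yc] St ..
  also have "V * (S * Y) * X = V * (S * (Y * X))"
    using assoc_mult_mat[OF Vc SY Xc] assoc_mult_mat[OF Sc Yc Xc] by simp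
  also have "V * (S * (Y * X)) * (transpose_mat Y * S * transpose_mat V)
      = V * (S * (Y * X) * (transpose_mat Y * S)) * transpose_mat V"
  proof -
    have c1: "S * (Y * X) \<in> carrier_mat n m" using Sc YX by (rule mult_carrier_mat)
    have c2: "transpose_mat Y * S \<in> carrier_mat m n" using Ytc Sc by (rule mult_carrier_mat)
    show ?thesis
      using assoc_mult_mat[OF mult_carrier_mat[OF Vc c1] c2 Vt] assoc_mult_mat[OF Vc c1 c2] by simp
  qed
  also have "S * (Y * X) * (transpose_mat Y * S) = S * (Y * X * transpose_mat Y) * S"
    using assoc_mult_mat[OF mult_carrier_mat[OF Sc YX] Ytc Sc] assoc_mult_mat[OF Sc YX Ytc] by simp
  finally show ?thesis by (simp add: X_def)
qed

context op_mono
begin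

lemma frobenius_nystrom_le:
  fixes Om :: "real mat" and c :: "nat \<Rightarrow> nat \<Rightarrow> real"
  assumes V: "orth_mat n V" and A: "A = V * mat_diag n lam * transpose_mat V"
    and lam: "\<And>i. i < n \<Longrightarrow> 0 \<le> lam i" and q: "1 \<le> q" and Om: "Om \<in> carrier_mat n m"
    and k: "k \<le> n" and t: "0 < t" and g: "g = f t / t"
    and hi: "\<And>i. i < k \<Longrightarrow> t \<le> lam i" and lo: "\<And>i. k \<le> i \<Longrightarrow> i < n \<Longrightarrow> lam i \<le> t"
  shows "(frobenius_norm (mat_fun f A - mat_fun f (nystrom A q Om)))\<^sup>2
    \<le> (\<Sum>i=k..<n. (f (lam i))\<^sup>2) + 2 * g\<^sup>2 * (\<Sum>i<k. (lam i)\<^sup>2 *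
        (\<Sum>s<n. ((if s = i then 1 else 0) -
          sqrt (lam s) ^ (2 * q - 1) * (\<Sum>l<m. (\<Sum>a<n. V $$ (a, s) * Om $$ (a, l)) * c i l))\<^sup>2))"
proof -
  have Vc: "V \<in> carrier_mat n n" using V by (simp add: orth_mat_def)
  have Vt: "transpose_mat V \<in> carrier_mat n n" using Vc by simp
  define S where "S = mat_diag n (\<lambda>i. sqrt (lam i))"
  define Y where "Y = mat_diag n (\<lambda>i. sqrt (lam i) ^ (2 * q - 1)) * (transpose_mat V * Om)"
  have Gc: "transpose_mat V * Om \<in> carrier_mat n m" using Vt Om by (rule mult_carrier_mat)
  have Yc: "Y \<in> carrier_mat n m" unfolding Y_def using mat_diag_dim Gc by (rule mult_carrier_mat)
  define P where "P = Y * pinv (transpose_mat Y * Y) * transpose_mat Y"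
  note P = pinv_projector[OF Yc, folded P_def]
  have Sc: "S \<in> carrier_mat n n" by (simp add: S_def)
  have St: "transpose_mat S = S" unfolding S_def mat_diag_def by (rule eq_matI) auto
  define M where "M = S * P * S"
  define B where "B = nystrom A q Om"
  have B: "B = V * M * transpose_mat V"
    unfolding B_def M_def P_def S_def Y_def by (rule nystrom_conj_diag[OF V A lam q Om])
  have Mc: "M \<in> carrier_mat n n" unfolding M_def using Sc P(1) by (intro mult_carrier_mat)
  have M: "M $$ (i, j) = sqrt (lam i) * P $$ (i, j) * sqrt (lam j)" if "i < n" "j < n" for i j
    unfolding M_def S_def mat_diag_mult_left[OF P(1)] by (subst mat_diag_mult_right[of _ n n]) (use that in auto)
  have SVt: "S * transpose_mat V \<in> carrier_mat n n" using Sc Vt by (rule mult_carrier_mat)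
  have gram: "transpose_mat (Q * (S * transpose_mat V)) * (Q * (S * transpose_mat V)) = V * (S * Q * S) * transpose_mat V"
    if Q: "Q \<in> carrier_mat n n" "transpose_mat Q = Q" "Q * Q = Q" for Q
  proof -
    have VS: "V * S \<in> carrier_mat n n" using Vc Sc by (rule mult_carrier_mat)
    have "transpose_mat (Q * (S * transpose_mat V)) * (Q * (S * transpose_mat V)) = V * S * Q * (Q * (S * transpose_mat V))"
      unfolding transpose_mult[OF Q(1) SVt] transpose_mult[OF Sc Vt] St Q(2) by simp
    also have "\<dots> = V * S * (Q * Q * (S * transpose_mat V))"
      using assoc_mult_mat[OF VS Q(1) mult_carrier_mat[OF Q(1) SVt]] assoc_mult_mat[OF Q(1) Q(1) SVt] by simp
    also have "\<dots> = V * S * (Q * S * transpose_mat V)"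
      unfolding Q(3) using assoc_mult_mat[OF Q(1) Sc Vt] by simp
    also have "\<dots> = V * (S * (Q * S)) * transpose_mat V"
      using assoc_mult_mat[OF VS mult_carrier_mat[OF Q(1) Sc] Vt] assoc_mult_mat[OF Vc Sc mult_carrier_mat[OF Q(1) Sc]] by simp
    also have "S * (Q * S) = S * Q * S" using assoc_mult_mat[OF Sc Q(1) Sc] by simp
    finally show ?thesis .
  qed
  have spB: "spsd n B"
    unfolding B M_def gram[OF P(1-3), symmetric] by (rule spsd_gram[OF mult_carrier_mat[OF P(1) SVt]])
  define Q where "Q = 1\<^sub>m n - P"
  have Qc: "Q \<in> carrier_mat n n" using P(1) by (auto simp: Q_def)
  have Qt: "transpose_mat Q = Q" unfolding Q_def by (subst transpose_minus[of _ n n]) (use P in auto)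
  have QQ: "Q * Q = Q"
  proof -
    have "Q * Q = Q * 1\<^sub>m n - Q * P" unfolding Q_def[symmetric]
      by (subst (2) Q_def, rule mult_minus_distrib_mat[OF Qc _ P(1)]) simp
    also have "Q * P = 1\<^sub>m n * P - P * P"
      unfolding Q_def by (rule minus_mult_distrib_mat[OF _ P(1) P(1)]) simp
    also have "\<dots> = 0\<^sub>m n n" using P by auto
    finally show ?thesis using Qc by auto
  qed
  have "A - B = V * (S * Q * S) * transpose_mat V"
  proof -
    have c: "S * S \<in> carrier_mat n n" using Sc Sc by (rule mult_carrier_mat)
    have "S * Q * S = S * S - M"
    proof -
      have "S * Q = S * 1\<^sub>m n - S * P" unfolding Q_def by (rule mult_minus_distrib_mat[OF Sc _ P(1)]) simp
      also have "S * 1\<^sub>m n = S" using Sc by simp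
      finally show ?thesis unfolding M_def
        using minus_mult_distrib_mat[OF Sc mult_carrier_mat[OF Sc P(1)] Sc] by simp
    qed
    hence "V * (S * Q * S) * transpose_mat V = V * (S * S) * transpose_mat V - B"
      unfolding B using mult_minus_distrib_mat[OF Vc c Mc]
        minus_mult_distrib_mat[OF mult_carrier_mat[OF Vc c] mult_carrier_mat[OF Vc Mc] Vt] by simp
    moreover have "S * S = mat_diag n lam"
      unfolding S_def mat_diag_diag using lam by (auto simp: mat_diag_def)
    ultimately show ?thesis using A by simp
  qed
  hence spAB: "spsd n (A - B)"
    unfolding gram[OF Qc Qt QQ, symmetric] using spsd_gram[OF mult_carrier_mat[OF Qc SVt]] by simp
  have main: "(frobenius_norm (mat_fun f A - mat_fun f B))\<^sup>2
      \<le> (\<Sum>i=k..<n. (f (lam i))\<^sup>2) + g\<^sup>2 * ((\<Sum>i<k. (lam i)\<^sup>2) - (frobenius_norm B)\<^sup>2)"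
    by (rule frobenius_mat_fun_diff_le_ordered[OF V A lam spB spAB k t g hi lo])
  have normB: "(\<Sum>i<k. (lam i * P $$ (i, i))\<^sup>2) \<le> (frobenius_norm B)\<^sup>2"
  proof -
    have "(\<Sum>i<k. (lam i * P $$ (i, i))\<^sup>2) = (\<Sum>i<k. (M $$ (i, i))\<^sup>2)"
      using k lam M by (intro sum.cong refl) (auto simp: power_mult_distrib power2_eq_square)
    also have "\<dots> \<le> (\<Sum>i<n. (M $$ (i, i))\<^sup>2)" using k by (intro sum_mono2) auto
    also have "\<dots> \<le> (\<Sum>i<n. \<Sum>j<n. (M $$ (i, j))\<^sup>2)"
      by (intro sum_mono member_le_sum) auto
    also have "\<dots> = (frobenius_norm B)\<^sup>2" unfolding B frobenius_norm_orth_conj[OF V Mc] frobenius_norm_sq[OF Mc] ..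
    finally show ?thesis .
  qed
  define z where "z = (\<lambda>i. \<Sum>s<n. ((if s = i then 1 else 0) -
          sqrt (lam s) ^ (2 * q - 1) * (\<Sum>l<m. (\<Sum>a<n. V $$ (a, s) * Om $$ (a, l)) * c i l))\<^sup>2)"
  have z: "z i = (\<Sum>s<n. ((if s = i then 1 else 0) - (\<Sum>l<m. Y $$ (s, l) * c i l))\<^sup>2)" for i
  proof -
    have "sqrt (lam s) ^ (2 * q - 1) * (\<Sum>l<m. (\<Sum>a<n. V $$ (a, s) * Om $$ (a, l)) * c i l)
        = (\<Sum>l<m. Y $$ (s, l) * c i l)" if "s < n" for s
      unfolding sum_distrib_left Y_def mat_diag_mult_left[OF Gc]
      using that Vc by (intro sum.cong refl) (simp add: mult_mat_index[OF Vt Om] del: index_mult_mat(1))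
    thus ?thesis unfolding z_def by (intro sum.cong refl) auto
  qed
  have "(\<Sum>i<k. (lam i)\<^sup>2) - (frobenius_norm B)\<^sup>2 \<le> (\<Sum>i<k. (lam i)\<^sup>2 - (lam i * P $$ (i, i))\<^sup>2)"
    using normB by (simp add: sum_subtractf)
  also have "\<dots> \<le> (\<Sum>i<k. 2 * ((lam i)\<^sup>2 * z i))"
  proof (intro sum_mono)
    fix i assume "i \<in> {..<k}"
    hence i: "i < n" using k by auto
    note Pi = projector_diag_le[OF P Yc i]
    have "1 - (P $$ (i, i))\<^sup>2 = (1 - P $$ (i, i)) * (1 + P $$ (i, i))" by (simp add: power2_eq_square algebra_simps)
    also have "\<dots> \<le> (1 - P $$ (i, i)) * 2" using Pi(1,2) by (intro mult_left_mono) auto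
    also have "\<dots> \<le> 2 * z i" using Pi(3)[of "c i"] z[of i] by simp
    finally have "(lam i)\<^sup>2 * (1 - (P $$ (i, i))\<^sup>2) \<le> (lam i)\<^sup>2 * (2 * z i)" by (rule mult_left_mono) simp
    thus "(lam i)\<^sup>2 - (lam i * P $$ (i, i))\<^sup>2 \<le> 2 * ((lam i)\<^sup>2 * z i)"
      by (simp add: power_mult_distrib algebra_simps)
  qed
  finally have "g\<^sup>2 * ((\<Sum>i<k. (lam i)\<^sup>2) - (frobenius_norm B)\<^sup>2) \<le> g\<^sup>2 * (\<Sum>i<k. 2 * ((lam i)\<^sup>2 * z i))"
    by (rule mult_left_mono) simp
  also have "\<dots> = 2 * g\<^sup>2 * (\<Sum>i<k. (lam i)\<^sup>2 * z i)"
    by (simp add: sum_distrib_left mult_ac)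
  finally show ?thesis using main unfolding z_def B_def by linarith
qed

end

section \<open>Gaussian integration by parts\<close>

abbreviation std_gauss :: "real measure" where
  "std_gauss \<equiv> density lborel (\<lambda>x. ennreal (std_normal_density x))"

lemma prob_space_std_gauss: "prob_space std_gauss"
  by (rule prob_space_normal_density) simp

lemma prob_space_PiM_std_gauss: "prob_space (PiM I (\<lambda>_. std_gauss))"
  by (rule prob_space_PiM[OF prob_space_std_gauss])

lemma integrable_std_gauss_sq: "integrable std_gauss (\<lambda>x. x\<^sup>2)"
  using integrable_std_normal_moment[of 2] by (simp add: integrable_density)

lemma integral_std_gauss_by_parts:
  fixes h h' :: "real \<Rightarrow> real"
  assumes d: "\<And>y. (h has_real_derivative h' y) (at y)" and c: "\<And>y. isCont h' y"
    and b: "\<And>y. \<bar>h y\<bar> \<le> K * (1 + y\<^sup>2)" "\<And>y. \<bar>y * h y\<bar> \<le> K * (1 + y\<^sup>2)" "\<And>y. \<bar>h' y\<bar> \<le> K * (1 + y\<^sup>2)"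
  shows "(\<integral>y. y * h y - h' y \<partial>std_gauss) = 0"
proof -
  let ?\<phi> = std_normal_density
  define H where "H = (\<lambda>y. - (?\<phi> y * h y))"
  define H' where "H' = (\<lambda>y. ?\<phi> y * (y * h y - h' y))"
  have hc: "isCont h y" for y using d by (rule DERIV_isCont)
  have \<phi>: "(?\<phi> has_real_derivative - (y * ?\<phi> y)) (at y)" for y
  proof -
    have eq: "?\<phi> = (\<lambda>y. 1 / sqrt (2 * pi) * exp (- (y\<^sup>2 / 2)))" by (rule ext) (simp add: std_normal_density_def)
    show ?thesis unfolding eq
      by (rule DERIV_cong[OF DERIV_cmult[of _ "- (y * exp (- (y\<^sup>2 / 2)))"]])
        (auto intro!: derivative_eq_intros)
  qed
  have H: "(H has_real_derivative H' y) (at y)" for y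
    unfolding H_def H'_def by (auto intro!: derivative_eq_intros \<phi> d simp: algebra_simps)
  have cont: "continuous_on UNIV h" "continuous_on UNIV h'" using hc c by (auto intro: continuous_at_imp_continuous_on)
  have meas: "h \<in> borel_measurable borel" "h' \<in> borel_measurable borel"
    using cont by (auto intro: borel_measurable_continuous_onI)
  have H'c: "isCont H' y" for y
    unfolding H'_def by (intro continuous_intros hc c DERIV_isCont[OF \<phi>])
  have int: "integrable lborel H'"
  proof (rule Bochner_Integration.integrable_bound)
    show "integrable lborel (\<lambda>y. 2 * K * (?\<phi> y * y ^ 0 + ?\<phi> y * y ^ 2))"
      by (intro integrable_mult_right Bochner_Integration.integrable_add integrable_std_normal_moment)
    show "H' \<in> borel_measurable lborel" unfolding H'_def using meas by measurable
    show "AE y in lborel. norm (H' y) \<le> norm (2 * K * (?\<phi> y * y ^ 0 + ?\<phi> y * y ^ 2))"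
    proof (rule AE_I2)
      fix y :: real
      have "\<bar>y * h y - h' y\<bar> \<le> 2 * K * (1 + y\<^sup>2)" using b(2)[of y] b(3)[of y] by linarith
      hence "?\<phi> y * \<bar>y * h y - h' y\<bar> \<le> ?\<phi> y * (2 * K * (1 + y\<^sup>2))" by (rule mult_left_mono) simp
      thus "norm (H' y) \<le> norm (2 * K * (?\<phi> y * y ^ 0 + ?\<phi> y * y ^ 2))"
        unfolding H'_def real_norm_def abs_mult[of "?\<phi> y"]
        by (intro order_trans[OF _ abs_ge_self]) (simp add: algebra_simps)
    qed
  qed
  have bound: "\<bar>H y\<bar> \<le> K * (?\<phi> y * (1 + y\<^sup>2))" for y
    using mult_left_mono[OF b(1)[of y], of "?\<phi> y"] by (simp add: H_def abs_mult mult_ac)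
  have lim: "((\<lambda>y. K * (?\<phi> y * (1 + y\<^sup>2))) \<longlongrightarrow> 0) at_top" "((\<lambda>y. K * (?\<phi> y * (1 + y\<^sup>2))) \<longlongrightarrow> 0) at_bot"
    unfolding std_normal_density_def by real_asymp+
  have H0: "(H \<longlongrightarrow> 0) at_top" "(H \<longlongrightarrow> 0) at_bot"
    by (rule Lim_null_comparison[OF always_eventually lim(1)], use bound in simp)
      (rule Lim_null_comparison[OF always_eventually lim(2)], use bound in simp)
  have "(LBINT y=-\<infinity>..\<infinity>. H' y) = 0 - 0"
  proof (rule interval_integral_FTC_integrable)
    show "((H \<circ> real_of_ereal) \<longlongrightarrow> 0) (at_right (- \<infinity>))" "((H \<circ> real_of_ereal) \<longlongrightarrow> 0) (at_left \<infinity>)"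
      using H0 by (simp_all add: ereal_tendsto_simps)
    show "set_integrable lborel (einterval (- \<infinity>) \<infinity>) H'"
      using int by (simp add: set_integrable_def)
  qed (use H H'c in \<open>auto simp: has_real_derivative_iff_has_vector_derivative\<close>)
  hence "(\<integral>y. H' y \<partial>lborel) = 0"
    by (simp add: interval_lebesgue_integral_def set_lebesgue_integral_def)
  thus ?thesis using meas by (simp add: integral_density H'_def)
qed

context
  fixes I :: "'i set"
  assumes fin: "finite I"
begin

interpretation G: product_prob_space "\<lambda>_. std_gauss" I
  by (intro product_prob_spaceI prob_space_std_gauss)


lemma integrable_PiM_std_gauss_sq:
  assumes "i \<in> I"
  shows "integrable (PiM I (\<lambda>_. std_gauss)) (\<lambda>x. (x i)\<^sup>2)"
proof -
  have "distr (PiM I (\<lambda>_. std_gauss)) std_gauss (\<lambda>x. x i) = std_gauss"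
    by (rule distr_PiM_component[OF prob_space_std_gauss assms])
  hence "integrable (distr (PiM I (\<lambda>_. std_gauss)) std_gauss (\<lambda>x. x i)) (\<lambda>x. x\<^sup>2)"
    using integrable_std_gauss_sq by simp
  thus ?thesis by (subst (asm) integrable_distr_eq) (use assms in auto)
qed

lemma integrable_quadratic_bound:
  fixes F :: "('i \<Rightarrow> real) \<Rightarrow> real"
  assumes "F \<in> borel_measurable (PiM I (\<lambda>_. std_gauss))"
    and "\<And>x. \<bar>F x\<bar> \<le> K * (1 + (\<Sum>i\<in>I. (x i)\<^sup>2))"
  shows "integrable (PiM I (\<lambda>_. std_gauss)) F"
proof (rule Bochner_Integration.integrable_bound[OF _ assms(1)])
  show "integrable (PiM I (\<lambda>_. std_gauss)) (\<lambda>x. K * (1 + (\<Sum>i\<in>I. (x i)\<^sup>2)))"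
    by (intro integrable_mult_right Bochner_Integration.integrable_add Bochner_Integration.integrable_sum
        integrable_PiM_std_gauss_sq) (auto simp: G.P.integrable_const)
  show "AE x in PiM I (\<lambda>_. std_gauss). norm (F x) \<le> norm (K * (1 + (\<Sum>i\<in>I. (x i)\<^sup>2)))"
    using assms(2) by (intro AE_I2) (auto intro: order_trans[OF _ abs_ge_self])
qed

lemma stein_PiM:
  fixes F F' :: "('i \<Rightarrow> real) \<Rightarrow> real"
  assumes c: "c \<in> I"
    and meas: "F \<in> borel_measurable (PiM I (\<lambda>_. std_gauss))" "F' \<in> borel_measurable (PiM I (\<lambda>_. std_gauss))"
    and d: "\<And>x y. ((\<lambda>y. F (x(c := y))) has_real_derivative F' (x(c := y))) (at y)"
    and cont: "\<And>x y. isCont (\<lambda>y. F' (x(c := y))) y"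
    and b: "\<And>x. \<bar>F x\<bar> \<le> K * (1 + (\<Sum>i\<in>I. (x i)\<^sup>2))"
      "\<And>x. \<bar>x c * F x\<bar> \<le> K * (1 + (\<Sum>i\<in>I. (x i)\<^sup>2))"
      "\<And>x. \<bar>F' x\<bar> \<le> K * (1 + (\<Sum>i\<in>I. (x i)\<^sup>2))"
  shows "integrable (PiM I (\<lambda>_. std_gauss)) (\<lambda>x. x c * F x)"
    and "integrable (PiM I (\<lambda>_. std_gauss)) F'"
    and "(\<integral>x. x c * F x \<partial>PiM I (\<lambda>_. std_gauss)) = (\<integral>x. F' x \<partial>PiM I (\<lambda>_. std_gauss))"
proof -
  have [measurable]: "(\<lambda>x. x c) \<in> borel_measurable (PiM I (\<lambda>_. std_gauss))"
    using measurable_component_singleton[OF c, of "\<lambda>_. std_gauss"] by (simp cong: measurable_cong_sets)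
  note meas[measurable]
  show i1: "integrable (PiM I (\<lambda>_. std_gauss)) (\<lambda>x. x c * F x)"
    by (rule integrable_quadratic_bound[OF _ b(2)]) measurable
  show i2: "integrable (PiM I (\<lambda>_. std_gauss)) F'"
    by (rule integrable_quadratic_bound[OF _ b(3)]) measurable
  define J where "J = I - {c}"
  have J: "I = insert c J" "c \<notin> J" "finite J" using c fin by (auto simp: J_def)
  have "(\<integral>x. x c * F x - F' x \<partial>PiM I (\<lambda>_. std_gauss))
      = (\<integral>x. (\<integral>y. (x(c := y)) c * F (x(c := y)) - F' (x(c := y)) \<partial>std_gauss) \<partial>PiM J (\<lambda>_. std_gauss))"
    using Bochner_Integration.integrable_diff[OF i1 i2] unfolding J(1)
    by (intro G.product_integral_insert J)
  also have "\<dots> = (\<integral>x. 0 \<partial>PiM J (\<lambda>_. std_gauss))"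
  proof (rule Bochner_Integration.integral_cong[OF refl])
    fix x :: "'i \<Rightarrow> real"
    define s where "s = (\<Sum>i\<in>J. (x i)\<^sup>2)"
    have s0: "0 \<le> s" unfolding s_def by (intro sum_nonneg) auto
    have K0: "0 \<le> K" using b(1)[of "\<lambda>_. 0"] by simp
    have sum: "(\<Sum>i\<in>I. ((x(c := y)) i)\<^sup>2) = y\<^sup>2 + s" for y
      unfolding J(1) s_def using J by (simp cong: sum.cong) (intro sum.cong, auto)
    have le: "K * (1 + (y\<^sup>2 + s)) \<le> K * (1 + s) * (1 + y\<^sup>2)" for y
    proof -
      have "1 + (y\<^sup>2 + s) \<le> (1 + s) * (1 + y\<^sup>2)" using s0 by (simp add: algebra_simps)
      from mult_left_mono[OF this K0] show ?thesis by (simp add: mult.assoc)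
    qed
    have "(\<integral>y. y * F (x(c := y)) - F' (x(c := y)) \<partial>std_gauss) = 0"
      by (rule integral_std_gauss_by_parts[where K = "K * (1 + s)", OF d cont])
        (use b[of "x(c := y)" for y] in \<open>auto simp only: sum fun_upd_same intro: order_trans[OF _ le]\<close>)
    thus "(\<integral>y. (x(c := y)) c * F (x(c := y)) - F' (x(c := y)) \<partial>std_gauss) = 0" by simp
  qed
  finally show "(\<integral>x. x c * F x \<partial>PiM I (\<lambda>_. std_gauss)) = (\<integral>x. F' x \<partial>PiM I (\<lambda>_. std_gauss))"
    using Bochner_Integration.integral_diff[OF i1 i2] by simp
qed

end

section \<open>A regularized pseudoinverse\<close>

locale regularized_sketch =
  fixes V :: "nat \<Rightarrow> nat \<Rightarrow> real" and n m k :: nat and \<epsilon> :: real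
  assumes orth: "\<And>i j. i < n \<Longrightarrow> j < n \<Longrightarrow> (\<Sum>a<n. V a i * V a j) = (if i = j then 1 else 0)"
    and k_le: "k \<le> n" and eps: "0 < \<epsilon>"
begin

definition G :: "(nat \<times> nat \<Rightarrow> real) \<Rightarrow> nat \<Rightarrow> nat \<Rightarrow> real" where
  "G x i l = (\<Sum>a<n. V a i * x (a, l))"

definition W :: "(nat \<times> nat \<Rightarrow> real) \<Rightarrow> nat \<Rightarrow> nat \<Rightarrow> real" where
  "W x i j = (\<Sum>l<m. G x i l * G x j l)"

definition W\<epsilon> :: "(nat \<times> nat \<Rightarrow> real) \<Rightarrow> real mat" where
  "W\<epsilon> x = Matrix.mat k k (\<lambda>(i, j). W x i j + (if i = j then \<epsilon> else 0))"

definition R :: "(nat \<times> nat \<Rightarrow> real) \<Rightarrow> nat \<Rightarrow> nat \<Rightarrow> real" where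
  "R x i j = adj_mat (W\<epsilon> x) $$ (i, j) / det (W\<epsilon> x)"

text \<open>With \<open>G\<^sub>1\<close> the first \<open>k\<close> rows of \<open>G\<close>: \<open>X = G\<^sub>1\<^sup>T (G\<^sub>1 G\<^sub>1\<^sup>T + \<epsilon>)\<inverse>\<close> is a regularized right
  inverse of \<open>G\<^sub>1\<close>, and \<open>Q = G\<^sub>1\<^sup>T (G\<^sub>1 G\<^sub>1\<^sup>T + \<epsilon>)\<inverse> G\<^sub>1\<close>.\<close>

definition X :: "(nat \<times> nat \<Rightarrow> real) \<Rightarrow> nat \<Rightarrow> nat \<Rightarrow> real" where
  "X x l i = (\<Sum>p<k. G x p l * R x p i)"

definition Q :: "(nat \<times> nat \<Rightarrow> real) \<Rightarrow> nat \<Rightarrow> nat \<Rightarrow> real" where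
  "Q x l l' = (\<Sum>i<k. G x i l * X x l' i)"

lemma W\<epsilon>_carrier: "W\<epsilon> x \<in> carrier_mat k k"
  by (simp add: W\<epsilon>_def)

lemma W_sym: "W x i j = W x j i"
  unfolding W_def by (simp add: mult.commute)

lemma det_W\<epsilon>: "det (W\<epsilon> x) \<noteq> 0"
proof
  assume "det (W\<epsilon> x) = 0"
  then obtain v where v: "v \<in> carrier_vec k" "v \<noteq> 0\<^sub>v k" "W\<epsilon> x *\<^sub>v v = 0\<^sub>v k"
    using det_0_iff_vec_prod_zero_field[OF W\<epsilon>_carrier] by blast
  have row: "(\<Sum>j<k. (W x i j + (if i = j then \<epsilon> else 0)) * v $ j) = 0" if "i < k" for i
    using arg_cong[OF v(3), of "\<lambda>u. u $ i"] that v(1)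
    by (simp add: W\<epsilon>_def scalar_prod_def lessThan_atLeast0)
  have "0 = (\<Sum>i<k. v $ i * (\<Sum>j<k. (W x i j + (if i = j then \<epsilon> else 0)) * v $ j))"
    using row by simp
  also have "\<dots> = (\<Sum>i<k. \<Sum>j<k. v $ i * W x i j * v $ j) + (\<Sum>i<k. \<Sum>j<k. if i = j then \<epsilon> * (v $ i)\<^sup>2 else 0)"
    unfolding sum.distrib[symmetric] sum_distrib_left
    by (intro sum.cong refl) (auto simp: algebra_simps power2_eq_square)
  also have "(\<Sum>i<k. \<Sum>j<k. v $ i * W x i j * v $ j) = (\<Sum>l<m. (\<Sum>i<k. v $ i * G x i l)\<^sup>2)"
  proof -
    have "(\<Sum>i<k. \<Sum>j<k. v $ i * W x i j * v $ j)
        = (\<Sum>i<k. \<Sum>j<k. \<Sum>l<m. v $ i * G x i l * (v $ j * G x j l))"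
      unfolding W_def by (simp add: sum_distrib_left sum_distrib_right mult_ac)
    also have "\<dots> = (\<Sum>i<k. \<Sum>l<m. \<Sum>j<k. v $ i * G x i l * (v $ j * G x j l))"
      by (intro sum.cong refl sum.swap)
    also have "\<dots> = (\<Sum>l<m. \<Sum>i<k. \<Sum>j<k. v $ i * G x i l * (v $ j * G x j l))" by (rule sum.swap)
    finally show ?thesis by (simp add: power2_eq_square sum_product)
  qed
  also have "(\<Sum>i<k. \<Sum>j<k. if i = j then \<epsilon> * (v $ i)\<^sup>2 else 0) = \<epsilon> * (\<Sum>i<k. (v $ i)\<^sup>2)"
    by (simp add: sum.delta sum_distrib_left)
  finally have "\<epsilon> * (\<Sum>i<k. (v $ i)\<^sup>2) \<le> 0"
    using sum_nonneg[of "{..<m}" "\<lambda>l. (\<Sum>i<k. v $ i * G x i l)\<^sup>2"] by simp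
  hence "(\<Sum>i<k. (v $ i)\<^sup>2) = 0"
    using eps sum_nonneg[of "{..<k}" "\<lambda>i. (v $ i)\<^sup>2"] by (simp add: mult_le_0_iff)
  hence "\<forall>i<k. v $ i = 0" by (subst (asm) sum_nonneg_eq_0_iff) auto
  thus False using v(1,2) by (metis eq_vecI carrier_vecD index_zero_vec)
qed

lemma
  assumes "i < k" and "j < k"
  shows W_R: "(\<Sum>p<k. W x i p * R x p j) = (if i = j then 1 else 0) - \<epsilon> * R x i j"
    and R_W: "(\<Sum>p<k. R x i p * W x p j) = (if i = j then 1 else 0) - \<epsilon> * R x i j"
proof -
  note adj = adj_mat[OF W\<epsilon>_carrier[of x]]
  have "(\<Sum>p<k. (W x i p + (if i = p then \<epsilon> else 0)) * adj_mat (W\<epsilon> x) $$ (p, j)) = (W\<epsilon> x * adj_mat (W\<epsilon> x)) $$ (i, j)"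
    using assms adj(1) W\<epsilon>_carrier[of x]
    by (simp add: scalar_prod_def lessThan_atLeast0) (simp add: W\<epsilon>_def)
  also have "\<dots> = det (W\<epsilon> x) * (if i = j then 1 else 0)" unfolding adj(2) using assms by simp
  finally have "(\<Sum>p<k. (W x i p + (if i = p then \<epsilon> else 0)) * R x p j) = (if i = j then 1 else 0)"
    unfolding R_def using det_W\<epsilon>[of x] by (auto simp flip: sum_divide_distrib)
  moreover have "(\<Sum>p<k. (W x i p + (if i = p then \<epsilon> else 0)) * R x p j)
      = (\<Sum>p<k. W x i p * R x p j) + (\<Sum>p<k. if i = p then \<epsilon> * R x i j else 0)"
    unfolding sum.distrib[symmetric] by (intro sum.cong) (auto simp: algebra_simps)
  ultimately show "(\<Sum>p<k. W x i p * R x p j) = (if i = j then 1 else 0) - \<epsilon> * R x i j"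
    using assms by (simp add: sum.delta)
  have "(\<Sum>p<k. adj_mat (W\<epsilon> x) $$ (i, p) * (W x p j + (if p = j then \<epsilon> else 0))) = (adj_mat (W\<epsilon> x) * W\<epsilon> x) $$ (i, j)"
    using assms adj(1) W\<epsilon>_carrier[of x]
    by (simp add: scalar_prod_def lessThan_atLeast0) (simp add: W\<epsilon>_def)
  also have "\<dots> = det (W\<epsilon> x) * (if i = j then 1 else 0)" unfolding adj(3) using assms by simp
  finally have "(\<Sum>p<k. R x i p * (W x p j + (if p = j then \<epsilon> else 0))) = (if i = j then 1 else 0)"
    unfolding R_def using det_W\<epsilon>[of x] by (auto simp flip: sum_divide_distrib)
  moreover have "(\<Sum>p<k. R x i p * (W x p j + (if p = j then \<epsilon> else 0)))
      = (\<Sum>p<k. R x i p * W x p j) + (\<Sum>p<k. if p = j then \<epsilon> * R x i j else 0)"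
    unfolding sum.distrib[symmetric] by (intro sum.cong) (auto simp: algebra_simps)
  ultimately show "(\<Sum>p<k. R x i p * W x p j) = (if i = j then 1 else 0) - \<epsilon> * R x i j"
    using assms by (simp add: sum.delta)
qed

lemma R_diff:
  assumes i: "i < k" and j: "j < k"
  shows "R y i j - R x i j = - (\<Sum>p<k. \<Sum>q<k. R y i p * (W y p q - W x p q) * R x q j)"
proof -
  have "(\<Sum>p<k. \<Sum>q<k. R y i p * W y p q * R x q j) = (\<Sum>q<k. (\<Sum>p<k. R y i p * W y p q) * R x q j)"
    unfolding sum_distrib_right by (rule sum.swap)
  also have "\<dots> = (\<Sum>q<k. ((if i = q then 1 else 0) - \<epsilon> * R y i q) * R x q j)"
    by (intro sum.cong refl) (simp add: R_W[OF i])
  also have "\<dots> = (\<Sum>q<k. (if i = q then R x i j else 0)) - \<epsilon> * (\<Sum>q<k. R y i q * R x q j)"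
    unfolding sum_distrib_left sum_subtractf[symmetric] by (intro sum.cong) (auto simp: algebra_simps)
  finally have 1: "(\<Sum>p<k. \<Sum>q<k. R y i p * W y p q * R x q j) = R x i j - \<epsilon> * (\<Sum>q<k. R y i q * R x q j)"
    using i by (simp add: sum.delta)
  have "(\<Sum>p<k. \<Sum>q<k. R y i p * W x p q * R x q j) = (\<Sum>p<k. R y i p * (\<Sum>q<k. W x p q * R x q j))"
    by (simp add: sum_distrib_left mult.assoc)
  also have "\<dots> = (\<Sum>p<k. R y i p * ((if p = j then 1 else 0) - \<epsilon> * R x p j))"
    by (intro sum.cong refl) (simp add: W_R[OF _ j])
  also have "\<dots> = (\<Sum>p<k. (if p = j then R y i j else 0)) - \<epsilon> * (\<Sum>p<k. R y i p * R x p j)"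
    unfolding sum_distrib_left sum_subtractf[symmetric] by (intro sum.cong) (auto simp: algebra_simps)
  finally have 2: "(\<Sum>p<k. \<Sum>q<k. R y i p * W x p q * R x q j) = R y i j - \<epsilon> * (\<Sum>p<k. R y i p * R x p j)"
    using j by (simp add: sum.delta)
  show ?thesis unfolding right_diff_distrib left_diff_distrib sum_subtractf 1 2 by simp
qed

lemma R_sym:
  assumes i: "i < k" and j: "j < k"
  shows "R x i j = R x j i"
proof -
  have "R x i j = (\<Sum>p<k. R x i p * (if p = j then 1 else 0))"
    using j by (simp add: sum.delta if_distrib[of "(*) _"] cong: if_cong)
  also have "\<dots> = (\<Sum>p<k. R x i p * ((\<Sum>q<k. W x p q * R x j q) + \<epsilon> * R x j p))"
  proof (intro sum.cong refl)
    fix p assume "p \<in> {..<k}"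
    hence "(\<Sum>q<k. W x p q * R x j q) + \<epsilon> * R x j p = (if p = j then 1 else 0)"
      using R_W[OF j, of p x] W_sym[of x p] by (auto simp: mult.commute)
    thus "R x i p * (if p = j then 1 else 0) = R x i p * ((\<Sum>q<k. W x p q * R x j q) + \<epsilon> * R x j p)" by simp
  qed
  also have "\<dots> = (\<Sum>p<k. \<Sum>q<k. R x i p * W x p q * R x j q) + \<epsilon> * (\<Sum>p<k. R x i p * R x j p)"
    by (simp add: distrib_left sum.distrib sum_distrib_left mult_ac)
  also have "(\<Sum>p<k. \<Sum>q<k. R x i p * W x p q * R x j q) = (\<Sum>q<k. (\<Sum>p<k. R x i p * W x p q) * R x j q)"
    unfolding sum_distrib_right by (rule sum.swap)
  also have "\<dots> = (\<Sum>q<k. ((if i = q then 1 else 0) - \<epsilon> * R x i q) * R x j q)"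
    by (intro sum.cong refl) (simp add: R_W[OF i])
  also have "\<dots> = (\<Sum>q<k. (if i = q then R x j i else 0)) - \<epsilon> * (\<Sum>q<k. R x i q * R x j q)"
    unfolding sum_distrib_left sum_subtractf[symmetric] by (intro sum.cong) (auto simp: algebra_simps)
  finally show ?thesis using i by (simp add: sum.delta)
qed

lemma G_X:
  assumes i: "i < k" and j: "j < k"
  shows "(\<Sum>l<m. G x i l * X x l j) = (if i = j then 1 else 0) - \<epsilon> * R x i j"
proof -
  have "(\<Sum>l<m. G x i l * X x l j) = (\<Sum>l<m. \<Sum>p<k. G x i l * G x p l * R x p j)"
    by (simp add: X_def sum_distrib_left mult.assoc)
  also have "\<dots> = (\<Sum>p<k. \<Sum>l<m. G x i l * G x p l * R x p j)" by (rule sum.swap)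
  also have "\<dots> = (\<Sum>p<k. W x i p * R x p j)" by (simp add: W_def sum_distrib_right)
  finally show ?thesis using W_R[OF i j] by simp
qed

lemma X_X:
  assumes i: "i < k" and j: "j < k"
  shows "(\<Sum>l<m. X x l i * X x l j) = R x i j - \<epsilon> * (\<Sum>p<k. R x i p * R x p j)"
proof -
  have "(\<Sum>l<m. X x l i * X x l j) = (\<Sum>l<m. \<Sum>p<k. R x i p * (G x p l * X x l j))"
    unfolding X_def[of x _ i] sum_distrib_right by (intro sum.cong refl) (use R_sym[OF i] in \<open>simp add: mult_ac\<close>)
  also have "\<dots> = (\<Sum>p<k. \<Sum>l<m. R x i p * (G x p l * X x l j))" by (rule sum.swap)
  also have "\<dots> = (\<Sum>p<k. R x i p * ((if p = j then 1 else 0) - \<epsilon> * R x p j))"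
    unfolding sum_distrib_left[symmetric] by (intro sum.cong refl) (simp add: G_X[OF _ j])
  also have "\<dots> = (\<Sum>p<k. (if p = j then R x i j else 0)) - \<epsilon> * (\<Sum>p<k. R x i p * R x p j)"
    unfolding sum_distrib_left sum_subtractf[symmetric] by (intro sum.cong) (auto simp: algebra_simps)
  finally show ?thesis using j by (simp add: sum.delta)
qed

lemma R_diag:
  assumes i: "i < k"
  shows "R x i i = (\<Sum>l<m. (X x l i)\<^sup>2) + \<epsilon> * (\<Sum>p<k. (R x i p)\<^sup>2)"
proof -
  have "(\<Sum>p<k. R x i p * R x p i) = (\<Sum>p<k. (R x i p)\<^sup>2)"
    by (intro sum.cong refl) (use R_sym[OF i] in \<open>simp add: power2_eq_square\<close>)
  thus ?thesis using X_X[OF i i, of x] by (simp add: power2_eq_square)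
qed

lemma
  assumes i: "i < k"
  shows X_sq_le: "(\<Sum>l<m. (X x l i)\<^sup>2) \<le> R x i i"
    and R_sq_le: "\<epsilon> * (\<Sum>p<k. (R x i p)\<^sup>2) \<le> R x i i"
    and R_diag_nonneg: "0 \<le> R x i i"
    and R_diag_le: "R x i i \<le> 1 / \<epsilon>"
proof -
  have s: "0 \<le> (\<Sum>l<m. (X x l i)\<^sup>2)" "0 \<le> \<epsilon> * (\<Sum>p<k. (R x i p)\<^sup>2)"
    using eps by (auto intro!: sum_nonneg mult_nonneg_nonneg)
  show "(\<Sum>l<m. (X x l i)\<^sup>2) \<le> R x i i" "\<epsilon> * (\<Sum>p<k. (R x i p)\<^sup>2) \<le> R x i i" "0 \<le> R x i i"
    using R_diag[OF i, of x] s by linarith+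
  have "\<epsilon> * (R x i i)\<^sup>2 \<le> \<epsilon> * (\<Sum>p<k. (R x i p)\<^sup>2)"
    using eps i by (intro mult_left_mono member_le_sum) auto
  also have "\<dots> \<le> R x i i" by fact
  finally have "(\<epsilon> * R x i i) * R x i i \<le> 1 * R x i i" by (simp add: power2_eq_square)
  hence "\<epsilon> * R x i i \<le> 1"
    using mult_right_le_imp_le[of "\<epsilon> * R x i i" "R x i i" 1] \<open>0 \<le> R x i i\<close>
    by (cases "R x i i = 0") auto
  thus "R x i i \<le> 1 / \<epsilon>" using eps by (simp add: field_simps)
qed

definition B :: real where "B = 1 + 1 / \<epsilon>"

lemma B_ge_1: "1 \<le> B" and B_pos: "0 < B"
  using eps by (auto simp: B_def add_pos_pos)

lemma abs_le_B: "y\<^sup>2 \<le> B \<Longrightarrow> \<bar>y\<bar> \<le> B"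
proof -
  assume "y\<^sup>2 \<le> B"
  also have "B \<le> B\<^sup>2" using B_ge_1 by (simp add: power2_eq_square)
  finally show ?thesis using B_pos by (simp flip: abs_le_square_iff)
qed

lemma R_bound:
  assumes i: "i < k" and j: "j < k"
  shows "\<bar>R x i j\<bar> \<le> 1 / \<epsilon>"
proof -
  have "\<epsilon> * (R x i j)\<^sup>2 \<le> \<epsilon> * (\<Sum>p<k. (R x i p)\<^sup>2)"
    using eps j by (intro mult_left_mono member_le_sum) auto
  also have "\<dots> \<le> 1 / \<epsilon>" using R_sq_le[OF i, of x] R_diag_le[OF i, of x] by linarith
  finally have "(R x i j)\<^sup>2 \<le> (1 / \<epsilon>)\<^sup>2" using eps by (simp add: field_simps power2_eq_square)
  thus ?thesis using eps by (simp add: abs_le_square_iff[symmetric])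
qed

lemma R_bound': "i < k \<Longrightarrow> j < k \<Longrightarrow> \<bar>R x i j\<bar> \<le> B"
  using R_bound[of i j x] by (simp add: B_def)

lemma X_bound:
  assumes l: "l < m" and i: "i < k"
  shows "\<bar>X x l i\<bar> \<le> B"
proof (rule abs_le_B)
  have "(X x l i)\<^sup>2 \<le> (\<Sum>l<m. (X x l i)\<^sup>2)" using l by (intro member_le_sum) auto
  thus "(X x l i)\<^sup>2 \<le> B" using X_sq_le[OF i, of x] R_diag_le[OF i, of x] by (simp add: B_def)
qed

lemma Q_sym:
  "Q x l l' = Q x l' l"
proof -
  have "Q x l l' = (\<Sum>i<k. \<Sum>p<k. G x i l * G x p l' * R x p i)"
    by (simp add: Q_def X_def sum_distrib_left mult.assoc)
  also have "\<dots> = (\<Sum>p<k. \<Sum>i<k. G x i l * G x p l' * R x p i)" by (rule sum.swap)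
  also have "\<dots> = (\<Sum>p<k. \<Sum>i<k. G x p l' * (G x i l * R x i p))"
    by (intro sum.cong refl) (use R_sym in \<open>simp add: mult_ac\<close>)
  also have "\<dots> = Q x l' l" by (simp add: Q_def X_def sum_distrib_left)
  finally show ?thesis .
qed

lemma Q_bound:
  assumes l: "l < m" and l': "l' < m"
  shows "\<bar>Q x l l'\<bar> \<le> B"
proof -
  have "(\<Sum>r<m. (Q x l r)\<^sup>2) = (\<Sum>r<m. \<Sum>i<k. \<Sum>j<k. G x i l * X x r i * (G x j r * X x l j))"
    unfolding power2_eq_square by (subst (2) Q_sym) (simp add: Q_def sum_product)
  also have "\<dots> = (\<Sum>i<k. \<Sum>r<m. \<Sum>j<k. G x i l * X x r i * (G x j r * X x l j))" by (rule sum.swap)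
  also have "\<dots> = (\<Sum>i<k. \<Sum>j<k. \<Sum>r<m. G x i l * X x r i * (G x j r * X x l j))"
    by (intro sum.cong refl sum.swap)
  also have "\<dots> = (\<Sum>i<k. \<Sum>j<k. G x i l * X x l j * (\<Sum>r<m. G x j r * X x r i))"
    by (simp add: sum_distrib_left mult_ac)
  also have "\<dots> = (\<Sum>i<k. \<Sum>j<k. G x i l * X x l j * ((if j = i then 1 else 0) - \<epsilon> * R x j i))"
    by (intro sum.cong refl) (simp add: G_X)
  also have "\<dots> = (\<Sum>i<k. \<Sum>j<k. (if j = i then G x i l * X x l i else 0) - \<epsilon> * (X x l j * (G x i l * R x i j)))"
    by (intro sum.cong refl) (use R_sym in \<open>auto simp: algebra_simps\<close>)
  also have "\<dots> = Q x l l - \<epsilon> * (\<Sum>i<k. \<Sum>j<k. X x l j * (G x i l * R x i j))"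
    by (simp add: sum_subtractf sum.delta Q_def sum_distrib_left)
  also have "(\<Sum>i<k. \<Sum>j<k. X x l j * (G x i l * R x i j)) = (\<Sum>j<k. \<Sum>i<k. X x l j * (G x i l * R x i j))"
    by (rule sum.swap)
  also have "\<dots> = (\<Sum>j<k. (X x l j)\<^sup>2)" by (simp add: X_def[of x l] sum_distrib_left power2_eq_square)
  finally have le: "(\<Sum>r<m. (Q x l r)\<^sup>2) \<le> Q x l l" using eps by (simp add: sum_nonneg)
  have "(Q x l l)\<^sup>2 \<le> (\<Sum>r<m. (Q x l r)\<^sup>2)" using l by (intro member_le_sum) auto
  hence "Q x l l * Q x l l \<le> 1 * Q x l l" using le by (simp add: power2_eq_square)
  hence "Q x l l \<le> 1"
    using mult_right_le_imp_le[of "Q x l l" "Q x l l" 1] by (cases "Q x l l > 0") auto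
  moreover have "(Q x l l')\<^sup>2 \<le> (\<Sum>r<m. (Q x l r)\<^sup>2)" using l' by (intro member_le_sum) auto
  ultimately have "(Q x l l')\<^sup>2 \<le> B" using le B_ge_1 by linarith
  thus ?thesis by (rule abs_le_B)
qed

lemma trace_Q: "(\<Sum>l<m. Q x l l) = real k - \<epsilon> * (\<Sum>i<k. R x i i)"
proof -
  have "(\<Sum>l<m. Q x l l) = (\<Sum>i<k. \<Sum>l<m. G x i l * X x l i)" unfolding Q_def by (rule sum.swap)
  thus ?thesis by (simp add: G_X sum_subtractf sum_distrib_left)
qed

end

section \<open>Expectations by Stein's identity\<close>

lemma borel_measurable_det:
  fixes A :: "'a \<Rightarrow> real mat"
  assumes A: "\<And>x. A x \<in> carrier_mat k k"
    and m: "\<And>i j. i < k \<Longrightarrow> j < k \<Longrightarrow> (\<lambda>x. A x $$ (i, j)) \<in> borel_measurable M"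
  shows "(\<lambda>x. det (A x)) \<in> borel_measurable M"
proof -
  have "(\<lambda>x. det (A x)) = (\<lambda>x. \<Sum>p | p permutes {0..<k}. signof p * (\<Prod>i = 0..<k. A x $$ (i, p i)))"
    by (rule ext) (rule det_def'[OF A])
  also have "\<dots> \<in> borel_measurable M"
    by (intro borel_measurable_sum borel_measurable_times borel_measurable_prod borel_measurable_const m)
      (auto simp: permutes_in_image[of _ "{0..<k}", simplified])
  finally show ?thesis .
qed

lemma borel_measurable_adj_mat:
  fixes A :: "'a \<Rightarrow> real mat"
  assumes A: "\<And>x. A x \<in> carrier_mat k k"
    and m: "\<And>i j. i < k \<Longrightarrow> j < k \<Longrightarrow> (\<lambda>x. A x $$ (i, j)) \<in> borel_measurable M"
    and i: "i < k" and j: "j < k"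
  shows "(\<lambda>x. adj_mat (A x) $$ (i, j)) \<in> borel_measurable M"
proof -
  have "(\<lambda>x. adj_mat (A x) $$ (i, j)) = (\<lambda>x. (-1) ^ (j + i) * det (mat_delete (A x) j i))"
    using i j by (simp add: adj_mat_def cofactor_def carrier_matD[OF A])
  moreover have "(\<lambda>x. det (mat_delete (A x) j i)) \<in> borel_measurable M"
  proof (rule borel_measurable_det)
    show "mat_delete (A x) j i \<in> carrier_mat (k - 1) (k - 1)" for x by (rule mat_delete_carrier[OF A])
    fix a b assume ab: "a < k - 1" "b < k - 1"
    have "mat_delete (A x) j i $$ (a, b) = A x $$ (if a < j then a else Suc a, if b < i then b else Suc b)" for x
      using ab A[of x] by (simp add: mat_delete_def)
    thus "(\<lambda>x. mat_delete (A x) j i $$ (a, b)) \<in> borel_measurable M"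
      using m[of "if a < j then a else Suc a" "if b < i then b else Suc b"] ab by auto
  qed
  ultimately show ?thesis by simp
qed

lemma integral_double_sum:
  fixes f :: "nat \<Rightarrow> nat \<Rightarrow> 'a \<Rightarrow> real"
  assumes "\<And>a l. a < n \<Longrightarrow> l < m \<Longrightarrow> integrable M (f a l)"
  shows "(\<integral>x. (\<Sum>a<n. \<Sum>l<m. f a l x) \<partial>M) = (\<Sum>a<n. \<Sum>l<m. \<integral>x. f a l x \<partial>M)"
proof -
  have "(\<integral>x. (\<Sum>a<n. \<Sum>l<m. f a l x) \<partial>M) = (\<Sum>a<n. \<integral>x. (\<Sum>l<m. f a l x) \<partial>M)"
    by (intro Bochner_Integration.integral_sum Bochner_Integration.integrable_sum assms) auto
  also have "\<dots> = (\<Sum>a<n. \<Sum>l<m. \<integral>x. f a l x \<partial>M)"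
    by (intro sum.cong refl Bochner_Integration.integral_sum assms) auto
  finally show ?thesis .
qed

context regularized_sketch
begin

abbreviation P :: "(nat \<times> nat \<Rightarrow> real) measure" where
  "P \<equiv> PiM ({..<n} \<times> {..<m}) (\<lambda>_. std_gauss)"

definition r :: "(nat \<times> nat \<Rightarrow> real) \<Rightarrow> nat \<Rightarrow> nat \<Rightarrow> real" where
  "r x a j = (\<Sum>i<k. V a i * R x i j)"

definition Y :: "(nat \<times> nat \<Rightarrow> real) \<Rightarrow> nat \<Rightarrow> nat \<Rightarrow> real" where
  "Y x a l = (\<Sum>i<k. V a i * X x l i)"

text \<open>The partial derivative of \<open>X x l' j\<close> with respect to the variable \<open>x (a, l)\<close>.\<close>

definition DX :: "(nat \<times> nat \<Rightarrow> real) \<Rightarrow> nat \<Rightarrow> nat \<Rightarrow> nat \<Rightarrow> nat \<Rightarrow> real" where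
  "DX x a l l' j = (if l' = l then r x a j else 0) - Y x a l' * X x l j - Q x l' l * r x a j"

lemma G_deriv:
  assumes a: "a < n"
  shows "((\<lambda>y. G (x((a, l) := y)) i l') has_real_derivative (if l' = l then V a i else 0)) (at y)"
proof -
  have "((\<lambda>y. \<Sum>b<n. V b i * (x((a, l) := y)) (b, l')) has_real_derivative
      (\<Sum>b<n. if b = a then (if l' = l then V a i else 0) else 0)) (at y)"
  proof (rule DERIV_sum)
    fix b
    show "((\<lambda>y. V b i * (x((a, l) := y)) (b, l')) has_real_derivative
        (if b = a then (if l' = l then V a i else 0) else 0)) (at y)"
      by (cases "(b, l') = (a, l)") (auto intro!: derivative_eq_intros)
  qed
  thus ?thesis unfolding G_def using a by (simp add: sum.delta)
qed

lemma W_deriv: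
  assumes a: "a < n" and l: "l < m"
  shows "((\<lambda>y. W (x((a, l) := y)) i j) has_real_derivative
    V a i * G (x((a, l) := y)) j l + G (x((a, l) := y)) i l * V a j) (at y)"
proof -
  let ?x = "x((a, l) := y)"
  have 1: "((\<lambda>y. \<Sum>l'<m. G (x((a, l) := y)) i l' * G (x((a, l) := y)) j l') has_real_derivative
      (\<Sum>l'<m. (if l' = l then V a i else 0) * G ?x j l' + (if l' = l then V a j else 0) * G ?x i l')) (at y)"
    by (intro DERIV_sum DERIV_mult G_deriv a)
  have "(\<Sum>l'<m. (if l' = l then V a i else 0) * G ?x j l' + (if l' = l then V a j else 0) * G ?x i l')
      = (\<Sum>l'<m. if l' = l then V a i * G ?x j l + G ?x i l * V a j else 0)"
    by (intro sum.cong) auto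
  also have "\<dots> = V a i * G ?x j l + G ?x i l * V a j" using l by (simp only: sum.delta' sum.delta finite_lessThan) simp
  finally have 2: "(\<Sum>l'<m. (if l' = l then V a i else 0) * G ?x j l' + (if l' = l then V a j else 0) * G ?x i l') = \<dots>" .
  show ?thesis using 1 unfolding W_def 2 .
qed

lemma R_cont:
  assumes a: "a < n" and l: "l < m" and i: "i < k" and j: "j < k"
  shows "((\<lambda>z. R (x((a, l) := z)) i j) \<longlongrightarrow> R (x((a, l) := y)) i j) (at y)"
proof (rule LIM_zero_cancel, rule Lim_null_comparison[OF always_eventually])
  let ?x = "\<lambda>z. x((a, l) := z)"
  show "\<forall>z. norm (R (?x z) i j - R (?x y) i j)
      \<le> (\<Sum>p<k. \<Sum>q<k. (1 / \<epsilon>) * \<bar>W (?x z) p q - W (?x y) p q\<bar> * (1 / \<epsilon>))"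
  proof
    fix z
    have "norm (R (?x z) i j - R (?x y) i j)
        \<le> (\<Sum>p<k. \<Sum>q<k. \<bar>R (?x z) i p * (W (?x z) p q - W (?x y) p q) * R (?x y) q j\<bar>)"
      unfolding R_diff[OF i j] real_norm_def abs_minus_cancel
      by (rule order_trans[OF sum_abs], rule sum_mono, rule sum_abs)
    also have "\<dots> \<le> (\<Sum>p<k. \<Sum>q<k. (1 / \<epsilon>) * \<bar>W (?x z) p q - W (?x y) p q\<bar> * (1 / \<epsilon>))"
      unfolding abs_mult using i j eps
      by (intro sum_mono mult_mono R_bound mult_nonneg_nonneg) auto
    finally show "norm (R (?x z) i j - R (?x y) i j)
        \<le> (\<Sum>p<k. \<Sum>q<k. (1 / \<epsilon>) * \<bar>W (?x z) p q - W (?x y) p q\<bar> * (1 / \<epsilon>))" .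
  qed
  have W: "((\<lambda>z. W (?x z) p q) \<longlongrightarrow> W (?x y) p q) (at y)" for p q
    using DERIV_isCont[OF W_deriv[OF a l]] unfolding isCont_def by blast
  have "((\<lambda>z. \<Sum>p<k. \<Sum>q<k. (1 / \<epsilon>) * \<bar>W (?x z) p q - W (?x y) p q\<bar> * (1 / \<epsilon>))
      \<longlongrightarrow> (\<Sum>p<k. \<Sum>q<k. (1 / \<epsilon>) * \<bar>W (?x y) p q - W (?x y) p q\<bar> * (1 / \<epsilon>))) (at y)"
    by (intro tendsto_intros W)
  thus "((\<lambda>z. \<Sum>p<k. \<Sum>q<k. (1 / \<epsilon>) * \<bar>W (?x z) p q - W (?x y) p q\<bar> * (1 / \<epsilon>)) \<longlongrightarrow> 0) (at y)"
    by simp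
qed

lemma R_deriv:
  fixes x :: "nat \<times> nat \<Rightarrow> real"
  assumes a: "a < n" and l: "l < m" and i: "i < k" and j: "j < k"
  defines "xy \<equiv> \<lambda>y. x((a, l) := y)"
  shows "((\<lambda>y. R (xy y) i j) has_real_derivative
    - (r (xy y) a i * X (xy y) l j + X (xy y) l i * r (xy y) a j)) (at y)"
proof -
  let ?D = "\<lambda>p q. V a p * G (xy y) q l + G (xy y) p l * V a q"
  have "((\<lambda>z. - (\<Sum>p<k. \<Sum>q<k. R (xy z) i p * ((W (xy z) p q - W (xy y) p q) / (z - y)) * R (xy y) q j))
      \<longlongrightarrow> - (\<Sum>p<k. \<Sum>q<k. R (xy y) i p * ?D p q * R (xy y) q j)) (at y)"
    using W_deriv[OF a l, of x _ _ y] unfolding xy_def has_field_derivative_iff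
    by (intro tendsto_minus tendsto_sum tendsto_mult tendsto_const R_cont[OF a l i]) auto
  moreover have "- (\<Sum>p<k. \<Sum>q<k. R (xy z) i p * ((W (xy z) p q - W (xy y) p q) / (z - y)) * R (xy y) q j)
      = (R (xy z) i j - R (xy y) i j) / (z - y)" for z
    unfolding R_diff[OF i j] by (simp add: sum_divide_distrib)
  moreover have "(\<Sum>p<k. \<Sum>q<k. R (xy y) i p * ?D p q * R (xy y) q j)
      = r (xy y) a i * X (xy y) l j + X (xy y) l i * r (xy y) a j"
  proof -
    have "(\<Sum>p<k. \<Sum>q<k. R (xy y) i p * ?D p q * R (xy y) q j)
        = (\<Sum>p<k. \<Sum>q<k. (V a p * R (xy y) p i) * (G (xy y) q l * R (xy y) q j)
            + (G (xy y) p l * R (xy y) p i) * (V a q * R (xy y) q j))"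
      by (intro sum.cong refl) (use R_sym[OF i] in \<open>simp add: algebra_simps\<close>)
    thus ?thesis unfolding r_def X_def sum_product by (simp add: sum.distrib)
  qed
  ultimately show ?thesis unfolding has_field_derivative_iff by simp
qed

lemma sum_G_r: "(\<Sum>p<k. G x p l * r x a p) = Y x a l"
proof -
  have "(\<Sum>p<k. G x p l * r x a p) = (\<Sum>p<k. \<Sum>i<k. G x p l * (V a i * R x i p))"
    by (simp add: r_def sum_distrib_left)
  also have "\<dots> = (\<Sum>i<k. \<Sum>p<k. G x p l * (V a i * R x i p))" by (rule sum.swap)
  also have "\<dots> = (\<Sum>i<k. V a i * (\<Sum>p<k. G x p l * R x p i))"
    unfolding sum_distrib_left by (intro sum.cong refl) (use R_sym in \<open>simp add: mult_ac\<close>)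
  finally show ?thesis by (simp add: Y_def X_def)
qed

lemma X_deriv:
  fixes x :: "nat \<times> nat \<Rightarrow> real"
  assumes a: "a < n" and l: "l < m" and j: "j < k"
  defines "xy \<equiv> \<lambda>y. x((a, l) := y)"
  shows "((\<lambda>y. X (xy y) l' j) has_real_derivative DX (xy y) a l l' j) (at y)"
proof -
  let ?x = "xy y"
  have "((\<lambda>y. \<Sum>p<k. G (xy y) p l' * R (xy y) p j) has_real_derivative
      (\<Sum>p<k. (if l' = l then V a p else 0) * R ?x p j
        + - (r ?x a p * X ?x l j + X ?x l p * r ?x a j) * G ?x p l')) (at y)"
    unfolding xy_def by (intro DERIV_sum DERIV_mult G_deriv R_deriv a l j) auto
  also have "(\<Sum>p<k. (if l' = l then V a p else 0) * R ?x p j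
        + - (r ?x a p * X ?x l j + X ?x l p * r ?x a j) * G ?x p l')
      = (\<Sum>p<k. if l' = l then V a p * R ?x p j else 0)
        - (\<Sum>p<k. G ?x p l' * r ?x a p) * X ?x l j - (\<Sum>p<k. G ?x p l' * X ?x l p) * r ?x a j"
    unfolding sum_distrib_right sum_subtractf[symmetric]
    by (intro sum.cong) (auto simp: algebra_simps)
  also have "\<dots> = DX ?x a l l' j" by (simp add: DX_def r_def[of _ _ j] sum_G_r Q_def)
  finally show ?thesis by (simp add: X_def)
qed

lemma DX_isCont:
  assumes a: "a < n" and l: "l < m" and j: "j < k"
  shows "isCont (\<lambda>y. DX (x((a, l) := y)) a l l' j) y"
proof -
  have G: "isCont (\<lambda>y. G (x((a, l) := y)) i l'') y" for i l'' by (rule DERIV_isCont[OF G_deriv[OF a]])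
  have R: "isCont (\<lambda>y. R (x((a, l) := y)) i j') y" if "i < k" "j' < k" for i j'
    by (rule DERIV_isCont[OF R_deriv[OF a l that]])
  have X: "isCont (\<lambda>y. X (x((a, l) := y)) l'' j') y" if "j' < k" for l'' j'
    by (rule DERIV_isCont[OF X_deriv[OF a l that]])
  show ?thesis unfolding DX_def r_def Y_def Q_def
    by (cases "l' = l") (auto intro!: continuous_intros G R X j)
qed

lemma coord_meas: "a < n \<Longrightarrow> l < m \<Longrightarrow> (\<lambda>x. x (a, l)) \<in> borel_measurable P"
  using measurable_component_singleton[of "(a, l)" "{..<n} \<times> {..<m}" "\<lambda>_. std_gauss"]
  by (simp cong: measurable_cong_sets)

lemma G_meas: "l < m \<Longrightarrow> (\<lambda>x. G x i l) \<in> borel_measurable P"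
  unfolding G_def by (intro borel_measurable_sum borel_measurable_times borel_measurable_const coord_meas) auto

lemma R_meas:
  assumes "i < k" "j < k"
  shows "(\<lambda>x. R x i j) \<in> borel_measurable P"
proof -
  have "(\<lambda>x. W x a b) \<in> borel_measurable P" for a b
    unfolding W_def by (intro borel_measurable_sum borel_measurable_times G_meas) auto
  hence "(\<lambda>x. W\<epsilon> x $$ (a, b)) \<in> borel_measurable P" if "a < k" "b < k" for a b
    using that by (simp add: W\<epsilon>_def)
  thus ?thesis unfolding R_def
    by (intro borel_measurable_divide borel_measurable_det[OF W\<epsilon>_carrier] borel_measurable_adj_mat[OF W\<epsilon>_carrier] assms) auto
qed

lemma X_meas: "l < m \<Longrightarrow> i < k \<Longrightarrow> (\<lambda>x. X x l i) \<in> borel_measurable P"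
  unfolding X_def by (intro borel_measurable_sum borel_measurable_times G_meas R_meas) auto

lemma Y_meas: "l < m \<Longrightarrow> (\<lambda>x. Y x a l) \<in> borel_measurable P"
  unfolding Y_def by (intro borel_measurable_sum borel_measurable_times X_meas borel_measurable_const) auto

lemma DX_meas: "l < m \<Longrightarrow> l' < m \<Longrightarrow> j < k \<Longrightarrow> (\<lambda>x. DX x a l l' j) \<in> borel_measurable P"
  unfolding DX_def r_def Q_def
  by (cases "l' = l") (auto intro!: borel_measurable_diff borel_measurable_sum borel_measurable_times
      G_meas R_meas X_meas Y_meas borel_measurable_const)

lemma V_bound: "a < n \<Longrightarrow> i < n \<Longrightarrow> \<bar>V a i\<bar> \<le> 1"
proof -
  assume a: "a < n" and i: "i < n"
  have "(V a i)\<^sup>2 \<le> (\<Sum>a<n. (V a i)\<^sup>2)" using a by (intro member_le_sum) auto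
  also have "\<dots> = 1" using orth[OF i i] by (simp add: power2_eq_square)
  finally show ?thesis by (simp add: abs_square_le_1)
qed

lemma abs_sum_V_le:
  assumes "a < n" and "\<And>i. i < k \<Longrightarrow> \<bar>u i\<bar> \<le> c"
  shows "\<bar>\<Sum>i<k. V a i * u i\<bar> \<le> real k * c"
proof -
  have "\<bar>\<Sum>i<k. V a i * u i\<bar> \<le> (\<Sum>i<k. \<bar>V a i\<bar> * \<bar>u i\<bar>)"
    using sum_abs[of "\<lambda>i. V a i * u i" "{..<k}"] by (simp add: abs_mult)
  also have "\<dots> \<le> (\<Sum>i<k. 1 * c)"
    using assms k_le by (intro sum_mono mult_mono V_bound) auto
  finally show ?thesis by simp
qed

definition C :: real where "C = 3 * real k * B\<^sup>2"

lemma B_sq: "B \<le> B\<^sup>2" and C_nonneg: "0 \<le> C"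
  using B_ge_1 by (auto simp: C_def power2_eq_square)

lemma
  assumes a: "a < n"
  shows Y_bound: "l < m \<Longrightarrow> \<bar>Y x a l\<bar> \<le> C"
    and DX_bound: "l < m \<Longrightarrow> l' < m \<Longrightarrow> j < k \<Longrightarrow> \<bar>DX x a l l' j\<bar> \<le> C"
proof -
  have kB: "real k * B \<le> real k * B\<^sup>2" using B_sq by (intro mult_left_mono) auto
  have Y: "\<bar>Y x a l\<bar> \<le> real k * B" if "l < m" for l
    unfolding Y_def by (rule abs_sum_V_le[OF a X_bound[OF that]])
  thus "\<bar>Y x a l\<bar> \<le> C" if "l < m"
    using kB that C_nonneg order_trans[OF Y[OF that] kB] by (simp add: C_def)
  have r: "\<bar>r x a j\<bar> \<le> real k * B" if "j < k" for j
    unfolding r_def by (rule abs_sum_V_le[OF a R_bound'[OF _ that]])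
  assume l: "l < m" "l' < m" "j < k"
  have "\<bar>DX x a l l' j\<bar> \<le> \<bar>r x a j\<bar> + \<bar>Y x a l'\<bar> * \<bar>X x l j\<bar> + \<bar>Q x l' l\<bar> * \<bar>r x a j\<bar>"
    unfolding DX_def abs_mult[symmetric] by (auto split: if_splits)
  also have "\<dots> \<le> real k * B + real k * B * B + B * (real k * B)"
    using l B_pos by (intro add_mono mult_mono r Y X_bound Q_bound) auto
  also have "\<dots> \<le> C" using kB by (simp add: C_def power2_eq_square algebra_simps)
  finally show "\<bar>DX x a l l' j\<bar> \<le> C" .
qed

lemma finite_I: "finite ({..<n} \<times> {..<m})"
  by simp

lemma sum_V_V:
  assumes "i < n" "j < n"
  shows "(\<Sum>a<n. V a i * (V a j * c)) = (if i = j then c else 0)"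
  using orth[OF assms] by (simp add: sum_distrib_right[symmetric] mult.assoc[symmetric])

lemma sum_V_comb:
  assumes j: "j < n"
  shows "(\<Sum>a<n. V a j * (\<Sum>i<k. V a i * u i)) = (if j < k then u j else 0)"
proof -
  have "(\<Sum>a<n. V a j * (\<Sum>i<k. V a i * u i)) = (\<Sum>i<k. \<Sum>a<n. V a j * (V a i * u i))"
    unfolding sum_distrib_left by (rule sum.swap)
  also have "\<dots> = (\<Sum>i<k. if i = j then u j else 0)"
    using k_le j by (intro sum.cong refl) (auto simp: sum_V_V)
  finally show ?thesis by (simp add: sum.delta)
qed

lemma sum_V_r: "j < n \<Longrightarrow> (\<Sum>a<n. V a j * r x a i) = (if j < k then R x j i else 0)"
  unfolding r_def by (rule sum_V_comb)

lemma sum_V_Y: "j < n \<Longrightarrow> (\<Sum>a<n. V a j * Y x a l) = (if j < k then X x l j else 0)"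
  unfolding Y_def by (rule sum_V_comb)

lemma integrable_R_diag: "i < k \<Longrightarrow> integrable P (\<lambda>x. R x i i)"
proof -
  assume i: "i < k"
  interpret prob_space P by (rule prob_space_PiM_std_gauss)
  show ?thesis by (rule integrable_const_bound[of _ B]) (use i R_bound' R_meas in auto)
qed

text \<open>Stein's identity for the field \<open>V\<^sub>1 X\<^sup>T\<close>: its divergence is
  \<open>(m - tr Q) tr R - \<parallel>X\<parallel>\<^sup>2\<close>, which is at least \<open>(m - k - 1) tr R\<close>.\<close>

lemma expectation_trace_R:
  "(real m - real k - 1) * (\<integral>x. (\<Sum>i<k. R x i i) \<partial>P) \<le> real k"
proof -
  interpret prob_space P by (rule prob_space_PiM_std_gauss)
  define F' where "F' = (\<lambda>a l x. \<Sum>i<k. V a i * DX x a l l i)"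
  let ?K = "(1 + real k) * C"
  note stein = stein_PiM[OF finite_I, of _ _ _ ?K]
  have S: "integrable P (\<lambda>x. x (a, l) * Y x a l)" "integrable P (F' a l)"
    "(\<integral>x. x (a, l) * Y x a l \<partial>P) = (\<integral>x. F' a l x \<partial>P)" if a: "a < n" and l: "l < m" for a l
  proof -
    have c: "(a, l) \<in> {..<n} \<times> {..<m}" using a l by auto
    have meas: "(\<lambda>x. Y x a l) \<in> borel_measurable P" "F' a l \<in> borel_measurable P"
      unfolding F'_def using l by (auto intro!: borel_measurable_sum borel_measurable_times Y_meas DX_meas)
    have d: "((\<lambda>y. Y (x((a, l) := y)) a l) has_real_derivative F' a l (x((a, l) := y))) (at y)" for x y
      unfolding Y_def F'_def by (intro DERIV_sum DERIV_cmult X_deriv a l) auto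
    have cont: "isCont (\<lambda>y. F' a l (x((a, l) := y))) y" for x y
      unfolding F'_def by (intro continuous_intros DX_isCont a l) auto
    have T: "1 + (x (a, l))\<^sup>2 \<le> 1 + (\<Sum>i\<in>{..<n} \<times> {..<m}. (x i)\<^sup>2)" for x :: "nat \<times> nat \<Rightarrow> real"
      using member_le_sum[OF c, of "\<lambda>i. (x i)\<^sup>2"] by simp
    have T1: "1 \<le> 1 + (\<Sum>i\<in>{..<n} \<times> {..<m}. (x i)\<^sup>2)" for x :: "nat \<times> nat \<Rightarrow> real"
      by (simp add: sum_nonneg)
    have CK: "C \<le> ?K" "real k * C \<le> ?K" "0 \<le> ?K" using C_nonneg by (auto simp: algebra_simps)
    have KT: "c \<le> ?K * (1 + (\<Sum>i\<in>{..<n} \<times> {..<m}. (x i)\<^sup>2))" if "c \<le> ?K" for c and x :: "nat \<times> nat \<Rightarrow> real"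
      by (rule order_trans[OF that]) (use mult_left_mono[OF T1 CK(3)] in simp)
    have b1: "\<bar>Y x a l\<bar> \<le> ?K * (1 + (\<Sum>i\<in>{..<n} \<times> {..<m}. (x i)\<^sup>2))" for x
      by (rule KT[OF order_trans[OF Y_bound[OF a l] CK(1)]])
    have b3: "\<bar>F' a l x\<bar> \<le> ?K * (1 + (\<Sum>i\<in>{..<n} \<times> {..<m}. (x i)\<^sup>2))" for x
      unfolding F'_def by (rule KT[OF order_trans[OF abs_sum_V_le[OF a DX_bound[OF a l l]] CK(2)]])
    have b2: "\<bar>x (a, l) * Y x a l\<bar> \<le> ?K * (1 + (\<Sum>i\<in>{..<n} \<times> {..<m}. (x i)\<^sup>2))" for x
    proof -
      have "\<bar>x (a, l)\<bar> \<le> 1 + (x (a, l))\<^sup>2"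
        using sum_squares_bound[of "\<bar>x (a, l)\<bar>" 1] by simp
      hence "\<bar>x (a, l) * Y x a l\<bar> \<le> (1 + (x (a, l))\<^sup>2) * ?K"
        unfolding abs_mult using Y_bound[OF a l, of x] CK by (intro mult_mono) auto
      also have "\<dots> \<le> (1 + (\<Sum>i\<in>{..<n} \<times> {..<m}. (x i)\<^sup>2)) * ?K" by (rule mult_right_mono[OF T CK(3)])
      finally show ?thesis by (simp add: mult.commute)
    qed
    show "integrable P (\<lambda>x. x (a, l) * Y x a l)" "integrable P (F' a l)"
      "(\<integral>x. x (a, l) * Y x a l \<partial>P) = (\<integral>x. F' a l x \<partial>P)"
      using stein[OF c meas d cont b1 b2 b3] by blast+
  qed
  let ?t = "\<lambda>x. \<Sum>i<k. R x i i"
  have lhs: "(\<Sum>a<n. \<Sum>l<m. x (a, l) * Y x a l) = real k - \<epsilon> * ?t x" for x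
  proof -
    have "(\<Sum>a<n. \<Sum>l<m. x (a, l) * Y x a l) = (\<Sum>a<n. \<Sum>l<m. \<Sum>i<k. V a i * x (a, l) * X x l i)"
      by (simp add: Y_def sum_distrib_left mult_ac)
    also have "\<dots> = (\<Sum>l<m. \<Sum>a<n. \<Sum>i<k. V a i * x (a, l) * X x l i)" by (rule sum.swap)
    also have "\<dots> = (\<Sum>l<m. \<Sum>i<k. \<Sum>a<n. V a i * x (a, l) * X x l i)" by (intro sum.cong refl sum.swap)
    also have "\<dots> = (\<Sum>l<m. Q x l l)" by (simp add: Q_def G_def sum_distrib_right)
    finally show ?thesis by (simp add: trace_Q)
  qed
  have rhs: "(real m - real k - 1) * ?t x \<le> (\<Sum>a<n. \<Sum>l<m. F' a l x)" for x
  proof -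
    have "(\<Sum>a<n. \<Sum>l<m. F' a l x)
        = (\<Sum>a<n. \<Sum>l<m. (1 - Q x l l) * (\<Sum>i<k. V a i * r x a i) - Y x a l * Y x a l)"
      by (intro sum.cong refl)
        (simp add: F'_def DX_def Y_def[of x] sum_distrib_left sum_distrib_right flip: sum_subtractf,
          simp add: algebra_simps sum_subtractf sum.distrib sum_distrib_left)
    also have "\<dots> = (\<Sum>l<m. \<Sum>a<n. (1 - Q x l l) * (\<Sum>i<k. V a i * r x a i) - Y x a l * Y x a l)"
      by (rule sum.swap)
    also have "\<dots> = (\<Sum>l<m. (1 - Q x l l) * ?t x - (\<Sum>i<k. (X x l i)\<^sup>2))"
    proof (intro sum.cong refl)
      fix l
      have "(\<Sum>a<n. \<Sum>i<k. V a i * r x a i) = ?t x"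
        by (subst sum.swap) (use k_le in \<open>simp add: sum_V_r\<close>)
      moreover have "(\<Sum>a<n. Y x a l * Y x a l) = (\<Sum>i<k. (X x l i)\<^sup>2)"
      proof -
        have "(\<Sum>a<n. Y x a l * Y x a l) = (\<Sum>a<n. \<Sum>i<k. X x l i * (V a i * Y x a l))"
          by (intro sum.cong refl, subst (1) Y_def) (simp add: sum_distrib_left mult_ac)
        also have "\<dots> = (\<Sum>i<k. \<Sum>a<n. X x l i * (V a i * Y x a l))" by (rule sum.swap)
        finally show ?thesis using k_le by (simp add: sum_distrib_left[symmetric] sum_V_Y power2_eq_square)
      qed
      ultimately show "(\<Sum>a<n. (1 - Q x l l) * (\<Sum>i<k. V a i * r x a i) - Y x a l * Y x a l)
          = (1 - Q x l l) * ?t x - (\<Sum>i<k. (X x l i)\<^sup>2)"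
        by (simp add: sum_subtractf sum_distrib_left[symmetric])
    qed
    also have "\<dots> = (real m - (\<Sum>l<m. Q x l l)) * ?t x - (\<Sum>l<m. \<Sum>i<k. (X x l i)\<^sup>2)"
      by (simp add: sum_subtractf sum_distrib_right[symmetric])
    also have "(\<Sum>l<m. \<Sum>i<k. (X x l i)\<^sup>2) = (\<Sum>i<k. \<Sum>l<m. (X x l i)\<^sup>2)" by (rule sum.swap)
    finally have eq: "(\<Sum>a<n. \<Sum>l<m. F' a l x)
        = (real m - (\<Sum>l<m. Q x l l)) * ?t x - (\<Sum>i<k. \<Sum>l<m. (X x l i)\<^sup>2)" .
    have t0: "0 \<le> ?t x" by (intro sum_nonneg R_diag_nonneg) auto
    have "(\<Sum>i<k. \<Sum>l<m. (X x l i)\<^sup>2) \<le> ?t x" by (intro sum_mono X_sq_le) auto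
    moreover have "(real m - real k) * ?t x \<le> (real m - (\<Sum>l<m. Q x l l)) * ?t x"
      using t0 eps by (intro mult_right_mono) (auto simp: trace_Q)
    ultimately show ?thesis unfolding eq by (simp add: algebra_simps)
  qed
  have it: "integrable P ?t" by (intro Bochner_Integration.integrable_sum integrable_R_diag) auto
  have "(real m - real k - 1) * (\<integral>x. ?t x \<partial>P) = (\<integral>x. (real m - real k - 1) * ?t x \<partial>P)" by simp
  also have "\<dots> \<le> (\<integral>x. (\<Sum>a<n. \<Sum>l<m. F' a l x) \<partial>P)"
    by (intro integral_mono Bochner_Integration.integrable_sum S integrable_mult_right it rhs) auto
  also have "\<dots> = (\<Sum>a<n. \<Sum>l<m. \<integral>x. x (a, l) * Y x a l \<partial>P)"
    by (subst integral_double_sum[where f = F', OF S(2)]) (auto intro!: sum.cong simp: S(3))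
  also have "\<dots> = (\<integral>x. (\<Sum>a<n. \<Sum>l<m. x (a, l) * Y x a l) \<partial>P)"
    by (rule integral_double_sum[OF S(1), symmetric])
  also have "\<dots> \<le> (\<integral>x. real k \<partial>P)"
    unfolding lhs using eps
    by (intro integral_mono Bochner_Integration.integrable_diff integrable_mult_right it)
      (auto intro!: mult_nonneg_nonneg sum_nonneg R_diag_nonneg)
  also have "\<dots> = real k" by (simp add: prob_space)
  finally show ?thesis .
qed

definition N :: "(nat \<times> nat \<Rightarrow> real) \<Rightarrow> nat \<Rightarrow> nat \<Rightarrow> real" where
  "N x s i = (\<Sum>l<m. G x s l * X x l i)"

lemma abs_sum_G_le:
  assumes s: "s < n" and u: "\<And>l. l < m \<Longrightarrow> \<bar>u l\<bar> \<le> c" and c: "0 \<le> c"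
  shows "\<bar>\<Sum>l<m. G x s l * u l\<bar> \<le> c * (\<Sum>z\<in>{..<n} \<times> {..<m}. \<bar>x z\<bar>)"
proof -
  have G: "\<bar>G x s l\<bar> \<le> (\<Sum>a<n. \<bar>x (a, l)\<bar>)" for l
  proof -
    have "\<bar>G x s l\<bar> \<le> (\<Sum>a<n. \<bar>V a s\<bar> * \<bar>x (a, l)\<bar>)"
      unfolding G_def using sum_abs[of "\<lambda>a. V a s * x (a, l)" "{..<n}"] by (simp add: abs_mult)
    also have "\<dots> \<le> (\<Sum>a<n. 1 * \<bar>x (a, l)\<bar>)"
      using s by (intro sum_mono mult_right_mono V_bound) auto
    finally show ?thesis by simp
  qed
  have "\<bar>\<Sum>l<m. G x s l * u l\<bar> \<le> (\<Sum>l<m. \<bar>G x s l\<bar> * \<bar>u l\<bar>)"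
    using sum_abs[of "\<lambda>l. G x s l * u l" "{..<m}"] by (simp add: abs_mult)
  also have "\<dots> \<le> (\<Sum>l<m. (\<Sum>a<n. \<bar>x (a, l)\<bar>) * c)"
    using G u c by (intro sum_mono mult_mono) (auto intro!: sum_nonneg)
  also have "\<dots> = c * (\<Sum>l<m. \<Sum>a<n. \<bar>x (a, l)\<bar>)" by (simp only: sum_distrib_left mult.commute)
  also have "(\<Sum>l<m. \<Sum>a<n. \<bar>x (a, l)\<bar>) = (\<Sum>z\<in>{..<n} \<times> {..<m}. \<bar>x z\<bar>)"
    by (subst sum.swap) (simp add: sum.cartesian_product)
  finally show ?thesis .
qed

text \<open>Stein's identity for the field \<open>v\<^sub>s (N X\<^sub>i)\<^sup>T\<close>: since \<open>v\<^sub>s\<close> is orthogonal to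
  \<open>v\<^sub>1, \<dots>, v\<^sub>k\<close>, only the explicit dependence of \<open>N\<close> on row \<open>s\<close> of \<open>G\<close> contributes
  to the divergence.\<close>

lemma
  assumes s: "k \<le> s" "s < n" and i: "i < k"
  shows integrable_N_sq: "integrable P (\<lambda>x. (N x s i)\<^sup>2)"
    and expectation_N_sq: "(\<integral>x. (N x s i)\<^sup>2 \<partial>P) \<le> (\<integral>x. R x i i \<partial>P)"
proof -
  interpret prob_space P by (rule prob_space_PiM_std_gauss)
  define DN where "DN = (\<lambda>a l x. V a s * X x l i + (\<Sum>l'<m. G x s l' * DX x a l l' i))"
  define F where "F = (\<lambda>a l x. V a s * (N x s i * X x l i))"
  define F' where "F' = (\<lambda>a l x. V a s * (DN a l x * X x l i + N x s i * DX x a l l i))"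
  let ?I = "{..<n} \<times> {..<m}"
  let ?S1 = "\<lambda>x::nat \<times> nat \<Rightarrow> real. \<Sum>z\<in>?I. \<bar>x z\<bar>"
  let ?T = "\<lambda>x::nat \<times> nat \<Rightarrow> real. 1 + (\<Sum>z\<in>?I. (x z)\<^sup>2)"
  let ?K = "(B * B + 2 * (B * C)) * (real (card ?I) + 1)"
  have N_meas: "(\<lambda>x. N x s i) \<in> borel_measurable P"
    unfolding N_def using i by (auto intro!: borel_measurable_sum borel_measurable_times G_meas X_meas)
  have S: "integrable P (\<lambda>x. x (a, l) * F a l x)" "integrable P (F' a l)"
    "(\<integral>x. x (a, l) * F a l x \<partial>P) = (\<integral>x. F' a l x \<partial>P)" if a: "a < n" and l: "l < m" for a l
  proof -
    have c: "(a, l) \<in> ?I" using a l by auto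
    have meas: "F a l \<in> borel_measurable P" "F' a l \<in> borel_measurable P"
      unfolding F_def F'_def DN_def using l i N_meas
      by (auto intro!: borel_measurable_sum borel_measurable_times borel_measurable_add G_meas X_meas DX_meas)
    have dN: "((\<lambda>y. N (x((a, l) := y)) s i) has_real_derivative DN a l (x((a, l) := y))) (at y)" for x y
    proof -
      let ?x = "x((a, l) := y)"
      have 1: "((\<lambda>y. \<Sum>l'<m. G (x((a, l) := y)) s l' * X (x((a, l) := y)) l' i) has_real_derivative
        (\<Sum>l'<m. (if l' = l then V a s else 0) * X ?x l' i + DX ?x a l l' i * G ?x s l')) (at y)"
        by (intro DERIV_sum DERIV_mult G_deriv X_deriv a l i)
      have "(\<Sum>l'<m. (if l' = l then V a s else 0) * X ?x l' i + DX ?x a l l' i * G ?x s l')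
          = (\<Sum>l'<m. if l' = l then V a s * X ?x l i else 0) + (\<Sum>l'<m. G ?x s l' * DX ?x a l l' i)"
        unfolding sum.distrib[symmetric] by (intro sum.cong) auto
      also have "\<dots> = DN a l ?x" unfolding DN_def using l by (simp only: sum.delta finite_lessThan) simp
      finally have 2: "(\<Sum>l'<m. (if l' = l then V a s else 0) * X ?x l' i + DX ?x a l l' i * G ?x s l') = DN a l ?x" .
      show ?thesis using 1 unfolding N_def 2 .
    qed
    have d: "((\<lambda>y. F a l (x((a, l) := y))) has_real_derivative F' a l (x((a, l) := y))) (at y)" for x y
      unfolding F_def F'_def
      by (intro DERIV_cmult DERIV_cong[OF DERIV_mult[OF dN X_deriv[OF a l i]]]) (simp add: mult.commute)
    have cont: "isCont (\<lambda>y. F' a l (x((a, l) := y))) y" for x y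
      unfolding F'_def DN_def
      by (intro continuous_intros DX_isCont DERIV_isCont[OF X_deriv] DERIV_isCont[OF dN] DERIV_isCont[OF G_deriv] a l i)
    have BC: "0 \<le> B" "0 \<le> C" "0 \<le> B * B" "0 \<le> B * C" using B_pos C_nonneg by auto
    have S1_nonneg: "0 \<le> ?S1 x" for x by (intro sum_nonneg) auto
    have S1: "?S1 x \<le> (real (card ?I) + 1) * ?T x" for x
    proof -
      have le1: "\<bar>y\<bar> \<le> 1 + y\<^sup>2" for y :: real
        using sum_squares_bound[of "\<bar>y\<bar>" 1] by simp
      have "?S1 x \<le> (\<Sum>z\<in>?I. 1 + (x z)\<^sup>2)" by (intro sum_mono le1)
      also have "\<dots> = real (card ?I) + (\<Sum>z\<in>?I. (x z)\<^sup>2)" by (simp add: sum.distrib)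
      also have "\<dots> \<le> (real (card ?I) + 1) * ?T x"
        by (simp add: algebra_simps sum_nonneg)
      finally show ?thesis .
    qed
    have T1: "1 \<le> ?T x" for x by (simp add: sum_nonneg)
    have cT: "1 \<le> (real (card ?I) + 1) * ?T x" for x
      using mult_mono[of 1 "real (card ?I) + 1" 1 "?T x"] T1[of x] by simp
    have N: "\<bar>N x s i\<bar> \<le> B * ?S1 x" for x
      unfolding N_def by (rule abs_sum_G_le[OF s(2) X_bound[OF _ i] BC(1)])
    have Va: "\<bar>V a s\<bar> \<le> 1" by (rule V_bound[OF a s(2)])
    have F: "\<bar>F a l x\<bar> \<le> B * B * ?S1 x" for x
    proof -
      have "\<bar>F a l x\<bar> \<le> 1 * (B * ?S1 x * B)"
        unfolding F_def abs_mult using Va N X_bound[OF l i] BC S1_nonneg[of x]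
        by (intro mult_mono mult_nonneg_nonneg) auto
      thus ?thesis by (simp add: mult_ac)
    qed
    have b1: "\<bar>F a l x\<bar> \<le> ?K * ?T x" for x
    proof -
      have "\<bar>F a l x\<bar> \<le> B * B * ((real (card ?I) + 1) * ?T x)"
        by (rule order_trans[OF F]) (intro mult_left_mono S1 BC)
      also have "\<dots> \<le> (B * B + 2 * (B * C)) * ((real (card ?I) + 1) * ?T x)"
        using cT[of x] BC by (intro mult_right_mono) auto
      finally show ?thesis by (simp only: mult.assoc)
    qed
    have b2: "\<bar>x (a, l) * F a l x\<bar> \<le> ?K * ?T x" for x
    proof -
      have "\<bar>x (a, l)\<bar> \<le> ?S1 x" using c by (intro member_le_sum) auto
      hence "\<bar>x (a, l) * F a l x\<bar> \<le> ?S1 x * (B * B * ?S1 x)"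
        unfolding abs_mult using F[of x] S1_nonneg[of x] by (intro mult_mono) auto
      also have "\<dots> = B * B * (?S1 x)\<^sup>2" by (simp add: power2_eq_square mult_ac)
      also have "(?S1 x)\<^sup>2 \<le> real (card ?I) * (\<Sum>z\<in>?I. (x z)\<^sup>2)"
        using sum_squared_le_sum_of_squares[of "\<lambda>z. \<bar>x z\<bar>" ?I] by (simp add: mult.commute)
      also have "\<dots> \<le> (real (card ?I) + 1) * ?T x" by (intro mult_mono) (auto intro: sum_nonneg)
      finally have "\<bar>x (a, l) * F a l x\<bar> \<le> B * B * ((real (card ?I) + 1) * ?T x)"
        using BC by (simp add: mult_left_mono)
      also have "\<dots> \<le> (B * B + 2 * (B * C)) * ((real (card ?I) + 1) * ?T x)"
        using cT[of x] BC by (intro mult_right_mono) auto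
      finally show ?thesis by (simp only: mult.assoc)
    qed
    have b3: "\<bar>F' a l x\<bar> \<le> ?K * ?T x" for x
    proof -
      have VX: "\<bar>V a s * X x l i\<bar> \<le> 1 * B"
        unfolding abs_mult using Va X_bound[OF l i] by (intro mult_mono) auto
      have "\<bar>\<Sum>l'<m. G x s l' * DX x a l l' i\<bar> \<le> C * ?S1 x"
        by (rule abs_sum_G_le[OF s(2) DX_bound[OF a l _ i] BC(2)])
      hence DN: "\<bar>DN a l x\<bar> \<le> B + C * ?S1 x" unfolding DN_def using VX by linarith
      have "\<bar>DN a l x * X x l i\<bar> \<le> (B + C * ?S1 x) * B" "\<bar>N x s i * DX x a l l i\<bar> \<le> B * ?S1 x * C"
        unfolding abs_mult using DN N[of x] X_bound[OF l i, of x] DX_bound[OF a l l i, of x] BC S1_nonneg[of x]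
        by (intro mult_mono; simp)+
      hence "\<bar>DN a l x * X x l i + N x s i * DX x a l l i\<bar> \<le> B * B + 2 * (B * C) * ?S1 x"
        by (simp add: algebra_simps)
      hence "\<bar>F' a l x\<bar> \<le> 1 * (B * B + 2 * (B * C) * ?S1 x)"
        unfolding F'_def abs_mult[of "V a s"] using Va by (intro mult_mono) auto
      also have "\<dots> \<le> B * B * ((real (card ?I) + 1) * ?T x) + 2 * (B * C) * ((real (card ?I) + 1) * ?T x)"
        using mult_left_mono[OF cT[of x] BC(3)] mult_left_mono[OF S1[of x], of "2 * (B * C)"] BC by simp
      finally show ?thesis by (simp only: mult.assoc distrib_right)
    qed
    show "integrable P (\<lambda>x. x (a, l) * F a l x)" "integrable P (F' a l)"
      "(\<integral>x. x (a, l) * F a l x \<partial>P) = (\<integral>x. F' a l x \<partial>P)"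
      using stein_PiM[OF finite_I c meas d cont b1 b2 b3] by blast+
  qed
  have lhs: "(\<Sum>a<n. \<Sum>l<m. x (a, l) * F a l x) = (N x s i)\<^sup>2" for x
  proof -
    have "(\<Sum>a<n. \<Sum>l<m. x (a, l) * F a l x) = (\<Sum>l<m. \<Sum>a<n. x (a, l) * F a l x)" by (rule sum.swap)
    also have "\<dots> = (\<Sum>l<m. N x s i * (G x s l * X x l i))"
      by (simp add: F_def G_def sum_distrib_left sum_distrib_right mult_ac)
    finally show ?thesis by (simp add: N_def power2_eq_square sum_distrib_left)
  qed
  have VDX: "(\<Sum>a<n. V a s * DX x a l l' i) = 0" for x l l'
  proof -
    have "(\<Sum>a<n. V a s * DX x a l l' i)
        = (if l' = l then 1 else 0) * (\<Sum>a<n. V a s * r x a i) - (\<Sum>a<n. V a s * Y x a l') * X x l i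
          - Q x l' l * (\<Sum>a<n. V a s * r x a i)"
      unfolding sum_distrib_left sum_distrib_right sum_subtractf[symmetric] DX_def
      by (intro sum.cong) (auto simp: algebra_simps)
    thus ?thesis using s by (simp add: sum_V_r sum_V_Y)
  qed
  have rhs: "(\<Sum>a<n. \<Sum>l<m. F' a l x) = (\<Sum>l<m. (X x l i)\<^sup>2)" for x
  proof -
    have "(\<Sum>a<n. \<Sum>l<m. F' a l x) = (\<Sum>l<m. \<Sum>a<n. F' a l x)" by (rule sum.swap)
    also have "\<dots> = (\<Sum>l<m. (\<Sum>a<n. V a s * V a s) * (X x l i)\<^sup>2
        + (\<Sum>l'<m. G x s l' * (\<Sum>a<n. V a s * DX x a l l' i)) * X x l i + N x s i * (\<Sum>a<n. V a s * DX x a l l i))"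
    proof (intro sum.cong refl)
      fix l
      have "(\<Sum>l'<m. G x s l' * (\<Sum>a<n. V a s * DX x a l l' i)) = (\<Sum>a<n. V a s * (\<Sum>l'<m. G x s l' * DX x a l l' i))"
        unfolding sum_distrib_left by (subst sum.swap) (simp add: mult_ac)
      thus "(\<Sum>a<n. F' a l x) = (\<Sum>a<n. V a s * V a s) * (X x l i)\<^sup>2
        + (\<Sum>l'<m. G x s l' * (\<Sum>a<n. V a s * DX x a l l' i)) * X x l i + N x s i * (\<Sum>a<n. V a s * DX x a l l i)"
        by (simp only: sum_distrib_right) (simp add: sum_distrib_left[of "N x s i"] F'_def DN_def
            algebra_simps power2_eq_square sum.distrib)
    qed
    also have "\<dots> = (\<Sum>l<m. (X x l i)\<^sup>2)" using orth[OF s(2) s(2)] by (simp add: VDX)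
    finally show ?thesis .
  qed
  show "integrable P (\<lambda>x. (N x s i)\<^sup>2)"
    unfolding lhs[symmetric] by (intro Bochner_Integration.integrable_sum S) auto
  have "(\<integral>x. (N x s i)\<^sup>2 \<partial>P) = (\<Sum>a<n. \<Sum>l<m. \<integral>x. x (a, l) * F a l x \<partial>P)"
    unfolding lhs[symmetric] by (rule integral_double_sum[OF S(1)])
  also have "\<dots> = (\<integral>x. (\<Sum>a<n. \<Sum>l<m. F' a l x) \<partial>P)"
    by (subst integral_double_sum[where f = F', OF S(2)]) (auto intro!: sum.cong simp: S(3))
  also have "\<dots> \<le> (\<integral>x. R x i i \<partial>P)"
  proof (rule integral_mono)
    show "integrable P (\<lambda>x. \<Sum>a<n. \<Sum>l<m. F' a l x)" by (intro Bochner_Integration.integrable_sum S) auto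
  qed (use X_sq_le[OF i] integrable_R_diag[OF i] in \<open>auto simp: rhs\<close>)
  finally show "(\<integral>x. (N x s i)\<^sup>2 \<partial>P) \<le> (\<integral>x. R x i i \<partial>P)" .
qed

end

section \<open>The error bound\<close>

context op_mono
begin

lemma frobenius_nystrom_sketch_le:
  fixes V Om :: "real mat" and lam :: "nat \<Rightarrow> real" and x :: "nat \<times> nat \<Rightarrow> real"
  assumes V: "orth_mat n V" and A: "A = V * mat_diag n lam * transpose_mat V"
    and lam: "\<And>i. i < n \<Longrightarrow> 0 \<le> lam i" and mono: "\<And>i j. i \<le> j \<Longrightarrow> j < n \<Longrightarrow> lam j \<le> lam i"
    and q: "2 \<le> q" and Om: "Om \<in> carrier_mat n m" and k: "0 < k" "k < n"
    and t: "0 < lam (k - 1)" and g: "g = f (lam (k - 1)) / lam (k - 1)"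
    and sk: "regularized_sketch (\<lambda>a i. V $$ (a, i)) n k \<epsilon>"
    and x: "\<And>a l. a < n \<Longrightarrow> l < m \<Longrightarrow> x (a, l) = Om $$ (a, l)"
  defines "R \<equiv> regularized_sketch.R (\<lambda>a i. V $$ (a, i)) n m k \<epsilon>"
    and "N \<equiv> regularized_sketch.N (\<lambda>a i. V $$ (a, i)) n m k \<epsilon>"
  shows "(frobenius_norm (mat_fun f A - mat_fun f (nystrom A q Om)))\<^sup>2
    \<le> (\<Sum>i=k..<n. (f (lam i))\<^sup>2) + 2 * g\<^sup>2 *
      ((\<Sum>i<k. \<Sum>s<k. (lam i)\<^sup>2 * (lam s / lam i) ^ (2 * q - 1)) * \<epsilon> * (\<Sum>i<k. R x i i)
        + (lam k / lam (k - 1)) ^ (2 * q - 3) * (\<Sum>s=k..<n. (lam s)\<^sup>2 * (\<Sum>i<k. (N x s i)\<^sup>2)))"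
proof -
  interpret sk: regularized_sketch "\<lambda>a i. V $$ (a, i)" n m k \<epsilon> by (rule sk)
  have q1: "1 \<le> q" using q by simp
  define w where "w = 2 * q - 1"
  define K where "K = (\<Sum>i<k. \<Sum>s<k. (lam i)\<^sup>2 * (lam s / lam i) ^ w)"
  define \<gamma> where "\<gamma> = lam k / lam (k - 1)"
  have hi: "lam (k - 1) \<le> lam i" if "i < k" for i using mono[of i "k - 1"] that k by simp
  have lo: "lam i \<le> lam (k - 1)" if "k \<le> i" "i < n" for i using mono[of "k - 1" i] that by simp
  have pos: "0 < lam i" if "i < k" for i using hi[OF that] t by linarith
  define c where "c = (\<lambda>i l. sk.X x l i / sqrt (lam i) ^ w)"
  define z where "z = (\<lambda>i s. (if s = i then 1 else 0) -
    sqrt (lam s) ^ w * (\<Sum>l<m. (\<Sum>a<n. V $$ (a, s) * Om $$ (a, l)) * c i l))"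
  have main: "(frobenius_norm (mat_fun f A - mat_fun f (nystrom A q Om)))\<^sup>2
    \<le> (\<Sum>i=k..<n. (f (lam i))\<^sup>2) + 2 * g\<^sup>2 * (\<Sum>i<k. (lam i)\<^sup>2 * (\<Sum>s<n. (z i s)\<^sup>2))"
    unfolding z_def w_def
    by (rule frobenius_nystrom_le[OF V A lam q1 Om less_imp_le[OF k(2)] t g hi lo])
  have sumG: "(\<Sum>a<n. V $$ (a, s) * Om $$ (a, l)) = sk.G x s l" if "l < m" for s l
    unfolding sk.G_def
  proof (rule sum.cong[OF refl])
    fix a assume "a \<in> {..<n}"
    hence "x (a, l) = Om $$ (a, l)" using that by (intro x) auto
    thus "V $$ (a, s) * Om $$ (a, l) = V $$ (a, s) * x (a, l)" by (rule arg_cong[OF sym])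
  qed
  have sumN: "(\<Sum>l<m. (\<Sum>a<n. V $$ (a, s) * Om $$ (a, l)) * c i l) = N x s i / sqrt (lam i) ^ w" for i s
  proof -
    have "(\<Sum>l<m. (\<Sum>a<n. V $$ (a, s) * Om $$ (a, l)) * c i l) = (\<Sum>l<m. sk.G x s l * sk.X x l i / sqrt (lam i) ^ w)"
    proof (rule sum.cong[OF refl])
      fix l assume "l \<in> {..<m}"
      hence "(\<Sum>a<n. V $$ (a, s) * Om $$ (a, l)) = sk.G x s l" by (intro sumG) auto
      thus "(\<Sum>a<n. V $$ (a, s) * Om $$ (a, l)) * c i l = sk.G x s l * sk.X x l i / sqrt (lam i) ^ w"
        unfolding c_def by (simp only: times_divide_eq_right)
    qed
    thus ?thesis unfolding N_def sk.N_def sum_divide_distrib .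
  qed
  define \<rho> where "\<rho> = (\<lambda>i s. sqrt (lam s) ^ w / sqrt (lam i) ^ w)"
  have z\<rho>: "z i s = (if s = i then 1 else 0) - \<rho> i s * N x s i" for i s
    unfolding z_def sumN \<rho>_def by simp
  have sq: "(\<rho> i s)\<^sup>2 = (lam s / lam i) ^ w" if "i < k" "s < n" for i s
  proof -
    have *: "(sqrt y ^ w)\<^sup>2 = y ^ w" if "0 \<le> y" for y
    proof -
      have "(sqrt y ^ w)\<^sup>2 = ((sqrt y)\<^sup>2) ^ w" by (simp only: power_mult[symmetric] mult.commute)
      thus ?thesis using that by simp
    qed
    show ?thesis unfolding \<rho>_def power_divide
      using *[OF lam[OF that(2)]] *[OF less_imp_le[OF pos[OF that(1)]]] by simp
  qed
  have nn: "0 \<le> (lam i)\<^sup>2 * (lam s / lam i) ^ w" if "i < k" "s < k" for i s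
    using pos[OF that(1)] pos[OF that(2)] by simp
  have small: "(lam i)\<^sup>2 * (z i s)\<^sup>2 \<le> K * \<epsilon>\<^sup>2 * (R x i s)\<^sup>2" if i: "i < k" and s: "s < k" for i s
  proof -
    have "N x s i = (if s = i then 1 else 0) - \<epsilon> * R x s i"
      unfolding N_def R_def sk.N_def by (rule sk.G_X[OF s i])
    moreover have "\<rho> i i = 1" using pos[OF i] by (simp add: \<rho>_def)
    ultimately have "z i s = \<epsilon> * \<rho> i s * R x s i"
      unfolding z\<rho> by (cases "s = i") (simp_all add: algebra_simps)
    hence "(z i s)\<^sup>2 = \<epsilon>\<^sup>2 * (lam s / lam i) ^ w * (R x i s)\<^sup>2"
      using sq[OF i] s k sk.R_sym[OF i s, of x] by (simp add: power_mult_distrib R_def)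
    hence "(lam i)\<^sup>2 * (z i s)\<^sup>2 = ((lam i)\<^sup>2 * (lam s / lam i) ^ w) * (\<epsilon>\<^sup>2 * (R x i s)\<^sup>2)" by simp
    also have "\<dots> \<le> K * (\<epsilon>\<^sup>2 * (R x i s)\<^sup>2)"
    proof (rule mult_right_mono)
      have "(lam i)\<^sup>2 * (lam s / lam i) ^ w \<le> (\<Sum>s<k. (lam i)\<^sup>2 * (lam s / lam i) ^ w)"
        by (rule member_le_sum[of s "{..<k}" "\<lambda>s. (lam i)\<^sup>2 * (lam s / lam i) ^ w"]) (use s nn[OF i] in auto)
      also have "\<dots> \<le> K" unfolding K_def
        by (rule member_le_sum[of i "{..<k}" "\<lambda>i. \<Sum>s<k. (lam i)\<^sup>2 * (lam s / lam i) ^ w"])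
          (use i nn in \<open>auto intro!: sum_nonneg\<close>)
      finally show "(lam i)\<^sup>2 * (lam s / lam i) ^ w \<le> K" .
    qed simp
    finally show ?thesis by (simp add: mult.assoc)
  qed
  have large: "(lam i)\<^sup>2 * (z i s)\<^sup>2 \<le> \<gamma> ^ (2 * q - 3) * ((lam s)\<^sup>2 * (N x s i)\<^sup>2)"
    if i: "i < k" and s: "k \<le> s" "s < n" for i s
  proof -
    have "z i s = - (\<rho> i s * N x s i)"
      unfolding z\<rho> using i s by simp
    hence "(z i s)\<^sup>2 = (lam s / lam i) ^ w * (N x s i)\<^sup>2"
      using sq[OF i s(2)] by (simp add: power_mult_distrib)
    also have "w = 2 + (2 * q - 3)" using q by (simp add: w_def)
    finally have "(lam i)\<^sup>2 * (z i s)\<^sup>2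
        = ((lam i)\<^sup>2 * (lam s / lam i)\<^sup>2) * ((lam s / lam i) ^ (2 * q - 3) * (N x s i)\<^sup>2)"
      by (simp only: power_add mult.assoc)
    also have "(lam i)\<^sup>2 * (lam s / lam i)\<^sup>2 = (lam s)\<^sup>2"
      using pos[OF i] by (simp flip: power_mult_distrib)
    also have "(lam s)\<^sup>2 * ((lam s / lam i) ^ (2 * q - 3) * (N x s i)\<^sup>2)
        = (lam s / lam i) ^ (2 * q - 3) * ((lam s)\<^sup>2 * (N x s i)\<^sup>2)" by simp
    also have "\<dots> \<le> \<gamma> ^ (2 * q - 3) * ((lam s)\<^sup>2 * (N x s i)\<^sup>2)"
    proof (intro mult_right_mono power_mono)
      show "lam s / lam i \<le> \<gamma>" unfolding \<gamma>_def
        by (rule frac_le[OF lam[OF k(2)] mono[OF s] t hi[OF i]])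
      show "0 \<le> lam s / lam i" using pos[OF i] lam[OF s(2)] by simp
    qed simp
    finally show ?thesis .
  qed
  have K0: "0 \<le> K" unfolding K_def by (intro sum_nonneg nn) auto
  have split: "(\<Sum>s<n. h s) = (\<Sum>s<k. h s) + (\<Sum>s=k..<n. h s)" for h :: "nat \<Rightarrow> real"
    unfolding lessThan_atLeast0 using k by (simp add: sum.atLeastLessThan_concat)
  have "(\<Sum>i<k. (lam i)\<^sup>2 * (\<Sum>s<n. (z i s)\<^sup>2))
      = (\<Sum>i<k. (\<Sum>s<k. (lam i)\<^sup>2 * (z i s)\<^sup>2) + (\<Sum>s=k..<n. (lam i)\<^sup>2 * (z i s)\<^sup>2))"
    by (simp only: sum_distrib_left split distrib_left)
  also have "\<dots> \<le> (\<Sum>i<k. (\<Sum>s<k. K * \<epsilon>\<^sup>2 * (R x i s)\<^sup>2) + (\<Sum>s=k..<n. \<gamma> ^ (2 * q - 3) * ((lam s)\<^sup>2 * (N x s i)\<^sup>2)))"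
    by (intro sum_mono add_mono small large) auto
  also have "\<dots> \<le> (\<Sum>i<k. K * \<epsilon> * R x i i + (\<Sum>s=k..<n. \<gamma> ^ (2 * q - 3) * ((lam s)\<^sup>2 * (N x s i)\<^sup>2)))"
  proof (intro sum_mono add_right_mono)
    fix i assume "i \<in> {..<k}"
    hence "(K * \<epsilon>) * (\<epsilon> * (\<Sum>s<k. (R x i s)\<^sup>2)) \<le> (K * \<epsilon>) * R x i i"
      unfolding R_def using K0 sk.eps by (intro mult_left_mono sk.R_sq_le) auto
    thus "(\<Sum>s<k. K * \<epsilon>\<^sup>2 * (R x i s)\<^sup>2) \<le> K * \<epsilon> * R x i i"
      by (simp add: sum_distrib_left power2_eq_square mult_ac)
  qed
  also have "\<dots> = K * \<epsilon> * (\<Sum>i<k. R x i i) + (\<Sum>i<k. \<Sum>s=k..<n. \<gamma> ^ (2 * q - 3) * ((lam s)\<^sup>2 * (N x s i)\<^sup>2))"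
    by (simp add: sum.distrib sum_distrib_left)
  also have "(\<Sum>i<k. \<Sum>s=k..<n. \<gamma> ^ (2 * q - 3) * ((lam s)\<^sup>2 * (N x s i)\<^sup>2))
      = \<gamma> ^ (2 * q - 3) * (\<Sum>s=k..<n. (lam s)\<^sup>2 * (\<Sum>i<k. (N x s i)\<^sup>2))"
    by (subst sum.swap) (simp add: sum_distrib_left)
  finally have "2 * g\<^sup>2 * (\<Sum>i<k. (lam i)\<^sup>2 * (\<Sum>s<n. (z i s)\<^sup>2)) \<le> 2 * g\<^sup>2 *
      (K * \<epsilon> * (\<Sum>i<k. R x i i) + \<gamma> ^ (2 * q - 3) * (\<Sum>s=k..<n. (lam s)\<^sup>2 * (\<Sum>i<k. (N x s i)\<^sup>2)))"
    by (rule mult_left_mono) simp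
  with main show ?thesis unfolding K_def \<gamma>_def w_def by linarith
qed

end

lemma (in prob_space) gaussian_matrix_distr:
  assumes gm: "gaussian_matrix n m \<Omega>" and nm: "0 < n" "0 < m"
  defines "I \<equiv> {..<n} \<times> {..<m}"
  shows "distr M (PiM I (\<lambda>_. std_gauss)) (\<lambda>w. \<lambda>ij\<in>I. \<Omega> w $$ ij) = PiM I (\<lambda>_. std_gauss)"
    and "(\<lambda>w. \<lambda>ij\<in>I. \<Omega> w $$ ij) \<in> measurable M (PiM I (\<lambda>_. std_gauss))"
proof -
  have rv: "random_variable borel (\<lambda>w. \<Omega> w $$ ij)" and
    d: "distr M borel (\<lambda>w. \<Omega> w $$ ij) = std_gauss" if "ij \<in> I" for ij
  proof -
    have D: "distributed M lborel (\<lambda>w. \<Omega> w $$ ij) (\<lambda>x. ennreal (std_normal_density x))"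
      using gm that unfolding gaussian_matrix_def I_def by blast
    show "random_variable borel (\<lambda>w. \<Omega> w $$ ij)" using distributed_measurable[OF D] by simp
    have "distr M borel (\<lambda>w. \<Omega> w $$ ij) = distr M lborel (\<lambda>w. \<Omega> w $$ ij)" by (rule distr_cong) auto
    thus "distr M borel (\<lambda>w. \<Omega> w $$ ij) = std_gauss" using distributed_distr_eq_density[OF D] by simp
  qed
  have ne: "I \<noteq> {}" using nm by (auto simp: I_def)
  have s: "sets (PiM I (\<lambda>_. std_gauss)) = sets (PiM I (\<lambda>_. borel))" by (rule sets_PiM_cong) auto
  have "indep_vars (\<lambda>_. borel) (\<lambda>ij w. \<Omega> w $$ ij) I" using gm unfolding gaussian_matrix_def I_def by blast
  hence "distr M (PiM I (\<lambda>_. borel)) (\<lambda>w. \<lambda>ij\<in>I. \<Omega> w $$ ij) = PiM I (\<lambda>ij. distr M borel (\<lambda>w. \<Omega> w $$ ij))"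
    using indep_vars_iff_distr_eq_PiM'[OF ne, of "\<lambda>ij w. \<Omega> w $$ ij" "\<lambda>_. borel"] rv by blast
  also have "\<dots> = PiM I (\<lambda>_. std_gauss)" by (rule PiM_cong) (use d in auto)
  finally show "distr M (PiM I (\<lambda>_. std_gauss)) (\<lambda>w. \<lambda>ij\<in>I. \<Omega> w $$ ij) = PiM I (\<lambda>_. std_gauss)"
    using distr_cong[OF refl s, of M "\<lambda>w. \<lambda>ij\<in>I. \<Omega> w $$ ij" "\<lambda>w. \<lambda>ij\<in>I. \<Omega> w $$ ij"] by simp
  have "(\<lambda>w. \<lambda>ij\<in>I. \<Omega> w $$ ij) \<in> measurable M (PiM I (\<lambda>_. borel))"
    using rv by (intro measurable_restrict)
  thus "(\<lambda>w. \<lambda>ij\<in>I. \<Omega> w $$ ij) \<in> measurable M (PiM I (\<lambda>_. std_gauss))"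
    using measurable_cong_sets[OF refl s] by blast
qed

context regularized_sketch
begin

lemma expectation_bound:
  fixes p :: nat and \<Phi> a b :: real and d :: "nat \<Rightarrow> real"
  assumes m: "m = k + p" and p: "2 \<le> p" and nn: "0 \<le> \<Phi>" "0 \<le> a" "0 \<le> b" "\<And>s. 0 \<le> d s"
  shows "(\<integral>\<^sup>+x. ennreal (\<Phi> + (a * (\<Sum>i<k. R x i i) + b * (\<Sum>s=k..<n. d s * (\<Sum>i<k. (N x s i)\<^sup>2)))) \<partial>P)
    \<le> ennreal (\<Phi> + (a + b * (\<Sum>s=k..<n. d s)) * (real k / (real p - 1)))"
proof -
  interpret prob_space P by (rule prob_space_PiM_std_gauss)
  let ?E = "real k / (real p - 1)"
  define S where "S = (\<lambda>s x. \<Sum>i<k. (N x s i)\<^sup>2)"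
  define t where "t = (\<lambda>x. \<Sum>i<k. R x i i)"
  have it: "integrable P t"
    unfolding t_def by (rule Bochner_Integration.integrable_sum) (simp add: integrable_R_diag)
  have iS: "integrable P (S s)" if "s \<in> {k..<n}" for s
    unfolding S_def using that by (intro Bochner_Integration.integrable_sum integrable_N_sq) auto
  have S_le: "(\<integral>x. S s x \<partial>P) \<le> (\<integral>x. t x \<partial>P)" if s: "s \<in> {k..<n}" for s
  proof -
    have "(\<integral>x. S s x \<partial>P) = (\<Sum>i<k. \<integral>x. (N x s i)\<^sup>2 \<partial>P)"
      unfolding S_def using s by (intro Bochner_Integration.integral_sum integrable_N_sq) auto
    also have "\<dots> \<le> (\<Sum>i<k. \<integral>x. R x i i \<partial>P)"
      using s by (intro sum_mono expectation_N_sq) auto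
    also have "\<dots> = (\<integral>x. t x \<partial>P)"
      unfolding t_def by (rule Bochner_Integration.integral_sum[symmetric]) (simp add: integrable_R_diag)
    finally show ?thesis .
  qed
  have tE: "(\<integral>x. t x \<partial>P) \<le> ?E"
    using expectation_trace_R p unfolding m t_def by (simp add: field_simps)
  have iN: "integrable P (\<lambda>x. \<Sum>s=k..<n. d s * S s x)"
    by (rule Bochner_Integration.integrable_sum) (simp add: iS)
  have "(\<integral>x. (\<Sum>s=k..<n. d s * S s x) \<partial>P) = (\<Sum>s=k..<n. \<integral>x. d s * S s x \<partial>P)"
    by (rule Bochner_Integration.integral_sum) (simp add: iS)
  also have "\<dots> = (\<Sum>s=k..<n. d s * (\<integral>x. S s x \<partial>P))" by simp
  also have "\<dots> \<le> (\<Sum>s=k..<n. d s * ?E)"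
    by (rule sum_mono, rule mult_left_mono[OF order_trans[OF S_le tE] nn(4)])
  finally have NE: "(\<integral>x. (\<Sum>s=k..<n. d s * S s x) \<partial>P) \<le> (\<Sum>s=k..<n. d s) * ?E"
    by (simp only: sum_distrib_right)
  let ?h = "\<lambda>x. \<Phi> + (a * t x + b * (\<Sum>s=k..<n. d s * S s x))"
  have ih: "integrable P ?h" using it iN by simp
  have t0: "0 \<le> t x" for x unfolding t_def by (rule sum_nonneg) (simp add: R_diag_nonneg)
  have S0: "0 \<le> (\<Sum>s=k..<n. d s * S s x)" for x
    unfolding S_def by (rule sum_nonneg) (simp add: nn(4) sum_nonneg)
  have h0: "0 \<le> ?h x" for x
    using mult_nonneg_nonneg[OF nn(2) t0[of x]] mult_nonneg_nonneg[OF nn(3) S0[of x]] nn(1) by simp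
  have "(\<integral>\<^sup>+x. ennreal (?h x) \<partial>P) = ennreal (\<integral>x. ?h x \<partial>P)"
    by (rule nn_integral_eq_integral[OF ih AE_I2[OF h0]])
  also have "(\<integral>x. ?h x \<partial>P) = \<Phi> + (a * (\<integral>x. t x \<partial>P) + b * (\<integral>x. (\<Sum>s=k..<n. d s * S s x) \<partial>P))"
    using it iN by (simp add: prob_space)
  also have "ennreal \<dots> \<le> ennreal (\<Phi> + (a * ?E + b * ((\<Sum>s=k..<n. d s) * ?E)))"
    by (rule ennreal_leI, rule add_left_mono, rule add_mono)
      (rule mult_left_mono[OF tE nn(2)], rule mult_left_mono[OF NE nn(3)])
  finally show ?thesis by (simp add: algebra_simps S_def t_def)
qed

end

theorem theorem3p4:
  fixes A :: "real mat" and lam :: "nat \<Rightarrow> real" and n k p q :: nat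
    and f :: "real \<Rightarrow> real" and M :: "'a measure" and \<Omega> :: "'a \<Rightarrow> real mat"
  assumes "spsd n A"
    and "ordered_eigenvalues n A lam"
    and "1 \<le> k" and "k < n" and "lam k > 0"
    and "operator_monotone f" and "f 0 = 0"
    and "prob_space M" and "prob_space.gaussian_matrix M n (k + p) \<Omega>"
    and "2 \<le> k" and "2 \<le> p" and "2 \<le> q"
  shows "(\<integral>\<^sup>+ w. ennreal ((frobenius_norm (mat_fun f A - mat_fun f (nystrom A q (\<Omega> w))))\<^sup>2) \<partial>M)
    \<le> ennreal ((1 + 5 * (lam (k + 1) / lam k) powr (2 * (real q - 3 / 2)) * (real k / (real p - 1)))
        * (frobenius_norm (mat_fun f (mat_diag (n - k) (\<lambda>i. lam (k + 1 + i)))))\<^sup>2)"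
proof -
  interpret op_mono f by unfold_locales fact+
  interpret M: prob_space M by fact
  have Ac: "A \<in> carrier_mat n n" and symA: "transpose_mat A = A"
    using \<open>spsd n A\<close> by (auto simp: spsd_def)
  obtain V where V: "orth_mat n V" and A: "A = V * mat_diag n (\<lambda>i. lam (Suc i)) * transpose_mat V"
    using spectral_decomposition_ordered[OF Ac symA] assms(2) by blast
  have Vc: "V \<in> carrier_mat n n" using V by (simp add: orth_mat_def)
  define ev where "ev = (\<lambda>i. lam (Suc i))"
  note A = A[folded ev_def]
  have nonneg: "0 \<le> ev i" if "i < n" for i
    using quadratic_form_eigenvector[OF V that, of ev] \<open>spsd n A\<close> Vc that
    unfolding spsd_def A[symmetric] by (metis col_carrier_vec carrier_matD(2))
  have mono: "ev j \<le> ev i" if "i \<le> j" "j < n" for i j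
    using assms(2) that unfolding ordered_eigenvalues_def ev_def by (auto simp: monotone_on_def)
  have k1: "ev (k - 1) = lam k" using \<open>1 \<le> k\<close> by (simp add: ev_def)
  have t: "0 < ev (k - 1)" using k1 \<open>lam k > 0\<close> by simp
  define g where "g = f (ev (k - 1)) / ev (k - 1)"
  define \<Phi> where "\<Phi> = (\<Sum>i=k..<n. (f (ev i))\<^sup>2)"
  define \<gamma> where "\<gamma> = (ev k / ev (k - 1)) ^ (2 * q - 3)"
  define E where "E = real k / (real p - 1)"
  define K where "K = (\<Sum>i<k. \<Sum>s<k. (ev i)\<^sup>2 * (ev s / ev i) ^ (2 * q - 1))"
  define m where "m = k + p"
  define I where "I = {..<n} \<times> {..<m}"
  have E0: "0 \<le> E" using \<open>2 \<le> p\<close> by (simp add: E_def)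
  have \<Phi>0: "0 \<le> \<Phi>" unfolding \<Phi>_def by (intro sum_nonneg) auto
  have \<gamma>0: "0 \<le> \<gamma>" unfolding \<gamma>_def using nonneg[OF \<open>k < n\<close>] t by simp
  have K0: "0 \<le> K" unfolding K_def using nonneg \<open>k < n\<close>
    by (intro sum_nonneg mult_nonneg_nonneg zero_le_power divide_nonneg_nonneg) auto
  define L where "L = (\<integral>\<^sup>+ w. ennreal ((frobenius_norm (mat_fun f A - mat_fun f (nystrom A q (\<Omega> w))))\<^sup>2) \<partial>M)"
  have gm: "M.gaussian_matrix n m \<Omega>" using assms(9) by (simp add: m_def)
  have nm: "0 < n" "0 < m" using \<open>k < n\<close> \<open>1 \<le> k\<close> by (auto simp: m_def)
  note distr = M.gaussian_matrix_distr[OF gm nm, folded I_def]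
  have bound: "L \<le> ennreal (\<Phi> + (2 * g\<^sup>2 * K * \<epsilon> + 2 * g\<^sup>2 * \<gamma> * (\<Sum>s=k..<n. (ev s)\<^sup>2)) * E)"
    if eps: "0 < \<epsilon>" for \<epsilon>
  proof -
    have sk: "regularized_sketch (\<lambda>a i. V $$ (a, i)) n k \<epsilon>"
      by unfold_locales (use orth_mat_cols[OF V] \<open>k < n\<close> eps in auto)
    interpret sk: regularized_sketch "\<lambda>a i. V $$ (a, i)" n m k \<epsilon> by (rule sk)
    let ?h = "\<lambda>x. \<Phi> + (2 * g\<^sup>2 * K * \<epsilon> * (\<Sum>i<k. sk.R x i i)
        + 2 * g\<^sup>2 * \<gamma> * (\<Sum>s=k..<n. (ev s)\<^sup>2 * (\<Sum>i<k. (sk.N x s i)\<^sup>2)))"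
    let ?x = "\<lambda>w. \<lambda>ij\<in>I. \<Omega> w $$ ij"
    have "L \<le> (\<integral>\<^sup>+ w. ennreal (?h (?x w)) \<partial>M)"
      unfolding L_def
    proof (rule nn_integral_mono, rule ennreal_leI)
      fix w assume "w \<in> space M"
      hence Om: "\<Omega> w \<in> carrier_mat n m" using gm by (simp add: M.gaussian_matrix_def)
      have "(frobenius_norm (mat_fun f A - mat_fun f (nystrom A q (\<Omega> w))))\<^sup>2 \<le> \<Phi> + 2 * g\<^sup>2 *
        (K * \<epsilon> * (\<Sum>i<k. sk.R (?x w) i i) + \<gamma> * (\<Sum>s=k..<n. (ev s)\<^sup>2 * (\<Sum>i<k. (sk.N (?x w) s i)\<^sup>2)))"
        unfolding \<Phi>_def K_def \<gamma>_def
        by (rule frobenius_nystrom_sketch_le[OF V A nonneg mono \<open>2 \<le> q\<close> Om _ \<open>k < n\<close> t g_def sk])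
          (use \<open>1 \<le> k\<close> in \<open>auto simp: I_def\<close>)
      thus "(frobenius_norm (mat_fun f A - mat_fun f (nystrom A q (\<Omega> w))))\<^sup>2 \<le> ?h (?x w)"
        by (simp add: algebra_simps)
    qed
    also have "\<dots> = (\<integral>\<^sup>+ x. ennreal (?h x) \<partial>distr M (PiM I (\<lambda>_. std_gauss)) ?x)"
    proof -
      have "(\<lambda>x. sk.N x s i) \<in> borel_measurable (PiM I (\<lambda>_. std_gauss))" if "i < k" for s i
        unfolding sk.N_def I_def using that by (intro borel_measurable_sum borel_measurable_times sk.G_meas sk.X_meas) auto
      moreover have "(\<lambda>x. sk.R x i i) \<in> borel_measurable (PiM I (\<lambda>_. std_gauss))" if "i < k" for i
        using sk.R_meas[OF that that] by (simp add: I_def)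
      ultimately have "(\<lambda>x. ennreal (?h x)) \<in> borel_measurable (PiM I (\<lambda>_. std_gauss))"
        by (intro measurable_compose[OF _ measurable_ennreal] borel_measurable_add borel_measurable_times
            borel_measurable_sum borel_measurable_power borel_measurable_const) auto
      thus ?thesis by (intro nn_integral_distr[symmetric, OF distr(2)]) simp
    qed
    also have "\<dots> = (\<integral>\<^sup>+ x. ennreal (?h x) \<partial>PiM I (\<lambda>_. std_gauss))" unfolding distr(1) ..
    also have "\<dots> \<le> ennreal (\<Phi> + (2 * g\<^sup>2 * K * \<epsilon> + 2 * g\<^sup>2 * \<gamma> * (\<Sum>s=k..<n. (ev s)\<^sup>2)) * E)"
      unfolding I_def E_def
      by (rule sk.expectation_bound[OF m_def \<open>2 \<le> p\<close> \<Phi>0]) (use K0 \<gamma>0 eps in auto)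
    finally show ?thesis .
  qed
  define S where "S = (\<Sum>s=k..<n. (ev s)\<^sup>2)"
  have "L \<le> ennreal (\<Phi> + 2 * g\<^sup>2 * \<gamma> * S * E)"
  proof (rule ennreal_le_epsilon)
    fix e :: real assume e: "0 < e"
    define c where "c = 2 * g\<^sup>2 * K * E"
    have c: "0 \<le> c" using K0 E0 by (simp add: c_def)
    define \<epsilon> where "\<epsilon> = e / (c + 1)"
    have \<epsilon>: "0 < \<epsilon>" "c * \<epsilon> \<le> e" using c e by (auto simp: \<epsilon>_def field_simps)
    have "L \<le> ennreal (\<Phi> + 2 * g\<^sup>2 * \<gamma> * S * E + c * \<epsilon>)"
      using bound[OF \<epsilon>(1)] by (simp add: S_def c_def algebra_simps)
    also have "\<dots> \<le> ennreal (\<Phi> + 2 * g\<^sup>2 * \<gamma> * S * E + e)" using \<epsilon> by (intro ennreal_leI) simp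
    also have "\<dots> = ennreal (\<Phi> + 2 * g\<^sup>2 * \<gamma> * S * E) + ennreal e"
      using e \<Phi>0 \<gamma>0 E0 by (intro ennreal_plus) (auto simp: S_def intro!: add_nonneg_nonneg mult_nonneg_nonneg sum_nonneg)
    finally show "L \<le> ennreal (\<Phi> + 2 * g\<^sup>2 * \<gamma> * S * E) + ennreal e" .
  qed
  also have "\<dots> \<le> ennreal ((1 + 5 * \<gamma> * E) * \<Phi>)"
  proof (rule ennreal_leI)
    have "g\<^sup>2 * S \<le> \<Phi>"
      unfolding S_def \<Phi>_def sum_distrib_left
    proof (rule sum_mono)
      fix s assume "s \<in> {k..<n}"
      hence s: "k \<le> s" "s < n" by auto
      have "g * ev s \<le> f (ev s)"
        using ratio_antimono[of "ev s" "ev (k - 1)"] mono[of "k - 1" s] s nonneg[OF s(2)] \<open>f 0 = 0\<close> t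
        by (cases "ev s = 0") (auto simp: g_def field_simps)
      moreover have "0 \<le> g * ev s" using nonneg[OF s(2)] f_nonneg[of "ev (k - 1)"] t by (simp add: g_def)
      ultimately have "(g * ev s)\<^sup>2 \<le> (f (ev s))\<^sup>2" by (intro power_mono)
      thus "g\<^sup>2 * (ev s)\<^sup>2 \<le> (f (ev s))\<^sup>2" by (simp add: power_mult_distrib)
    qed
    hence "2 * (\<gamma> * E) * (g\<^sup>2 * S) \<le> 5 * (\<gamma> * E) * \<Phi>"
      using \<gamma>0 E0 \<Phi>0 by (intro mult_mono mult_nonneg_nonneg) (auto simp: S_def intro!: sum_nonneg)
    thus "\<Phi> + 2 * g\<^sup>2 * \<gamma> * S * E \<le> (1 + 5 * \<gamma> * E) * \<Phi>" by (simp add: algebra_simps)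
  qed
  also have "\<gamma> = (lam (k + 1) / lam k) powr (2 * (real q - 3 / 2))"
  proof -
    have e: "2 * (real q - 3 / 2) = real (2 * q - 3)" using \<open>2 \<le> q\<close> by (simp add: of_nat_diff)
    define y where "y = lam (k + 1) / lam k"
    have y: "0 \<le> y" using nonneg[OF \<open>k < n\<close>] \<open>lam k > 0\<close> by (simp add: y_def ev_def)
    have "\<gamma> = y ^ (2 * q - 3)" unfolding \<gamma>_def k1 by (simp add: ev_def y_def)
    also have "\<dots> = y powr real (2 * q - 3)"
    proof (cases "y = 0")
      case True
      thus ?thesis using \<open>2 \<le> q\<close> by (simp add: power_0_left)
    next
      case False
      thus ?thesis using y powr_realpow[of y "2 * q - 3"] by linarith
    qed
    finally show ?thesis unfolding e y_def .
  qed
  also have "\<Phi> = (frobenius_norm (mat_fun f (mat_diag (n - k) (\<lambda>i. lam (k + 1 + i)))))\<^sup>2"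
  proof -
    let ?d = "\<lambda>i. f (lam (k + 1 + i))"
    have "(frobenius_norm (mat_diag (n - k) ?d))\<^sup>2 = (\<Sum>i<n - k. (?d i)\<^sup>2)"
      using frobenius_norm_conj_diag[OF orth_mat_one, of "n - k" ?d]
      by (simp add: left_mult_one_mat[OF mat_diag_dim] right_mult_one_mat[OF mat_diag_dim])
    also have "\<dots> = \<Phi>"
      unfolding \<Phi>_def ev_def
      by (rule sum.reindex_bij_witness[of _ "\<lambda>i. i - k" "\<lambda>i. i + k"]) (auto simp: add.commute)
    finally show ?thesis unfolding mat_fun_diag by simp
  qed
  finally show ?thesis unfolding L_def E_def by simp
qed

end
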